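(* Let $p_1,p_2:\mathbb{Z}\to\mathbb{Z}$ be polynomials with $\deg(p_1),\deg(p_2)\geq 2$. There exist two ergodic measure preserving transformations $T,S$ of a standard probability space $(X,\mathcal{X},\mu)$, with $h_\mu(X,T)=h_\mu(X,S)=0$, and $A\in\mathcal{X}$ with $\mu(A)>0$, such that the averages $$\frac{1}{N}\sum_{n=0}^{N-1}\left(1_A\circ T^{p_1(n)}\right)\left(1_A\circ S^{p_2(n)}\right)$$ do not converge in $L^2(\mu)$ as $N\to\infty$.
   Context: $h_\mu(X,T)$ denotes the measure-theoretic (Kolmogorov–Sinai) entropy of $T$ with respect to $\mu$. $T$ and $S$ are not assumed to commute; they are invertible, so that negative iterates make sense. *)

theory Defs
  imports "HOL-Probability.Probability" "HOL-Computational_Algebra.Polynomial"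
begin

text \<open>The Polish topology on the carrier is only required to exist; it need not be a subspace
  topology of an ambient topological type. Since a Polish space has at most continuum many points,
  every standard probability space therefore has a copy whose carrier is a set of reals.\<close>

definition standard_prob_space :: "'a measure \<Rightarrow> bool" where
  "standard_prob_space M \<longleftrightarrow> prob_space M \<and>
     (\<exists>X. topspace X = space M \<and> completely_metrizable_space X \<and> second_countable X \<and>
          sets M = sigma_sets (topspace X) {U. openin X U})"

definition invertible_mpt :: "'a measure \<Rightarrow> ('a \<Rightarrow> 'a) \<Rightarrow> bool" where
  "invertible_mpt M T \<longleftrightarrow> bij_betw T (space M) (space M) \<and>
     T \<in> measurable M M \<and> the_inv_into (space M) T \<in> measurable M M \<and> distr M M T = M"

definition ergodic :: "'a measure \<Rightarrow> ('a \<Rightarrow> 'a) \<Rightarrow> bool" where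
  "ergodic M T \<longleftrightarrow>
     (\<forall>A\<in>sets M. T -` A \<inter> space M = A \<longrightarrow> measure M A = 0 \<or> measure M A = 1)"

definition int_iterate :: "'a measure \<Rightarrow> ('a \<Rightarrow> 'a) \<Rightarrow> int \<Rightarrow> 'a \<Rightarrow> 'a" where
  "int_iterate M T k =
     (if k \<ge> 0 then T ^^ nat k else the_inv_into (space M) T ^^ nat (- k))"

text \<open>Kolmogorov--Sinai entropy, via finite measurable partitions.\<close>

definition finite_partition :: "'a measure \<Rightarrow> 'a set set \<Rightarrow> bool" where
  "finite_partition M P \<longleftrightarrow> finite P \<and> P \<subseteq> sets M \<and> partition_on (space M) P"

text \<open>The convention \<open>0 log 0 = 0\<close> holds because of the factor \<open>measure M A\<close>.\<close>

definition partition_entropy :: "'a measure \<Rightarrow> 'a set set \<Rightarrow> real" where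
  "partition_entropy M P = - (\<Sum>A\<in>P. measure M A * ln (measure M A))"

definition pullback_partition :: "'a measure \<Rightarrow> ('a \<Rightarrow> 'a) \<Rightarrow> 'a set set \<Rightarrow> 'a set set" where
  "pullback_partition M T P = (\<lambda>A. T -` A \<inter> space M) ` P"

text \<open>The join of the partitions \<open>T\<^sup>-\<^sup>i P\<close> over \<open>i < n\<close>; meaningful for \<open>n > 0\<close>.\<close>

definition iterated_join :: "'a measure \<Rightarrow> ('a \<Rightarrow> 'a) \<Rightarrow> 'a set set \<Rightarrow> nat \<Rightarrow> 'a set set" where
  "iterated_join M T P n = common_refinement ((\<lambda>i. pullback_partition M (T ^^ i) P) ` {..<n})"

definition entropy_wrt :: "'a measure \<Rightarrow> ('a \<Rightarrow> 'a) \<Rightarrow> 'a set set \<Rightarrow> ereal" where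
  "entropy_wrt M T P = lim (\<lambda>n. ereal (partition_entropy M (iterated_join M T P n) / real n))"

definition KS_entropy :: "'a measure \<Rightarrow> ('a \<Rightarrow> 'a) \<Rightarrow> ereal" where
  "KS_entropy M T = (SUP P\<in>{P. finite_partition M P}. entropy_wrt M T P)"

definition L2_convergent :: "'a measure \<Rightarrow> (nat \<Rightarrow> 'a \<Rightarrow> real) \<Rightarrow> bool" where
  "L2_convergent M F \<longleftrightarrow>
     (\<exists>f\<in>borel_measurable M. integrable M (\<lambda>x. (f x)\<^sup>2) \<and>
        (\<lambda>N. \<integral>\<^sup>+ x. ennreal ((F N x - f x)\<^sup>2) \<partial>M) \<longlonglongrightarrow> 0)"

text \<open>The coefficients need not be integers, as in \<open>n (n - 1) / 2\<close>; integrality of the values at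
  integers forces them to be rational.\<close>

definition int_valued_poly :: "(int \<Rightarrow> int) \<Rightarrow> real poly \<Rightarrow> bool" where
  "int_valued_poly p q \<longleftrightarrow> (\<forall>n. real_of_int (p n) = poly q (real_of_int n))"

end

theory Submission
  imports Defs
begin

text \<open>The two transformations act on \<open>\<Omega> \<times> {0,1}\<^sup>\<int>\<close>: a point is a base point \<open>w\<close> together with
  a bi-infinite sequence \<open>y\<close> of independent fair coins. The map \<open>T (w, y) = (R w, y (\<cdot> + \<phi> w))\<close>
  rotates \<open>w\<close> and shifts the coins by an amount depending on \<open>w\<close>. If \<open>A\<close> says that coin \<open>0\<close> shows heads,
  then \<open>T\<^sup>t (w, y) \<in> A\<close> is decided by coin number \<open>\<phi>\<^sub>t w\<close>, the sum of \<open>\<phi>\<close> over the first \<open>t\<close> points of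
  the orbit of \<open>w\<close>. Coins may be renamed by a permutation that depends on \<open>w\<close>, and this preserves the
  measure. So if the coins read by \<open>T\<close> at the times \<open>p\<^sub>1 n\<close> are distinct for the \<open>n\<close> in a long block, and
  likewise for \<open>p\<^sub>2 n\<close>, then a conjugate \<open>S\<close> of \<open>T\<close> by a renaming can be made to read at time \<open>p\<^sub>2 n\<close>
  exactly the coin that \<open>T\<close> reads at time \<open>p\<^sub>1 n\<close>, or a different one. The event that both \<open>T\<close> at time
  \<open>p\<^sub>1 n\<close> and \<open>S\<close> at time \<open>p\<^sub>2 n\<close> lie in \<open>A\<close> then has probability \<open>1/2\<close> or \<open>1/4\<close>. Alternating between the two
  along blocks that dwarf everything before them makes the integrals of the averages oscillate
  (\<open>block_correlation\<close>, \<open>block_average_not_convergent\<close>), which excludes convergence in \<open>L\<^sup>2\<close>.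

  The point is to have distinct coins at polynomial times although the entropy vanishes. This is
  possible because a polynomial of degree at least two has gaps that tend to infinity. Take
  \<open>\<Omega> = \<Prod>\<^sub>k \<int>/Q\<^sub>k\<close> with pairwise coprime, very rapidly growing \<open>Q\<^sub>k\<close>, let \<open>R\<close> add \<open>1\<close> in every coordinate, and
  let \<open>\<phi>\<close> be the sum over \<open>k\<close> of the coboundaries of \<open>w \<mapsto> w\<^sub>k div D\<^sub>k\<close>. Write \<open>W\<^sub>k\<close> for the product of
  the \<open>Q\<^sub>j\<close> with \<open>j < k\<close>. For times up to a bound \<open>H\<^sub>k\<close>, with probability close to \<open>1\<close> the coordinates above \<open>k\<close> contribute nothing to \<open>\<phi>\<^sub>t\<close>, those
  below \<open>k\<close> contribute at most \<open>W\<^sub>k\<close> in absolute value, and coordinate \<open>k\<close> contributes \<open>t/D\<^sub>k\<close> up to an error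
  of \<open>1\<close>. Hence \<open>\<phi>\<^sub>t\<close> increases strictly along any sequence of times whose gaps exceed a fixed multiple of
  \<open>D\<^sub>k W\<^sub>k\<close> (\<open>cocycle_good_less\<close>), and such are the values of the polynomials in block number \<open>k\<close>.

  At time \<open>W\<^sub>k\<close> the coordinates below \<open>k\<close> have returned and \<open>\<phi>\<close> has summed to \<open>0\<close> on most of the space. So
  \<open>T\<close> is rigid: \<open>T\<^sup>m\<close> tends to the identity along these times (\<open>T_rigid\<close>), and rigidity forces entropy zero
  for every finite partition at once (\<open>rigid_imp_KS_entropy_0\<close>). For ergodicity, one averages correlations
  over windows of length \<open>W\<^sub>k\<close> on which \<open>\<phi>\<^sub>t\<close> is large: the coins decouple, and by the Chinese remainder
  theorem the first \<open>k\<close> coordinates are exactly equidistributed (\<open>T_ergodic\<close>). The conjugate \<open>S\<close> inherits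
  both properties. If a polynomial tends to \<open>-\<infinity>\<close>, the corresponding transformation is replaced by its
  inverse. Finally the system is copied to a set of reals along an arbitrary injection.\<close>

section \<open>Rigidity forces zero entropy\<close>

text \<open>The one-sided difference suffices: for a measure preserving \<open>T\<close> the two differences of \<open>A\<close> and
  its preimage have the same measure.\<close>

definition rigid :: "'a measure \<Rightarrow> ('a \<Rightarrow> 'a) \<Rightarrow> bool" where
  "rigid M T \<longleftrightarrow> (\<exists>m::nat \<Rightarrow> nat. (\<forall>k. 0 < m k) \<and>
     (\<forall>A\<in>sets M. (\<lambda>k. measure M (((T ^^ m k) -` A \<inter> space M) - A)) \<longlonglongrightarrow> 0))"

definition itinerary :: "('a \<Rightarrow> 'a) \<Rightarrow> ('a \<Rightarrow> 'b) \<Rightarrow> nat \<Rightarrow> 'a \<Rightarrow> 'b list" where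
  "itinerary T c n x = map (\<lambda>i. c ((T ^^ i) x)) [0..<n]"

definition cell_of :: "'a set set \<Rightarrow> 'a \<Rightarrow> 'a set" where
  "cell_of P x = (THE A. A \<in> P \<and> x \<in> A)"

lemma cell_of_eq:
  assumes "partition_on X P" "A \<in> P" "x \<in> A"
  shows "cell_of P x = A"
  unfolding cell_of_def
proof (rule the_equality)
  show "A \<in> P \<and> x \<in> A" using assms by simp
  fix B assume "B \<in> P \<and> x \<in> B"
  then show "B = A" using assms by (metis disjointD disjoint_iff partition_onD2)
qed

lemma cell_of_in:
  assumes "partition_on X P" "x \<in> X"
  shows "cell_of P x \<in> P" "x \<in> cell_of P x"
proof -
  obtain A where "A \<in> P" "x \<in> A" using assms by (metis UnionE partition_onD1)
  with cell_of_eq[OF assms(1)] show "cell_of P x \<in> P" "x \<in> cell_of P x" by auto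
qed

lemma funpow_space:
  assumes "T \<in> measurable M M" "x \<in> space M"
  shows "(T ^^ i) x \<in> space M"
  by (induction i) (use assms in \<open>auto dest: measurable_space\<close>)

lemma funpow_measurable [measurable (raw)]:
  assumes "T \<in> measurable M M"
  shows "T ^^ i \<in> measurable M M"
  by (rule measurable_compose_n[OF assms])

lemma distr_funpow:
  assumes T: "T \<in> measurable M M" and d: "distr M M T = M"
  shows "distr M M (T ^^ i) = M"
proof (induction i)
  case 0 show ?case by (simp add: id_def distr_id)
next
  case (Suc i)
  have "distr M M (T ^^ Suc i) = distr (distr M M (T ^^ i)) M T"
    using T by (subst distr_distr) (auto simp: funpow_measurable)
  then show ?case using Suc d by (simp add: comp_def)
qed

lemma measure_funpow_vimage:
  assumes T: "T \<in> measurable M M" and d: "distr M M T = M" and A: "A \<in> sets M"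
  shows "measure M ((T ^^ i) -` A \<inter> space M) = measure M A"
  using distr_funpow[OF T d, of i] A measure_distr[OF funpow_measurable[OF T], of A i] by simp

text \<open>Replaces the join of partitions by the fibres of one finite-valued map, so that entropies of
  joins become entropies of random variables. Pullbacks for different exponents may coincide as
  families of sets, therefore the proof compares cells and not the indices of the pullbacks.\<close>

lemma iterated_join_eq_itinerary_fibres:
  assumes P: "partition_on (space M) P" and T: "T \<in> measurable M M" and n: "0 < n"
  shows "iterated_join M T P n =
    (\<lambda>v. itinerary T (cell_of P) n -` {v} \<inter> space M) ` (itinerary T (cell_of P) n ` space M)"
    (is "_ = ?R")
proof -
  let ?c = "cell_of P"
  let ?pb = "\<lambda>i. pullback_partition M (T ^^ i) P"
  have fibre: "itinerary T ?c n -` {itinerary T ?c n x} \<inter> space M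
      = {z\<in>space M. \<forall>i<n. ?c ((T ^^ i) z) = ?c ((T ^^ i) x)}" for x
    by (auto simp: itinerary_def)
  have cell: "Q = {z\<in>space M. ?c ((T ^^ i) z) = ?c ((T ^^ i) x)}"
    if Q: "Q \<in> ?pb i" "x \<in> Q" for Q i x
  proof -
    obtain A where A: "A \<in> P" "Q = (T ^^ i) -` A \<inter> space M"
      using Q(1) unfolding pullback_partition_def by blast
    then have "?c ((T ^^ i) x) = A" using that cell_of_eq[OF P] by auto
    then show ?thesis using A cell_of_eq[OF P] cell_of_in[OF P] funpow_space[OF T] by auto
  qed
  have mem: "{z\<in>space M. ?c ((T ^^ i) z) = ?c ((T ^^ i) x)} \<in> ?pb i" if "x \<in> space M" for i x
  proof -
    have "?c ((T ^^ i) x) \<in> P" using cell_of_in[OF P] funpow_space[OF T that] by auto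
    then have "(T ^^ i) -` ?c ((T ^^ i) x) \<inter> space M \<in> ?pb i"
      by (auto simp: pullback_partition_def)
    moreover have "x \<in> (T ^^ i) -` ?c ((T ^^ i) x) \<inter> space M"
      using cell_of_in[OF P funpow_space[OF T that]] that by auto
    ultimately show ?thesis using cell by metis
  qed
  show ?thesis
  proof (intro equalityI subsetI)
    fix X assume "X \<in> iterated_join M T P n"
    then obtain f where f: "f \<in> (\<Pi> Q\<in>?pb ` {..<n}. Q)" "X = \<Inter> (f ` ?pb ` {..<n})" "X \<noteq> {}"
      unfolding iterated_join_def common_refinement by auto
    then obtain x where x: "x \<in> X" by auto
    have fi: "f (?pb i) = {z\<in>space M. ?c ((T ^^ i) z) = ?c ((T ^^ i) x)}" if "i < n" for i
      using f x that by (intro cell) auto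
    have "f (?pb 0) \<in> f ` ?pb ` {..<n}" using n by (intro imageI) simp
    then have "x \<in> f (?pb 0)" using x unfolding f(2) by (rule InterD[rotated])
    then have xs: "x \<in> space M" using fi[OF n] by auto
    have "X = {z\<in>space M. \<forall>i<n. ?c ((T ^^ i) z) = ?c ((T ^^ i) x)}"
      using f(2) fi n by auto
    then have "X = itinerary T ?c n -` {itinerary T ?c n x} \<inter> space M" by (simp only: fibre)
    then show "X \<in> ?R" using xs by blast
  next
    fix X assume "X \<in> ?R"
    then obtain x where x: "x \<in> space M" and X: "X = {z\<in>space M. \<forall>i<n. ?c ((T ^^ i) z) = ?c ((T ^^ i) x)}"
      using fibre by auto
    define f where "f Q = (THE q. q \<in> Q \<and> x \<in> q)" for Q :: "'a set set"
    have fi: "f (?pb i) = {z\<in>space M. ?c ((T ^^ i) z) = ?c ((T ^^ i) x)}" for i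
      unfolding f_def
    proof (rule the_equality)
      show "{z\<in>space M. ?c ((T ^^ i) z) = ?c ((T ^^ i) x)} \<in> ?pb i \<and>
          x \<in> {z\<in>space M. ?c ((T ^^ i) z) = ?c ((T ^^ i) x)}"
        using mem[OF x] x by simp
    qed (use cell in blast)
    have "f (?pb i) \<in> ?pb i" for i unfolding fi by (rule mem[OF x])
    then have "f \<in> (\<Pi> Q\<in>?pb ` {..<n}. Q)" by blast
    moreover have "X = \<Inter> (f ` ?pb ` {..<n})" unfolding image_image fi X using n by auto
    moreover have "X \<noteq> {}" using x X by auto
    ultimately show "X \<in> iterated_join M T P n"
      unfolding iterated_join_def common_refinement by blast
  qed
qed


definition law :: "'a measure \<Rightarrow> ('a \<Rightarrow> 'b) \<Rightarrow> 'b \<Rightarrow> real" where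
  "law M X v = measure M (X -` {v} \<inter> space M)"

definition ent :: "'a measure \<Rightarrow> ('a \<Rightarrow> 'b) \<Rightarrow> real" where
  "ent M X = - (\<Sum>v\<in>X ` space M. law M X v * ln (law M X v))"

lemma law_nonneg: "0 \<le> law M X v"
  by (simp add: law_def)

lemma law_eq_0:
  assumes "v \<notin> X ` space M" shows "law M X v = 0"
proof -
  have "X -` {v} \<inter> space M = {}" using assms by auto
  then show ?thesis by (simp add: law_def)
qed

context prob_space begin

lemma law_comp:
  assumes X: "simple_function M X"
  shows "law M (\<lambda>x. g (X x)) u = (\<Sum>v\<in>{v\<in>X ` space M. g v = u}. law M X v)"
proof -
  have "(\<lambda>x. g (X x)) -` {u} \<inter> space M = (\<Union>v\<in>{v\<in>X ` space M. g v = u}. X -` {v} \<inter> space M)"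
    by auto
  moreover have "measure M \<dots> = (\<Sum>v\<in>{v\<in>X ` space M. g v = u}. measure M (X -` {v} \<inter> space M))"
    using simple_functionD[OF X]
    by (intro finite_measure_finite_Union) (auto simp: disjoint_family_on_def)
  ultimately show ?thesis by (simp add: law_def)
qed

text \<open>Grouping the values of \<open>X\<close> by their image under \<open>g\<close>. This lets the entropies of several
  functions of \<open>X\<close> be written as sums over the values of \<open>X\<close> alone.\<close>

lemma sum_law_comp:
  assumes X: "simple_function M X"
  shows "(\<Sum>u\<in>(\<lambda>x. g (X x)) ` space M. law M (\<lambda>x. g (X x)) u * h u) = (\<Sum>v\<in>X ` space M. law M X v * h (g v))"
proof -
  have "(\<Sum>v\<in>X ` space M. law M X v * h (g v)) =
     (\<Sum>u\<in>(\<lambda>x. g (X x)) ` space M. \<Sum>v\<in>{v\<in>X ` space M. g v = u}. law M X v * h (g v))"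
    using simple_functionD[OF X]
    by (intro sum.group[symmetric]) (auto simp: image_image[symmetric, of g X])
  also have "\<dots> = (\<Sum>u\<in>(\<lambda>x. g (X x)) ` space M. law M (\<lambda>x. g (X x)) u * h u)"
    by (intro sum.cong refl) (simp add: law_comp[OF X] sum_distrib_right)
  finally show ?thesis ..
qed

lemma ent_comp:
  assumes X: "simple_function M X"
  shows "ent M (\<lambda>x. g (X x)) = - (\<Sum>v\<in>X ` space M. law M X v * ln (law M (\<lambda>x. g (X x)) (g v)))"
  unfolding ent_def using sum_law_comp[OF X, of g "\<lambda>u. ln (law M (\<lambda>x. g (X x)) u)"] by simp

lemma law_comp_ge:
  assumes X: "simple_function M X" and v: "v \<in> X ` space M"
  shows "law M X v \<le> law M (\<lambda>x. g (X x)) (g v)"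
  using simple_functionD[OF X] v unfolding law_comp[OF X]
  by (intro member_le_sum) (auto simp: law_nonneg)

lemma sum_law: assumes X: "simple_function M X" shows "(\<Sum>v\<in>X ` space M. law M X v) = 1"
proof -
  have "law M (\<lambda>x. ()) () = (\<Sum>v\<in>X ` space M. law M X v)"
    using law_comp[OF X, of "\<lambda>_. ()" "()"] by simp
  moreover have "law M (\<lambda>x. ()) () = 1" using prob_space by (simp add: law_def)
  ultimately show ?thesis by simp
qed

text \<open>The conditional entropy of \<open>X\<close> given \<open>Y\<close> is at most the one given \<open>f Y\<close>, with the conditional
  entropies written as differences. The law under which \<open>X\<close> and \<open>Y\<close> are conditionally independent given
  \<open>f Y\<close> has total mass \<open>1\<close>; Gibbs' inequality, that is \<open>ln t \<le> t - 1\<close>, compares it with the true joint law.\<close>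

lemma ent_submodular:
  assumes X: "simple_function M X" and Y: "simple_function M Y"
  shows "ent M (\<lambda>x. (Y x, X x)) + ent M (\<lambda>x. f (Y x)) \<le> ent M Y + ent M (\<lambda>x. (f (Y x), X x))"
proof -
  define W where "W x = (Y x, X x)" for x
  have W: "simple_function M W" unfolding W_def using X Y by simp
  define pY where "pY w = law M Y (fst w)" for w :: "'c \<times> 'b"
  define pZ where "pZ w = law M (\<lambda>x. f (Y x)) (f (fst w))" for w :: "'c \<times> 'b"
  define pXZ where "pXZ w = law M (\<lambda>x. (f (Y x), X x)) (f (fst w), snd w)" for w
  let ?p = "law M W" and ?V = "W ` space M"
  have fin: "finite ?V" "finite (X ` space M)" "finite (Y ` space M)"
    using simple_functionD W X Y by blast+
  have eY: "ent M Y = - (\<Sum>w\<in>?V. ?p w * ln (pY w))"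
    using ent_comp[OF W, of fst] by (simp add: W_def pY_def)
  have eZ: "ent M (\<lambda>x. f (Y x)) = - (\<Sum>w\<in>?V. ?p w * ln (pZ w))"
    using ent_comp[OF W, of "\<lambda>w. f (fst w)"] by (simp add: W_def pZ_def)
  have eXZ: "ent M (\<lambda>x. (f (Y x), X x)) = - (\<Sum>w\<in>?V. ?p w * ln (pXZ w))"
    using ent_comp[OF W, of "\<lambda>w. (f (fst w), snd w)"] by (simp add: W_def pXZ_def)
  have eW: "ent M (\<lambda>x. (Y x, X x)) = - (\<Sum>w\<in>?V. ?p w * ln (?p w))"
    by (simp add: ent_def W_def[abs_def])
  have ge: "?p w \<le> pY w" "?p w \<le> pZ w" "?p w \<le> pXZ w" if "w \<in> ?V" for w
    using law_comp_ge[OF W that, of fst] law_comp_ge[OF W that, of "\<lambda>w. f (fst w)"]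
      law_comp_ge[OF W that, of "\<lambda>w. (f (fst w), snd w)"]
    by (simp_all add: W_def pY_def pZ_def pXZ_def)
  have gibbs: "(\<Sum>w\<in>?V. ?p w * (ln (pXZ w) + ln (pY w) - ln (?p w) - ln (pZ w)))
      \<le> (\<Sum>w\<in>?V. pXZ w * pY w / pZ w - ?p w)"
  proof (intro sum_mono)
    fix w assume w: "w \<in> ?V"
    show "?p w * (ln (pXZ w) + ln (pY w) - ln (?p w) - ln (pZ w)) \<le> pXZ w * pY w / pZ w - ?p w"
    proof (cases "?p w = 0")
      case True
      have "0 \<le> pXZ w * pY w / pZ w" by (simp add: pXZ_def pY_def pZ_def law_nonneg)
      then show ?thesis using True by simp
    next
      case False
      then have pos: "0 < ?p w" "0 < pY w" "0 < pZ w" "0 < pXZ w"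
        using ge[OF w] law_nonneg[of M W w] by linarith+
      have "ln (pXZ w) + ln (pY w) - ln (?p w) - ln (pZ w) = ln (pXZ w * pY w / (?p w * pZ w))"
        using pos by (simp add: ln_mult ln_div)
      also have "\<dots> \<le> pXZ w * pY w / (?p w * pZ w) - 1"
        using pos by (intro ln_le_minus_one) simp
      finally have "?p w * (ln (pXZ w) + ln (pY w) - ln (?p w) - ln (pZ w))
          \<le> ?p w * (pXZ w * pY w / (?p w * pZ w) - 1)"
        using pos by (intro mult_left_mono) auto
      also have "\<dots> = pXZ w * pY w / pZ w - ?p w" using pos by (simp add: right_diff_distrib)
      finally show ?thesis .
    qed
  qed
  have mass: "(\<Sum>w\<in>?V. pXZ w * pY w / pZ w) \<le> 1"
  proof -
    have "(\<Sum>w\<in>?V. pXZ w * pY w / pZ w) \<le> (\<Sum>w\<in>Y ` space M \<times> X ` space M. pXZ w * pY w / pZ w)"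
      using fin by (intro sum_mono2) (auto simp: W_def pXZ_def pY_def pZ_def law_nonneg)
    also have "\<dots> = (\<Sum>y\<in>Y ` space M. \<Sum>x\<in>X ` space M. pXZ (y, x) * pY (y, x) / pZ (y, x))"
      by (simp add: sum.cartesian_product)
    also have "\<dots> \<le> (\<Sum>y\<in>Y ` space M. law M Y y)"
    proof (intro sum_mono)
      fix y
      have ZX: "simple_function M (\<lambda>x. (f (Y x), X x))"
        using X simple_function_compose[OF Y, of f] by (simp add: comp_def)
      have "law M (\<lambda>x. f (Y x)) (f y) = 
         (\<Sum>v\<in>{v\<in>(\<lambda>x. (f (Y x), X x)) ` space M. fst v = f y}. law M (\<lambda>x. (f (Y x), X x)) v)"
        using law_comp[OF ZX, of fst "f y"] by simp
      also have "\<dots> = (\<Sum>v\<in>Pair (f y) ` X ` space M. law M (\<lambda>x. (f (Y x), X x)) v)"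
      proof (rule sum.mono_neutral_left)
        show "\<forall>v\<in>Pair (f y) ` X ` space M - {v\<in>(\<lambda>x. (f (Y x), X x)) ` space M. fst v = f y}.
            law M (\<lambda>x. (f (Y x), X x)) v = 0"
          by (intro ballI law_eq_0) auto
      qed (use fin in auto)
      also have "\<dots> = (\<Sum>x\<in>X ` space M. pXZ (y, x))"
        by (subst sum.reindex) (auto simp: inj_on_def pXZ_def)
      finally have *: "(\<Sum>x\<in>X ` space M. pXZ (y, x)) = law M (\<lambda>x. f (Y x)) (f y)" ..
      have "(\<Sum>x\<in>X ` space M. pXZ (y, x) * pY (y, x) / pZ (y, x)) =
         (\<Sum>x\<in>X ` space M. pXZ (y, x)) * law M Y y / law M (\<lambda>x. f (Y x)) (f y)"
        by (simp add: pY_def pZ_def sum_distrib_right sum_divide_distrib)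
      also have "\<dots> \<le> law M Y y"
        unfolding * by (simp add: law_nonneg)
      finally show "(\<Sum>x\<in>X ` space M. pXZ (y, x) * pY (y, x) / pZ (y, x)) \<le> law M Y y" .
    qed
    finally show ?thesis using sum_law[OF Y] by simp
  qed
  have "(\<Sum>w\<in>?V. ?p w * (ln (pXZ w) + ln (pY w) - ln (?p w) - ln (pZ w))) \<le> 0"
    using gibbs mass by (simp add: sum_subtractf sum_law[OF W])
  then show ?thesis unfolding eY eZ eXZ eW
    by (simp add: sum_subtractf sum.distrib algebra_simps)
qed


lemma ent_superset:
  assumes "finite V" "X ` space M \<subseteq> V"
  shows "ent M X = - (\<Sum>v\<in>V. law M X v * ln (law M X v))"
proof -
  have "(\<Sum>v\<in>X ` space M. law M X v * ln (law M X v)) = (\<Sum>v\<in>V. law M X v * ln (law M X v))"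
    using assms by (intro sum.mono_neutral_left) (auto simp: law_eq_0)
  then show ?thesis by (simp add: ent_def)
qed

lemma ent_inj:
  assumes g: "inj_on g (X ` space M)"
  shows "ent M (\<lambda>x. g (X x)) = ent M X"
proof -
  have "(\<lambda>x. g (X x)) ` space M = g ` (X ` space M)" by auto
  moreover have "law M (\<lambda>x. g (X x)) (g v) = law M X v" if "v \<in> X ` space M" for v
  proof -
    have "(\<lambda>x. g (X x)) -` {g v} \<inter> space M = X -` {v} \<inter> space M"
      using that g by (auto simp: inj_on_def)
    then show ?thesis by (simp add: law_def)
  qed
  ultimately show ?thesis unfolding ent_def using g by (simp add: sum.reindex)
qed

lemma ent_nonneg: "0 \<le> ent M X"
proof -
  have "law M X v * ln (law M X v) \<le> 0" for v
  proof (cases "law M X v = 0")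
    case False
    then have "0 < law M X v" "law M X v \<le> 1" by (auto simp: law_def zero_less_measure_iff)
    then show ?thesis by (simp add: mult_nonneg_nonpos)
  qed simp
  then show ?thesis unfolding ent_def by (simp add: sum_nonpos)
qed

lemma ent_stationary:
  assumes T: "T \<in> measurable M M" and d: "distr M M T = M" and Z: "simple_function M Z"
  shows "ent M (\<lambda>x. Z ((T ^^ j) x)) = ent M Z"
proof -
  have "law M (\<lambda>x. Z ((T ^^ j) x)) v = law M Z v" for v
  proof -
    have "(\<lambda>x. Z ((T ^^ j) x)) -` {v} \<inter> space M = (T ^^ j) -` (Z -` {v} \<inter> space M) \<inter> space M"
      using funpow_space[OF T] by auto
    then show ?thesis using measure_funpow_vimage[OF T d simple_functionD(2)[OF Z]]
      by (simp add: law_def)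
  qed
  moreover have "(\<lambda>x. Z ((T ^^ j) x)) ` space M \<subseteq> Z ` space M" using funpow_space[OF T] by auto
  moreover have "finite (Z ` space M)" using simple_functionD[OF Z] by simp
  ultimately show ?thesis using ent_superset[of "Z ` space M"] by simp
qed

lemma simple_function_funpow:
  assumes T: "T \<in> measurable M M" and Z: "simple_function M Z"
  shows "simple_function M (\<lambda>x. Z ((T ^^ j) x))"
proof -
  have "(\<lambda>x. Z ((T ^^ j) x)) ` space M \<subseteq> Z ` space M" using funpow_space[OF T] by auto
  then have "finite ((\<lambda>x. Z ((T ^^ j) x)) ` space M)"
    using simple_functionD(1)[OF Z] by (rule finite_subset)
  moreover have "(\<lambda>x. Z ((T ^^ j) x)) -` {v} \<inter> space M \<in> sets M" for v
  proof -
    have "(\<lambda>x. Z ((T ^^ j) x)) -` {v} \<inter> space M = (T ^^ j) -` (Z -` {v} \<inter> space M) \<inter> space M"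
      using funpow_space[OF T] by auto
    then show ?thesis
      using measurable_sets[OF funpow_measurable[OF T] simple_functionD(2)[OF Z]] by simp
  qed
  ultimately show ?thesis by (simp add: simple_function_def)
qed

lemma itinerary_Suc: "itinerary T c (Suc n) x = itinerary T c n x @ [c ((T ^^ n) x)]"
  by (simp add: itinerary_def)

lemma simple_function_itinerary:
  assumes T: "T \<in> measurable M M" and c: "simple_function M c"
  shows "simple_function M (itinerary T c n)"
proof (induction n)
  case 0
  then show ?case by (simp add: itinerary_def[abs_def])
next
  case (Suc n)
  have "simple_function M (\<lambda>x. (\<lambda>p. fst p @ [snd p]) (itinerary T c n x, c ((T ^^ n) x)))"
    by (intro simple_function_compose1[where g="\<lambda>p. fst p @ [snd p]"] simple_function_Pair
        Suc simple_function_funpow[OF T c])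
  then show ?case by (simp add: itinerary_Suc[abs_def])
qed

text \<open>The letter at time \<open>n\<close> is added to the letters before it. Forgetting all of these except the one
  at time \<open>n - m\<close> only increases its conditional entropy, and by stationarity the result does not
  depend on \<open>n\<close>.\<close>

lemma ent_itinerary_Suc_le:
  assumes T: "T \<in> measurable M M" and d: "distr M M T = M" and c: "simple_function M c"
    and m: "0 < m" "m \<le> n"
  shows "ent M (itinerary T c (Suc n)) \<le> ent M (itinerary T c n) + (ent M (\<lambda>x. (c x, c ((T ^^ m) x))) - ent M c)"
proof -
  let ?Y = "itinerary T c n" and ?X = "\<lambda>x. c ((T ^^ n) x)"
  have Y: "simple_function M ?Y" by (rule simple_function_itinerary[OF T c])
  have X: "simple_function M ?X" by (rule simple_function_funpow[OF T c])
  have f: "?Y x ! (n - m) = c ((T ^^ (n - m)) x)" for x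
    using m by (simp add: itinerary_def)
  have "ent M (itinerary T c (Suc n)) = ent M (\<lambda>x. (\<lambda>p. fst p @ [snd p]) (?Y x, ?X x))"
    by (simp add: itinerary_Suc[abs_def])
  also have "\<dots> = ent M (\<lambda>x. (?Y x, ?X x))"
    by (rule ent_inj) (auto simp: inj_on_def)
  finally have 1: "ent M (\<lambda>x. (?Y x, ?X x)) = ent M (itinerary T c (Suc n))" ..
  have c2: "simple_function M (\<lambda>x. (c x, c ((T ^^ m) x)))"
    using c simple_function_funpow[OF T c] by simp
  have "(T ^^ n) x = (T ^^ m) ((T ^^ (n - m)) x)" for x
    using m by (metis comp_apply funpow_add le_add_diff_inverse)
  then have "ent M (\<lambda>x. (?Y x ! (n - m), ?X x)) = ent M (\<lambda>x. (\<lambda>x. (c x, c ((T ^^ m) x))) ((T ^^ (n - m)) x))"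
    by (simp add: f)
  also have "\<dots> = ent M (\<lambda>x. (c x, c ((T ^^ m) x)))"
    by (rule ent_stationary[OF T d c2])
  finally have 2: "ent M (\<lambda>x. (?Y x ! (n - m), ?X x)) = ent M (\<lambda>x. (c x, c ((T ^^ m) x)))" .
  have 3: "ent M (\<lambda>x. ?Y x ! (n - m)) = ent M c"
    unfolding f by (rule ent_stationary[OF T d c])
  show ?thesis
    using ent_submodular[OF X Y, of "\<lambda>l. l ! (n - m)"] unfolding 1 2 3 by simp
qed

lemma ent_itinerary_le:
  assumes "T \<in> measurable M M" "distr M M T = M" "simple_function M c" "0 < m"
  shows "ent M (itinerary T c (m + j)) \<le>
    ent M (itinerary T c m) + real j * (ent M (\<lambda>x. (c x, c ((T ^^ m) x))) - ent M c)"
proof (induction j)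
  case (Suc j)
  then show ?case using ent_itinerary_Suc_le[OF assms, of "m + j"] by (simp add: algebra_simps)
qed simp

end

lemma xlnx_tendsto_0:
  assumes "X \<longlonglongrightarrow> (0::real)" "\<And>n. 0 \<le> X n"
  shows "(\<lambda>n. X n * ln (X n)) \<longlonglongrightarrow> 0"
proof (rule Lim_null_comparison)
  \<comment> \<open>Apply \<open>ln u \<le> u - 1\<close> at \<open>u = 1 / sqrt t\<close>.\<close>
  have b: "\<bar>t * ln t\<bar> \<le> 2 * sqrt t" if t: "0 \<le> t" "t < 1" for t :: real
  proof (cases "t = 0")
    case False
    then have p: "0 < t" "0 < sqrt t" using t by auto
    have "- ln t = 2 * ln (1 / sqrt t)" using p by (simp add: ln_div ln_sqrt)
    also have "\<dots> \<le> 2 * (1 / sqrt t)" using ln_le_minus_one[of "1 / sqrt t"] p by simp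
    finally have "t * (- ln t) \<le> t * (2 * (1 / sqrt t))" using p by (intro mult_left_mono) auto
    also have "\<dots> = 2 * sqrt t" using p by (simp add: field_simps)
    finally show ?thesis using p t by (simp add: abs_mult)
  qed simp
  have "eventually (\<lambda>n. X n < 1) sequentially" using order_tendstoD(2)[OF assms(1), of 1] by simp
  then show "eventually (\<lambda>n. norm (X n * ln (X n)) \<le> 2 * sqrt (X n)) sequentially"
    by eventually_elim (use b assms(2) in auto)
  show "(\<lambda>n. 2 * sqrt (X n)) \<longlonglongrightarrow> 0"
    using tendsto_mult_left[OF tendsto_real_sqrt[OF assms(1)], of 2] by simp
qed

lemma xlnx_tendsto:
  assumes "X \<longlonglongrightarrow> (a::real)" "\<And>n. 0 \<le> X n"
  shows "(\<lambda>n. X n * ln (X n)) \<longlonglongrightarrow> a * ln a"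
proof (cases "a = 0")
  case True then show ?thesis using xlnx_tendsto_0 assms by simp
next
  case False
  then show ?thesis using assms by (intro tendsto_intros)
qed

context prob_space begin

text \<open>Along rigidity times the joint law of a letter and its image concentrates on the diagonal, and
  \<open>t ln t\<close> is continuous.\<close>

lemma rigid_entropy_increment:
  assumes T: "T \<in> measurable M M" and d: "distr M M T = M" and c: "simple_function M c"
    and m: "\<And>A. A \<in> sets M \<Longrightarrow> (\<lambda>k. measure M (((T ^^ m k) -` A \<inter> space M) - A)) \<longlonglongrightarrow> 0"
  shows "(\<lambda>k. ent M (\<lambda>x. (c x, c ((T ^^ m k) x)))) \<longlonglongrightarrow> ent M c"
proof -
  let ?C = "c ` space M"
  have finC: "finite ?C" using simple_functionD[OF c] by simp
  let ?q = "\<lambda>k. law M (\<lambda>x. (c x, c ((T ^^ m k) x)))"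
  define S where "S u = c -` {u} \<inter> space M" for u
  have S: "S u \<in> sets M" for u unfolding S_def using simple_functionD[OF c] by auto
  have TS: "(T ^^ i) -` S u \<inter> space M \<in> sets M" for i u
    using measurable_sets[OF funpow_measurable[OF T] S] .
  have q: "?q k (u, v) = measure M (S u \<inter> ((T ^^ m k) -` S v \<inter> space M))" for k u v
    unfolding law_def S_def using funpow_space[OF T] by (intro arg_cong[where f="measure M"]) auto
  have off: "(\<lambda>k. ?q k (u, v)) \<longlonglongrightarrow> 0" if "u \<noteq> v" for u v
  proof (rule tendsto_sandwich[OF _ _ tendsto_const m[OF S[of v]]])
    show "eventually (\<lambda>k. ?q k (u, v) \<le> measure M (((T ^^ m k) -` S v \<inter> space M) - S v)) sequentially"
      unfolding q using that TS S
      by (intro always_eventually allI finite_measure_mono) (auto simp: S_def)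
  qed (simp add: law_nonneg)
  have diag: "(\<lambda>k. ?q k (u, u)) \<longlonglongrightarrow> law M c u" for u
  proof -
    have "?q k (u, u) = law M c u - measure M (((T ^^ m k) -` S u \<inter> space M) - S u)" for k
    proof -
      have "S u \<inter> ((T ^^ m k) -` S u \<inter> space M) = ((T ^^ m k) -` S u \<inter> space M) - (((T ^^ m k) -` S u \<inter> space M) - S u)"
        by auto
      then have "?q k (u, u) = measure M ((T ^^ m k) -` S u \<inter> space M) - measure M (((T ^^ m k) -` S u \<inter> space M) - S u)"
        unfolding q by (simp only:) (intro finite_measure_Diff, use TS S in auto)
      then show ?thesis using measure_funpow_vimage[OF T d S] by (simp add: law_def S_def)
    qed
    then show ?thesis using tendsto_diff[OF tendsto_const m[OF S[of u]], of "law M c u"] by simp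
  qed
  have "ent M (\<lambda>x. (c x, c ((T ^^ m k) x))) = - (\<Sum>u\<in>?C. \<Sum>v\<in>?C. ?q k (u, v) * ln (?q k (u, v)))" for k
    unfolding sum.cartesian_product
    by (subst ent_superset[of "?C \<times> ?C"]) (use finC funpow_space[OF T] in \<open>auto intro!: sum.cong\<close>)
  moreover have "(\<lambda>k. - (\<Sum>u\<in>?C. \<Sum>v\<in>?C. ?q k (u, v) * ln (?q k (u, v))))
      \<longlonglongrightarrow> - (\<Sum>u\<in>?C. \<Sum>v\<in>?C. if v = u then law M c u * ln (law M c u) else 0)"
  proof (intro tendsto_minus tendsto_sum)
    fix u v
    show "(\<lambda>k. ?q k (u, v) * ln (?q k (u, v))) \<longlonglongrightarrow> (if v = u then law M c u * ln (law M c u) else 0)"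
      using xlnx_tendsto[OF diag[of u]] xlnx_tendsto[OF off[of u v]] by (auto simp: law_nonneg)
  qed
  ultimately show ?thesis using finC by (simp add: ent_def)
qed

lemma simple_function_cell_of:
  assumes "finite_partition M P" shows "simple_function M (cell_of P)"
proof -
  have P: "finite P" "P \<subseteq> sets M" "partition_on (space M) P"
    using assms by (auto simp: finite_partition_def)
  have "cell_of P ` space M \<subseteq> P" using cell_of_in[OF P(3)] by auto
  moreover have "cell_of P -` {A} \<inter> space M \<in> sets M" if "A \<in> P" for A
  proof -
    have "cell_of P -` {A} \<inter> space M = A"
      using that cell_of_eq[OF P(3)] cell_of_in[OF P(3)] P sets.sets_into_space by blast
    then show ?thesis using that P by auto
  qed
  ultimately show ?thesis using P finite_subset unfolding simple_function_def by (metis subsetD)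
qed

lemma partition_entropy_iterated_join:
  assumes T: "T \<in> measurable M M" and P: "finite_partition M P" and n: "0 < n"
  shows "partition_entropy M (iterated_join M T P n) = ent M (itinerary T (cell_of P) n)"
proof -
  have "inj_on (\<lambda>v. itinerary T (cell_of P) n -` {v} \<inter> space M) (itinerary T (cell_of P) n ` space M)"
    unfolding inj_on_def by blast
  then show ?thesis
    using P n by (simp add: finite_partition_def iterated_join_eq_itinerary_fibres[OF _ T] partition_entropy_def
      sum.reindex ent_def law_def)
qed

text \<open>By \<open>ent_itinerary_le\<close> the entropy of itineraries grows linearly with slope at most the
  conditional entropy of a letter given the letter \<open>m\<close> steps earlier, and rigidity makes this slope
  arbitrarily small.\<close>

theorem rigid_imp_KS_entropy_0:
  assumes T: "T \<in> measurable M M" and d: "distr M M T = M" and r: "rigid M T"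
  shows "KS_entropy M T = 0"
proof -
  obtain m where m0: "\<And>k. 0 < m k"
    and m: "\<And>A. A \<in> sets M \<Longrightarrow> (\<lambda>k. measure M (((T ^^ m k) -` A \<inter> space M) - A)) \<longlonglongrightarrow> 0"
    using r unfolding rigid_def by blast
  have "entropy_wrt M T P = 0" if P: "finite_partition M P" for P
  proof -
    let ?c = "cell_of P" and ?H = "\<lambda>n. ent M (itinerary T (cell_of P) n)"
    have c: "simple_function M ?c" by (rule simple_function_cell_of[OF P])
    have "(\<lambda>n. ?H n / real n) \<longlonglongrightarrow> 0"
    proof (rule LIMSEQ_I)
      fix e :: real assume e: "0 < e"
      have "eventually (\<lambda>k. ent M (\<lambda>x. (?c x, ?c ((T ^^ m k) x))) < ent M ?c + e / 2) sequentially"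
        using order_tendstoD(2)[OF rigid_entropy_increment[OF T d c m]] e by simp
      then obtain k where "ent M (\<lambda>x. (?c x, ?c ((T ^^ m k) x))) < ent M ?c + e / 2"
        using eventually_happens'[OF sequentially_bot] by blast
      then have k: "ent M (\<lambda>x. (?c x, ?c ((T ^^ m k) x))) - ent M ?c < e / 2" by simp
      define K where "K = nat \<lceil>2 * ?H (m k) / e\<rceil> + 1"
      have "norm (?H n / real n - 0) < e" if n: "n \<ge> K + m k" for n
      proof -
        have n0: "0 < real n" using n by (simp add: K_def)
        have "2 * ?H (m k) / e < real K" unfolding K_def by linarith
        then have "2 * ?H (m k) / e < real n" using n by linarith
        then have "?H (m k) < real n * (e / 2)" using e by (simp add: field_simps)
        moreover have "?H n \<le> ?H (m k) + real (n - m k) * (ent M (\<lambda>x. (?c x, ?c ((T ^^ m k) x))) - ent M ?c)"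
          using ent_itinerary_le[OF T d c m0, of k "n - m k"] n by simp
        moreover have "real (n - m k) * (ent M (\<lambda>x. (?c x, ?c ((T ^^ m k) x))) - ent M ?c) \<le> real n * (e / 2)"
        proof -
          have "real (n - m k) * (ent M (\<lambda>x. (?c x, ?c ((T ^^ m k) x))) - ent M ?c) \<le> real (n - m k) * (e / 2)"
            using k by (intro mult_left_mono) auto
          also have "\<dots> \<le> real n * (e / 2)" using e by (intro mult_right_mono) auto
          finally show ?thesis .
        qed
        ultimately have "?H n < real n * e" by (simp add: field_simps)
        then show ?thesis using n0 ent_nonneg[of "itinerary T ?c n"] by (simp add: field_simps)
      qed
      then show "\<exists>no. \<forall>n\<ge>no. norm (?H n / real n - 0) < e" by blast
    qed
    moreover have "eventually (\<lambda>n. ?H n / real n = partition_entropy M (iterated_join M T P n) / real n) sequentially"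
      using eventually_gt_at_top[of 0] by eventually_elim (simp add: partition_entropy_iterated_join[OF T P])
    ultimately have "(\<lambda>n. partition_entropy M (iterated_join M T P n) / real n) \<longlonglongrightarrow> 0"
      by (rule Lim_transform_eventually)
    then have "(\<lambda>n. ereal (partition_entropy M (iterated_join M T P n) / real n)) \<longlonglongrightarrow> ereal 0"
      by simp
    then show ?thesis unfolding entropy_wrt_def by (simp add: limI zero_ereal_def)
  qed
  moreover have "finite_partition M {space M}"
    using not_empty by (auto simp: finite_partition_def partition_on_def)
  ultimately show ?thesis unfolding KS_entropy_def
    by (intro antisym) (auto intro!: SUP_least SUP_upper2[of "{space M}"])
qed

end

section \<open>Testing ergodicity and rigidity on a generator\<close>

context prob_space begin

text \<open>A Dynkin argument: additivity handles complements and finite disjoint unions, and the bound by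
  a multiple of the measure makes the tail of a countable disjoint union small uniformly in \<open>k\<close>.\<close>

lemma additive_limit_zero:
  fixes g :: "nat \<Rightarrow> 'a set \<Rightarrow> real"
  assumes add: "\<And>k A B. A \<in> sets M \<Longrightarrow> B \<in> sets M \<Longrightarrow> A \<inter> B = {} \<Longrightarrow> g k (A \<union> B) = g k A + g k B"
    and bound: "\<And>k A. A \<in> sets M \<Longrightarrow> \<bar>g k A\<bar> \<le> C * measure M A"
    and G: "Int_stable G" "space M \<in> G" "sets M = sigma_sets (space M) G"
    and lim: "\<And>A. A \<in> G \<Longrightarrow> (\<lambda>k. g k A) \<longlonglongrightarrow> 0"
    and A: "A \<in> sets M"
  shows "(\<lambda>k. g k A) \<longlonglongrightarrow> 0"
proof -
  have g0: "g k {} = 0" for k using bound[of "{}" k] by simp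
  have GP: "G \<subseteq> Pow (space M)" using G(3) sets.sets_into_space by (metis PowI sigma_sets.Basic subsetI)
  have AG: "A \<in> sigma_sets (space M) G" using A G by simp
  from G(1) GP AG show ?thesis
  proof (induction rule: sigma_sets_induct_disjoint)
    case (basic A) then show ?case by (rule lim)
  next
    case empty then show ?case by (simp add: g0)
  next
    case (compl A)
    then have "g k (space M - A) = g k (space M) - g k A" for k
      using add[of A "space M - A" k] sets.sets_into_space[of A M] sets.compl_sets[of A M] G(3)
      by (simp add: Un_absorb1)
    then show ?case using tendsto_diff[OF lim[OF G(2)] compl(2)] by simp
  next
    case (union A)
    then have meas: "A i \<in> sets M" for i using G(3) by auto
    have fin: "g k (\<Union>i<n. A i) = (\<Sum>i<n. g k (A i))" for k n
    proof (induction n)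
      case (Suc n)
      have "(\<Union>i<Suc n. A i) = (\<Union>i<n. A i) \<union> A n" by (auto simp: less_Suc_eq)
      moreover have "(\<Union>i<n. A i) \<inter> A n = {}"
      proof -
        have "A i \<inter> A n = {}" if "i < n" for i
          using union(1) that by (auto simp: disjoint_family_on_def)
        then show ?thesis by auto
      qed
      moreover have "(\<Union>i<n. A i) \<in> sets M" using meas by (intro sets.finite_UN) auto
      ultimately show ?case using add[of "\<Union>i<n. A i" "A n" k] Suc meas[of n] by simp
    qed (simp add: g0)
    define R where "R n = measure M (\<Union>i. A i) - measure M (\<Union>i<n. A i)" for n
    have UA: "(\<Union>i. A i) \<in> sets M" "(\<Union>i<n. A i) \<in> sets M" for n using meas by auto
    have "incseq (\<lambda>n. \<Union>i<n. A i)" unfolding incseq_def by (intro allI impI UN_mono) auto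
    then have "(\<lambda>n. measure M (\<Union>i<n. A i)) \<longlonglongrightarrow> measure M (\<Union>n. \<Union>i<n. A i)"
      using UA by (intro finite_Lim_measure_incseq) auto
    moreover have "(\<Union>n. \<Union>i<n. A i) = (\<Union>i. A i)" by auto
    ultimately have "R \<longlonglongrightarrow> 0" unfolding R_def by (auto intro!: tendsto_eq_intros)
    then have CR: "(\<lambda>n. C * R n) \<longlonglongrightarrow> 0" by (rule tendsto_mult_right_zero)
    have tail: "\<bar>g k (\<Union>i. A i) - (\<Sum>i<n. g k (A i))\<bar> \<le> C * R n" for k n
    proof -
      let ?D = "(\<Union>i. A i) - (\<Union>i<n. A i)"
      have "(\<Union>i<n. A i) \<union> ?D = (\<Union>i. A i)" by auto
      then have "g k (\<Union>i. A i) = g k (\<Union>i<n. A i) + g k ?D"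
        using add[of "\<Union>i<n. A i" ?D k] UA by auto
      moreover have "measure M ?D = R n" unfolding R_def using UA
        by (intro finite_measure_Diff) auto
      ultimately show ?thesis using bound[of ?D k] UA fin by auto
    qed
    show ?case
    proof (rule LIMSEQ_I)
      fix e :: real assume e: "0 < e"
      have "eventually (\<lambda>n. C * R n < e / 2) sequentially"
        using order_tendstoD(2)[OF CR, of "e / 2"] e by simp
      then obtain n where n: "C * R n < e / 2" using eventually_happens'[OF sequentially_bot] by blast
      have "(\<lambda>k. \<Sum>i<n. g k (A i)) \<longlonglongrightarrow> (\<Sum>i<n. 0)" by (intro tendsto_sum union(3))
      then have "(\<lambda>k. \<Sum>i<n. g k (A i)) \<longlonglongrightarrow> 0" by simp
      then obtain K where K: "\<And>k. k \<ge> K \<Longrightarrow> \<bar>\<Sum>i<n. g k (A i)\<bar> < e / 2"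
        using LIMSEQ_D[of "\<lambda>k. \<Sum>i<n. g k (A i)" 0 "e / 2"] e by (auto simp: real_norm_def)
      have "norm (g k (\<Union>i. A i) - 0) < e" if "k \<ge> K" for k
        using K[OF that] tail[of k n] n by (simp add: real_norm_def)
      then show "\<exists>no. \<forall>k\<ge>no. norm (g k (\<Union>i. A i) - 0) < e" by blast
    qed
  qed
qed

lemma biadditive_limit_zero:
  fixes g :: "nat \<Rightarrow> 'a set \<Rightarrow> 'a set \<Rightarrow> real"
  assumes add1: "\<And>k A B D. A \<in> sets M \<Longrightarrow> B \<in> sets M \<Longrightarrow> D \<in> sets M \<Longrightarrow> A \<inter> B = {} \<Longrightarrow> g k (A \<union> B) D = g k A D + g k B D"
    and add2: "\<And>k A B D. A \<in> sets M \<Longrightarrow> B \<in> sets M \<Longrightarrow> D \<in> sets M \<Longrightarrow> A \<inter> B = {} \<Longrightarrow> g k D (A \<union> B) = g k D A + g k D B"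
    and bound1: "\<And>k A B. A \<in> sets M \<Longrightarrow> B \<in> sets M \<Longrightarrow> \<bar>g k A B\<bar> \<le> C * measure M A"
    and bound2: "\<And>k A B. A \<in> sets M \<Longrightarrow> B \<in> sets M \<Longrightarrow> \<bar>g k A B\<bar> \<le> C * measure M B"
    and G: "Int_stable G" "space M \<in> G" "sets M = sigma_sets (space M) G"
    and lim: "\<And>A B. A \<in> G \<Longrightarrow> B \<in> G \<Longrightarrow> (\<lambda>k. g k A B) \<longlonglongrightarrow> 0"
    and A: "A \<in> sets M" and B: "B \<in> sets M"
  shows "(\<lambda>k. g k A B) \<longlonglongrightarrow> 0"
proof -
  have G_sets: "D \<in> sets M" if "D \<in> G" for D using that G(3) by (simp add: sigma_sets.Basic)
  have "(\<lambda>k. g k A D) \<longlonglongrightarrow> 0" if D: "D \<in> G" for D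
    by (rule additive_limit_zero[where C=C and g="\<lambda>k A. g k A D", OF _ _ G _ A])
       (use add1 bound1 lim D G_sets in auto)
  then show ?thesis
    by (intro additive_limit_zero[where C=C and g="\<lambda>k D. g k A D", OF _ _ G _ B])
       (use add2 bound2 A in auto)
qed

lemma vimage_Un_measure:
  assumes "A \<in> sets M" "B \<in> sets M" "D \<in> sets M" "A \<inter> B = {}" and T: "T \<in> measurable M M"
  shows "measure M ((A \<union> B) \<inter> (T ^^ t) -` D) = measure M (A \<inter> (T ^^ t) -` D) + measure M (B \<inter> (T ^^ t) -` D)"
    and "measure M (D \<inter> (T ^^ t) -` (A \<union> B)) = measure M (D \<inter> (T ^^ t) -` A) + measure M (D \<inter> (T ^^ t) -` B)"
proof -
  have *: "U \<inter> (T ^^ t) -` V \<in> sets M" if "U \<in> sets M" "V \<in> sets M" for U V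
  proof -
    have "U \<inter> (T ^^ t) -` V = U \<inter> ((T ^^ t) -` V \<inter> space M)" using sets.sets_into_space[OF that(1)] by auto
    then show ?thesis using that measurable_sets[OF funpow_measurable[OF T]] by auto
  qed
  have "(A \<union> B) \<inter> (T ^^ t) -` D = (A \<inter> (T ^^ t) -` D) \<union> (B \<inter> (T ^^ t) -` D)" by auto
  then show "measure M ((A \<union> B) \<inter> (T ^^ t) -` D) = measure M (A \<inter> (T ^^ t) -` D) + measure M (B \<inter> (T ^^ t) -` D)"
    using assms * by (simp, intro finite_measure_Union) auto
  have "D \<inter> (T ^^ t) -` (A \<union> B) = (D \<inter> (T ^^ t) -` A) \<union> (D \<inter> (T ^^ t) -` B)" by auto
  then show "measure M (D \<inter> (T ^^ t) -` (A \<union> B)) = measure M (D \<inter> (T ^^ t) -` A) + measure M (D \<inter> (T ^^ t) -` B)"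
    using assms * by (simp, intro finite_measure_Union) auto
qed

lemma vimage_Int_measure_le:
  assumes "A \<in> sets M" "B \<in> sets M" and T: "T \<in> measurable M M" and d: "distr M M T = M"
  shows "measure M (A \<inter> (T ^^ t) -` B) \<le> measure M A" "measure M (A \<inter> (T ^^ t) -` B) \<le> measure M B"
proof -
  show "measure M (A \<inter> (T ^^ t) -` B) \<le> measure M A" using assms by (intro finite_measure_mono) auto
  have "measure M (A \<inter> (T ^^ t) -` B) \<le> measure M ((T ^^ t) -` B \<inter> space M)"
    using assms sets.sets_into_space[of A M] measurable_sets[OF funpow_measurable[OF T]]
    by (intro finite_measure_mono) auto
  then show "measure M (A \<inter> (T ^^ t) -` B) \<le> measure M B"
    using measure_funpow_vimage[OF T d] assms by simp
qed

text \<open>On an invariant set \<open>A\<close> every correlation equals the measure of \<open>A\<close>. If averaged correlations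
  factorise in the limit, this measure equals its own square.\<close>

lemma ergodic_from_generator:
  assumes T: "T \<in> measurable M M" and d: "distr M M T = M"
    and G: "Int_stable G" "space M \<in> G" "sets M = sigma_sets (space M) G"
    and F: "\<And>k::nat. finite (F k)" "\<And>k. F k \<noteq> {}"
    and lim: "\<And>A B. A \<in> G \<Longrightarrow> B \<in> G \<Longrightarrow>
      (\<lambda>k. (\<Sum>t\<in>F k. measure M (A \<inter> (T ^^ t) -` B)) / real (card (F k)) - measure M A * measure M B) \<longlonglongrightarrow> 0"
  shows "ergodic M T"
proof -
  define h where "h k A B = (\<Sum>t\<in>F k. measure M (A \<inter> (T ^^ t) -` B)) / real (card (F k))" for k A B
  have card: "real (card (F k)) > 0" for k using F by (simp add: card_gt_0_iff)
  have h0: "0 \<le> h k A B" for k A B unfolding h_def by (intro divide_nonneg_nonneg sum_nonneg) auto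
  have hle: "h k A B \<le> c" if "\<And>t. measure M (A \<inter> (T ^^ t) -` B) \<le> c" for k A B c
  proof -
    have "(\<Sum>t\<in>F k. measure M (A \<inter> (T ^^ t) -` B)) \<le> (\<Sum>t\<in>F k. c)" by (intro sum_mono that)
    then show ?thesis unfolding h_def using card[of k] by (simp add: field_simps)
  qed
  have abs: "\<bar>a - b * c\<bar> \<le> x" if "0 \<le> a" "a \<le> x" "0 \<le> b * c" "b * c \<le> x" for a b c x :: real
    using that by linarith
  have pm: "measure M A * measure M B \<le> measure M A" "measure M A * measure M B \<le> measure M B" for A B
    by (auto intro: mult_left_le mult_left_le_one_le)
  have bnd: "\<bar>h k A B - measure M A * measure M B\<bar> \<le> 1 * measure M A" "\<bar>h k A B - measure M A * measure M B\<bar> \<le> 1 * measure M B"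
    if "A \<in> sets M" "B \<in> sets M" for k A B
    using abs[OF h0 hle[OF vimage_Int_measure_le(1)[OF that T d]], of "measure M A" "measure M B" k]
      abs[OF h0 hle[OF vimage_Int_measure_le(2)[OF that T d]], of "measure M A" "measure M B" k] pm[of A B]
      mult_nonneg_nonneg[OF measure_nonneg measure_nonneg, of M A M B]
    by simp_all
  have lim': "(\<lambda>k. h k A A - measure M A * measure M A) \<longlonglongrightarrow> 0" if A: "A \<in> sets M" for A
  proof (rule biadditive_limit_zero[where g="\<lambda>k A B. h k A B - measure M A * measure M B", OF _ _ bnd G _ A A])
    show "h k (U \<union> V) D - measure M (U \<union> V) * measure M D =
        h k U D - measure M U * measure M D + (h k V D - measure M V * measure M D)"
      if "U \<in> sets M" "V \<in> sets M" "D \<in> sets M" "U \<inter> V = {}" for k U V D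
      using that unfolding h_def
      by (simp add: vimage_Un_measure[OF that T] finite_measure_Union sum.distrib add_divide_distrib algebra_simps
          del: vimage_Un Int_Un_distrib2)
    show "h k D (U \<union> V) - measure M D * measure M (U \<union> V) =
        h k D U - measure M D * measure M U + (h k D V - measure M D * measure M V)"
      if "U \<in> sets M" "V \<in> sets M" "D \<in> sets M" "U \<inter> V = {}" for k U V D
      using that unfolding h_def
      by (simp add: vimage_Un_measure[OF that T] finite_measure_Union sum.distrib add_divide_distrib algebra_simps
          del: vimage_Un Int_Un_distrib2)
    show "(\<lambda>k. h k U V - measure M U * measure M V) \<longlonglongrightarrow> 0" if "U \<in> G" "V \<in> G" for U V
      using lim[OF that] by (simp add: h_def)
  qed
  show ?thesis unfolding ergodic_def
  proof (intro ballI impI)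
    fix A assume A: "A \<in> sets M" and inv: "T -` A \<inter> space M = A"
    have "A \<inter> (T ^^ t) -` A = A" for t
    proof -
      have "x \<in> A \<Longrightarrow> (T ^^ t) x \<in> A" for x by (induction t) (use inv in auto)
      then show ?thesis by auto
    qed
    then have "h k A A = measure M A" for k using card[of k] by (simp add: h_def)
    then have "(\<lambda>k::nat. measure M A - measure M A * measure M A) \<longlonglongrightarrow> 0"
      using lim'[OF A] by simp
    then have "measure M A - measure M A * measure M A = 0" by (simp only: LIMSEQ_const_iff)
    then have "measure M A * (1 - measure M A) = 0" by (simp add: algebra_simps)
    then show "measure M A = 0 \<or> measure M A = 1" by auto
  qed
qed

text \<open>Correlations rather than differences of sets are used in the hypothesis because they are
  additive in each argument, so that \<open>biadditive_limit_zero\<close> applies.\<close>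

lemma rigid_from_generator:
  assumes T: "T \<in> measurable M M" and d: "distr M M T = M"
    and G: "Int_stable G" "space M \<in> G" "sets M = sigma_sets (space M) G"
    and m: "\<And>k::nat. 0 < m k"
    and lim: "\<And>A B. A \<in> G \<Longrightarrow> B \<in> G \<Longrightarrow>
      (\<lambda>k. measure M (A \<inter> (T ^^ m k) -` B) - measure M (A \<inter> B)) \<longlonglongrightarrow> 0"
  shows "rigid M T"
proof -
  have lim': "(\<lambda>k. measure M (A \<inter> (T ^^ m k) -` A) - measure M (A \<inter> A)) \<longlonglongrightarrow> 0" if A: "A \<in> sets M" for A
  proof (rule biadditive_limit_zero[where C=1 and g="\<lambda>k A B. measure M (A \<inter> (T ^^ m k) -` B) - measure M (A \<inter> B)", OF _ _ _ _ G lim A A])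
    fix k U V D assume UVD: "U \<in> sets M" "V \<in> sets M" "D \<in> sets M" "U \<inter> V = {}"
    have "measure M ((U \<union> V) \<inter> D) = measure M (U \<inter> D) + measure M (V \<inter> D)"
      unfolding Int_Un_distrib2 using UVD by (intro finite_measure_Union) auto
    then show "measure M ((U \<union> V) \<inter> (T ^^ m k) -` D) - measure M ((U \<union> V) \<inter> D) =
       measure M (U \<inter> (T ^^ m k) -` D) - measure M (U \<inter> D) + (measure M (V \<inter> (T ^^ m k) -` D) - measure M (V \<inter> D))"
      using vimage_Un_measure[OF UVD T] by simp
    have "measure M (D \<inter> (U \<union> V)) = measure M (D \<inter> U) + measure M (D \<inter> V)"
      unfolding Int_Un_distrib using UVD by (intro finite_measure_Union) auto
    then show "measure M (D \<inter> (T ^^ m k) -` (U \<union> V)) - measure M (D \<inter> (U \<union> V)) =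
       measure M (D \<inter> (T ^^ m k) -` U) - measure M (D \<inter> U) + (measure M (D \<inter> (T ^^ m k) -` V) - measure M (D \<inter> V))"
      using vimage_Un_measure[OF UVD T] by simp
  next
    fix k U V assume UV: "U \<in> sets M" "V \<in> sets M"
    have "measure M (U \<inter> V) \<le> measure M U" "measure M (U \<inter> V) \<le> measure M V"
      using UV by (auto intro: finite_measure_mono)
    then show "\<bar>measure M (U \<inter> (T ^^ m k) -` V) - measure M (U \<inter> V)\<bar> \<le> 1 * measure M U"
      "\<bar>measure M (U \<inter> (T ^^ m k) -` V) - measure M (U \<inter> V)\<bar> \<le> 1 * measure M V"
      using vimage_Int_measure_le[OF UV T d, of "m k"] measure_nonneg[of M "U \<inter> (T ^^ m k) -` V"]
        measure_nonneg[of M "U \<inter> V"] by linarith+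
  qed
  have "(\<lambda>k. measure M (((T ^^ m k) -` A \<inter> space M) - A)) \<longlonglongrightarrow> 0" if A: "A \<in> sets M" for A
  proof -
    have "measure M (((T ^^ m k) -` A \<inter> space M) - A) = - (measure M (A \<inter> (T ^^ m k) -` A) - measure M (A \<inter> A))" for k
    proof -
      have V: "(T ^^ m k) -` A \<inter> space M \<in> sets M" using measurable_sets[OF funpow_measurable[OF T] A] .
      have "((T ^^ m k) -` A \<inter> space M) - A = ((T ^^ m k) -` A \<inter> space M) - (A \<inter> (T ^^ m k) -` A)"
        by auto
      moreover have "A \<inter> (T ^^ m k) -` A = A \<inter> ((T ^^ m k) -` A \<inter> space M)"
        using sets.sets_into_space[OF A] by auto
      ultimately have "measure M (((T ^^ m k) -` A \<inter> space M) - A) =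
          measure M ((T ^^ m k) -` A \<inter> space M) - measure M (A \<inter> (T ^^ m k) -` A)"
        using V A by (simp only:) (intro finite_measure_Diff, auto)
      then show ?thesis using measure_funpow_vimage[OF T d A] by simp
    qed
    then show ?thesis using tendsto_minus[OF lim'[OF A]] by simp
  qed
  then show ?thesis using m unfolding rigid_def by blast
qed

text \<open>Jensen's inequality: the square of the difference of the integrals is at most the integral of
  the squared difference.\<close>

lemma L2_convergent_imp_integral_convergent:
  assumes F: "\<And>N. F N \<in> borel_measurable M" and b: "\<And>N x. \<bar>F N x\<bar> \<le> 1"
    and L2: "L2_convergent M F"
  shows "convergent (\<lambda>N. \<integral>x. F N x \<partial>M)"
proof -
  obtain f where f: "f \<in> borel_measurable M" "integrable M (\<lambda>x. (f x)\<^sup>2)"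
    "(\<lambda>N. \<integral>\<^sup>+ x. ennreal ((F N x - f x)\<^sup>2) \<partial>M) \<longlonglongrightarrow> 0"
    using L2 unfolding L2_convergent_def by blast
  have le: "\<bar>t\<bar> \<le> 1 + t\<^sup>2" for t :: real
  proof (cases "\<bar>t\<bar> \<le> 1")
    case False
    then have "\<bar>t\<bar> * 1 \<le> \<bar>t\<bar> * \<bar>t\<bar>" by (intro mult_left_mono) auto
    then show ?thesis by (simp add: power2_eq_square)
  qed (use zero_le_power2[of t] in linarith)
  have fi: "integrable M f"
    by (rule Bochner_Integration.integrable_bound[of M "\<lambda>x. 1 + (f x)\<^sup>2"]) (use f le in \<open>auto intro: order_trans\<close>)
  have Fi: "integrable M (F N)" for N
    by (rule integrable_const_bound[of _ 1]) (use F b in auto)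
  have sq: "(F N x - f x)\<^sup>2 \<le> 2 + 2 * (f x)\<^sup>2" for N x
  proof -
    have "(F N x)\<^sup>2 \<le> 1" using b[of N x] by (simp add: abs_square_le_1)
    moreover have "0 \<le> (F N x + f x)\<^sup>2" by simp
    ultimately show ?thesis by (simp add: power2_eq_square algebra_simps)
  qed
  have hi: "integrable M (\<lambda>x. (F N x - f x)\<^sup>2)" for N
    by (rule Bochner_Integration.integrable_bound[of M "\<lambda>x. 2 + 2 * (f x)\<^sup>2"]) (use f F sq in auto)
  have lim: "(\<lambda>N. \<integral>x. (F N x - f x)\<^sup>2 \<partial>M) \<longlonglongrightarrow> 0"
  proof -
    have "(\<integral>\<^sup>+ x. ennreal ((F N x - f x)\<^sup>2) \<partial>M) = ennreal (\<integral>x. (F N x - f x)\<^sup>2 \<partial>M)" for N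
      by (rule nn_integral_eq_integral[OF hi]) simp
    then have "(\<lambda>N. ennreal (\<integral>x. (F N x - f x)\<^sup>2 \<partial>M)) \<longlonglongrightarrow> ennreal 0" using f(3) by simp
    then show ?thesis by (subst (asm) tendsto_ennreal_iff) auto
  qed
  have jensen: "(expectation (F N) - expectation f)\<^sup>2 \<le> (\<integral>x. (F N x - f x)\<^sup>2 \<partial>M)" for N
    using variance_eq[of "\<lambda>x. F N x - f x"] variance_positive[of "\<lambda>x. F N x - f x"] hi[of N] Fi[of N] fi
    by simp
  have "(\<lambda>N. (expectation (F N) - expectation f)\<^sup>2) \<longlonglongrightarrow> 0"
    by (rule tendsto_sandwich[OF _ _ tendsto_const lim]) (simp_all add: jensen)
  then have "(\<lambda>N. sqrt ((expectation (F N) - expectation f)\<^sup>2)) \<longlonglongrightarrow> sqrt 0" by (rule tendsto_real_sqrt)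
  then have "(\<lambda>N. expectation (F N)) \<longlonglongrightarrow> expectation f"
    by (simp add: tendsto_rabs_zero_iff LIM_zero_iff)
  then show ?thesis by (rule convergentI)
qed

end

section \<open>Inverses, conjugates and copies on the real line\<close>

definition rigid_ergodic_mpt :: "'a measure \<Rightarrow> ('a \<Rightarrow> 'a) \<Rightarrow> bool" where
  "rigid_ergodic_mpt N T \<longleftrightarrow> bij T \<and> T \<in> measurable N N \<and> inv T \<in> measurable N N \<and>
     distr N N T = N \<and> ergodic N T \<and> rigid N T"

text \<open>With the whole type as carrier, maps can be inverted and conjugated without restricting them
  to the space.\<close>

locale full_prob_space = prob_space N for N :: "'a measure" +
  assumes space_UNIV [simp]: "space N = UNIV"
begin

lemma distr_inv:
  assumes "bij T" "T \<in> measurable N N" "inv T \<in> measurable N N" "distr N N T = N"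
  shows "distr N N (inv T) = N"
proof -
  have "distr (distr N N T) N (inv T) = distr N N (inv T \<circ> T)"
    using assms by (intro distr_distr) auto
  moreover have "inv T \<circ> T = id" using assms(1) by (simp add: bij_is_inj)
  ultimately show ?thesis using assms(4) by (simp add: id_def distr_id)
qed

lemma vimage_inv: "bij T \<Longrightarrow> inv T -` A = T ` A"
  by (simp add: bij_vimage_eq_inv_image inv_inv_eq bij_imp_bij_inv)

text \<open>For rigidity: the preimage under \<open>T\<^sup>j\<close> of \<open>T\<^sup>j A - A\<close> is \<open>A - T\<^sup>-\<^sup>j A\<close>, whose measure equals that of
  \<open>T\<^sup>-\<^sup>j A - A\<close>.\<close>

lemma rigid_ergodic_mpt_inv:
  assumes "rigid_ergodic_mpt N T"
  shows "rigid_ergodic_mpt N (inv T)"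
proof -
  have T: "bij T" "T \<in> measurable N N" "inv T \<in> measurable N N" "distr N N T = N" "ergodic N T" "rigid N T"
    using assms by (auto simp: rigid_ergodic_mpt_def)
  have "ergodic N (inv T)" unfolding ergodic_def
  proof (intro ballI impI)
    fix A assume A: "A \<in> sets N" "inv T -` A \<inter> space N = A"
    then have "T ` A = A" using vimage_inv[OF T(1)] by simp
    then have "T -` A = A" using T(1) by (metis bij_is_inj inj_vimage_image_eq)
    then show "measure N A = 0 \<or> measure N A = 1" using T(5) A by (simp add: ergodic_def)
  qed
  moreover have "rigid N (inv T)"
  proof -
    obtain m where m0: "\<And>k. 0 < m k"
      and m: "\<And>A. A \<in> sets N \<Longrightarrow> (\<lambda>k. measure N (((T ^^ m k) -` A \<inter> space N) - A)) \<longlonglongrightarrow> 0"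
      using T(6) unfolding rigid_def by blast
    have "measure N ((inv T ^^ j) -` A - A) = measure N ((T ^^ j) -` A - A)" if A: "A \<in> sets N" for j A
    proof -
      have bj: "bij (T ^^ j)" using T(1) by (rule bij_fn)
      have "(inv T ^^ j) -` A = (T ^^ j) ` A"
        using vimage_inv[OF bj] inv_fn[OF T(1)] by simp
      then have *: "(T ^^ j) -` ((inv T ^^ j) -` A - A) = A - (T ^^ j) -` A"
        using bij_is_inj[OF bj] by (simp add: vimage_Diff inj_vimage_image_eq)
      have V: "(T ^^ j) -` A \<in> sets N" "(inv T ^^ j) -` A \<in> sets N"
        using measurable_sets[OF funpow_measurable A] T by auto
      have "measure N ((inv T ^^ j) -` A - A) = measure N (A - (T ^^ j) -` A)"
        using measure_funpow_vimage[OF T(2,4), of "(inv T ^^ j) -` A - A" j] V A * by simp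
      also have "\<dots> = measure N A - measure N (A \<inter> (T ^^ j) -` A)"
        using A V finite_measure_Diff' by blast
      also have "\<dots> = measure N ((T ^^ j) -` A) - measure N ((T ^^ j) -` A \<inter> A)"
        using measure_funpow_vimage[OF T(2,4) A, of j] by (simp add: Int_commute)
      also have "\<dots> = measure N ((T ^^ j) -` A - A)"
        using A V finite_measure_Diff' by metis
      finally show ?thesis .
    qed
    then show ?thesis using m0 m unfolding rigid_def by (intro exI[of _ m]) simp
  qed
  ultimately show ?thesis
    using T distr_inv[OF T(1-4)] by (simp add: rigid_ergodic_mpt_def bij_imp_bij_inv inv_inv_eq)
qed

lemma funpow_conj: assumes "bij P" shows "(inv P \<circ> T \<circ> P) ^^ j = inv P \<circ> T ^^ j \<circ> P"
proof -
  define S where "S = inv P \<circ> T \<circ> P"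
  have S: "S y = inv P (T (P y))" for y by (simp add: S_def)
  have "(S ^^ j) x = inv P ((T ^^ j) (P x))" for x
    by (induction j) (use assms in \<open>simp_all add: S bij_is_inj bij_is_surj surj_f_inv_f\<close>)
  then show ?thesis unfolding S_def by (simp add: fun_eq_iff)
qed

lemma rigid_ergodic_mpt_conj:
  assumes "rigid_ergodic_mpt N T"
    and P: "bij P" "P \<in> measurable N N" "inv P \<in> measurable N N" "distr N N P = N"
  shows "rigid_ergodic_mpt N (inv P \<circ> T \<circ> P)"
proof -
  let ?S = "inv P \<circ> T \<circ> P"
  have T: "bij T" "T \<in> measurable N N" "inv T \<in> measurable N N" "distr N N T = N" "ergodic N T" "rigid N T"
    using assms by (auto simp: rigid_ergodic_mpt_def)
  have bij: "bij ?S" using T(1) P(1) by (intro bij_comp bij_imp_bij_inv)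
  have S: "?S \<in> measurable N N" using T P by auto
  have "inv ?S = inv P \<circ> inv T \<circ> P"
    using T(1) P(1) by (simp add: o_inv_distrib bij_comp bij_imp_bij_inv inv_inv_eq o_assoc)
  then have iS: "inv ?S \<in> measurable N N" using T P by auto
  have dS: "distr N N ?S = N"
  proof -
    have TP: "distr N N (T \<circ> P) = N"
      using distr_distr[OF T(2) P(2)] T(4) P(4) by simp
    have "distr N N (inv P \<circ> (T \<circ> P)) = distr (distr N N (T \<circ> P)) N (inv P)"
      using T P by (intro distr_distr[symmetric]) auto
    then show ?thesis using TP distr_inv[OF P] by (simp add: comp_assoc)
  qed
  have PB: "P -` (P ` A) = A" for A using P(1) by (simp add: bij_is_inj inj_vimage_image_eq)
  have PA: "P ` A \<in> sets N" if "A \<in> sets N" for A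
    using measurable_sets[OF P(3) that] vimage_inv[OF P(1)] by simp
  have Sv: "(?S ^^ j) -` A = P -` ((T ^^ j) -` (P ` A))" for j A
    using funpow_conj[OF P(1)] vimage_inv[OF P(1), of A] by (simp add: vimage_comp[symmetric])
  have mP: "measure N (P -` A) = measure N A" if "A \<in> sets N" for A
    using measure_funpow_vimage[OF P(2,4) that, of 1] by simp
  have "ergodic N ?S" unfolding ergodic_def
  proof (intro ballI impI)
    fix A assume A: "A \<in> sets N" "?S -` A \<inter> space N = A"
    then have "P -` (T -` (P ` A)) = A" using Sv[of 1 A] by simp
    then have "T -` (P ` A) = P ` A" using P(1) by (metis bij_is_surj surj_image_vimage_eq)
    then have "measure N (P ` A) = 0 \<or> measure N (P ` A) = 1"
      using T(5) PA[OF A(1)] by (simp add: ergodic_def)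
    then show "measure N A = 0 \<or> measure N A = 1" using mP[OF PA[OF A(1)]] PB by simp
  qed
  moreover have "rigid N ?S"
  proof -
    obtain m where m0: "\<And>k. 0 < m k"
      and m: "\<And>A. A \<in> sets N \<Longrightarrow> (\<lambda>k. measure N (((T ^^ m k) -` A \<inter> space N) - A)) \<longlonglongrightarrow> 0"
      using T(6) unfolding rigid_def by blast
    have "measure N ((?S ^^ j) -` A - A) = measure N ((T ^^ j) -` (P ` A) - P ` A)" if A: "A \<in> sets N" for j A
    proof -
      have "(?S ^^ j) -` A - A = P -` ((T ^^ j) -` (P ` A) - P ` A)"
        unfolding Sv vimage_Diff PB ..
      moreover have "(T ^^ j) -` (P ` A) \<in> sets N"
        using measurable_sets[OF funpow_measurable[OF T(2)] PA[OF A]] by simp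
      ultimately show ?thesis using mP PA[OF A] by simp
    qed
    then show ?thesis using m0 m[OF PA] unfolding rigid_def by (intro exI[of _ m]) simp
  qed
  ultimately show ?thesis using bij S iS dS by (simp add: rigid_ergodic_mpt_def)
qed

end

text \<open>The analogue of \<open>int_iterate\<close> for a bijection of a whole type.\<close>

definition int_power :: "('a \<Rightarrow> 'a) \<Rightarrow> int \<Rightarrow> 'a \<Rightarrow> 'a" where
  "int_power T k = (if k \<ge> 0 then T ^^ nat k else inv T ^^ nat (- k))"

lemma int_power_inv: "bij T \<Longrightarrow> int_power (inv T) k = int_power T (- k)"
  by (auto simp: int_power_def inv_inv_eq)

text \<open>The \<open>\<sigma>\<close>-algebra, the measure and the topology are all carried
  along \<open>f\<close>, so that any injection into the reals will do.\<close>

locale transport = full_prob_space N for N :: "'a measure" +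
  fixes f :: "'a \<Rightarrow> real"
  assumes inj_f: "inj f"
begin

abbreviation "M \<equiv> embed_measure N f"
abbreviation "push T \<equiv> f \<circ> T \<circ> inv f"

lemma space_M: "space M = range f" by (simp add: space_embed_measure)
lemma sets_M: "sets M = (\<lambda>A. f ` A) ` sets N" using sets_embed_measure[OF inj_f, of N] by auto
lemma measure_M: "A \<in> sets N \<Longrightarrow> measure M (f ` A) = measure N A"
  by (simp add: measure_def emeasure_embed_measure_image[OF inj_f])
lemma prob_space_M: "prob_space M"
  using emeasure_embed_measure_image[OF inj_f, of UNIV N] emeasure_space_1 sets.top[of N]
  by (intro prob_spaceI) (simp add: space_M)

lemma push_f: "push T (f x) = f (T x)" using inj_f by simp

lemma push_vimage: "push T -` (f ` A) \<inter> range f = f ` (T -` A)"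
  by (auto simp: inj_eq[OF inj_f] inv_f_f[OF inj_f])

lemma push_funpow: "((push T) ^^ j) (f x) = f ((T ^^ j) x)"
  by (induction j) (use inj_f in auto)

lemma push_funpow_vimage: "((push T) ^^ j) -` (f ` A) \<inter> range f = f ` ((T ^^ j) -` A)"
  using push_funpow[where T=T and j=j] by (auto simp: inj_eq[OF inj_f] simp del: comp_apply)

lemma push_measurable: assumes "T \<in> measurable N N" shows "push T \<in> measurable M M"
proof (rule measurableI)
  fix A assume "A \<in> sets M"
  then obtain B where B: "B \<in> sets N" "A = f ` B" using sets_M by auto
  have "T -` B \<in> sets N" using measurable_sets[OF assms B(1)] by simp
  then show "push T -` A \<inter> space M \<in> sets M" using push_vimage[where T=T and A=B] B sets_M space_M by auto
qed (auto simp: space_M)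

lemma push_distr:
  assumes "T \<in> measurable N N" "distr N N T = N" shows "distr M M (push T) = M"
proof (rule measure_eqI)
  fix A assume "A \<in> sets (distr M M (push T))"
  then obtain B where B: "B \<in> sets N" "A = f ` B" using sets_M by auto
  have TB: "T -` B \<in> sets N" using measurable_sets[OF assms(1) B(1)] by simp
  have "emeasure (distr M M (push T)) A = emeasure M (f ` (T -` B))"
    using push_measurable[OF assms(1)] B sets_M push_vimage[where T=T and A=B]
    by (subst emeasure_distr) (auto simp: space_M)
  also have "\<dots> = emeasure N (T -` B)" using TB by (rule emeasure_embed_measure_image[OF inj_f])
  also have "\<dots> = emeasure (distr N N T) B" using emeasure_distr[OF assms(1) B(1)] by simp
  also have "\<dots> = emeasure M A" using assms B by (simp add: emeasure_embed_measure_image[OF inj_f])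
  finally show "emeasure (distr M M (push T)) A = emeasure M A" .
qed simp

lemma push_bij: assumes "bij T" shows "bij_betw (push T) (range f) (range f)"
  using assms inj_f by (intro bij_betw_byWitness[where f'="push (inv T)"])
    (auto simp: bij_is_inj bij_is_surj surj_f_inv_f)

lemma push_the_inv: assumes "bij T" "y \<in> range f"
  shows "the_inv_into (range f) (push T) y = push (inv T) y"
proof -
  obtain x where x: "y = f x" using assms by auto
  have "push T (push (inv T) y) = y" using assms(1) inj_f x by (simp add: bij_is_surj surj_f_inv_f)
  then show ?thesis
    using push_bij[OF assms(1)] by (intro the_inv_into_f_eq) (auto simp: bij_betw_def)
qed

lemma push_invertible_mpt:
  assumes "rigid_ergodic_mpt N T" shows "invertible_mpt M (push T)"
proof -
  have T: "bij T" "T \<in> measurable N N" "inv T \<in> measurable N N" "distr N N T = N"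
    using assms by (auto simp: rigid_ergodic_mpt_def)
  have "the_inv_into (space M) (push T) \<in> measurable M M \<longleftrightarrow> push (inv T) \<in> measurable M M"
    by (rule measurable_cong) (use push_the_inv[OF T(1)] in \<open>simp add: space_M\<close>)
  then show ?thesis unfolding invertible_mpt_def
    using push_bij[OF T(1)] push_measurable[OF T(2)] push_measurable[OF T(3)] push_distr[OF T(2,4)]
    by (simp add: space_M)
qed

lemma push_ergodic:
  assumes "ergodic N T" shows "ergodic M (push T)"
  unfolding ergodic_def
proof (intro ballI impI)
  fix A assume A: "A \<in> sets M" "push T -` A \<inter> space M = A"
  then obtain B where B: "B \<in> sets N" "A = f ` B" using sets_M by auto
  then have "f ` (T -` B) = f ` B" using A(2) push_vimage[where T=T and A=B] by (simp add: space_M)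
  then have "T -` B = B" using inj_f by (simp add: inj_image_eq_iff)
  then show "measure M A = 0 \<or> measure M A = 1"
    using assms B by (simp add: ergodic_def measure_M)
qed

lemma push_rigid:
  assumes T: "T \<in> measurable N N" and r: "rigid N T" shows "rigid M (push T)"
proof -
  obtain m where m0: "\<And>k. 0 < m k"
    and m: "\<And>A. A \<in> sets N \<Longrightarrow> (\<lambda>k. measure N (((T ^^ m k) -` A \<inter> space N) - A)) \<longlonglongrightarrow> 0"
    using r unfolding rigid_def by blast
  have "(\<lambda>k. measure M ((((push T) ^^ m k) -` A \<inter> space M) - A)) \<longlonglongrightarrow> 0" if A: "A \<in> sets M" for A
  proof -
    obtain B where B: "B \<in> sets N" "A = f ` B" using A sets_M by auto
    have "measure M ((((push T) ^^ j) -` A \<inter> space M) - A) = measure N ((T ^^ j) -` B - B)" for j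
    proof -
      have "(T ^^ j) -` B \<in> sets N" using measurable_sets[OF funpow_measurable[OF T] B(1)] by simp
      moreover have "(((push T) ^^ j) -` A \<inter> space M) - A = f ` ((T ^^ j) -` B - B)"
        using B push_funpow_vimage[where T=T and j=j and A=B] inj_f by (simp add: space_M image_set_diff)
      ultimately show ?thesis using B by (simp add: measure_M)
    qed
    then show ?thesis using m[OF B(1)] by simp
  qed
  then show ?thesis using m0 unfolding rigid_def by blast
qed

lemma push_KS_entropy:
  assumes "rigid_ergodic_mpt N T" shows "KS_entropy M (push T) = 0"
proof -
  interpret M: prob_space M by (rule prob_space_M)
  show ?thesis using assms unfolding rigid_ergodic_mpt_def
    by (intro M.rigid_imp_KS_entropy_0 push_measurable push_distr push_rigid) auto
qed

lemma int_iterate_push: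
  assumes "bij T" shows "int_iterate M (push T) k (f x) = f (int_power T k x)"
proof -
  define h where "h = the_inv_into (range f) (push T)"
  have h: "h (f x) = f (inv T x)" for x
    unfolding h_def push_the_inv[OF assms rangeI] by (rule push_f)
  have "(h ^^ j) (f x) = f ((inv T ^^ j) x)" for j
    by (induction j) (simp_all add: h)
  then have "(the_inv_into (range f) (push T) ^^ j) (f x) = f ((inv T ^^ j) x)" for j
    by (simp only: h_def)
  then show ?thesis unfolding int_iterate_def int_power_def space_M using push_funpow[where T=T] by simp
qed

lemma standard_M:
  assumes X: "topspace X = UNIV" "completely_metrizable_space X" "second_countable X"
    "sets N = sigma_sets UNIV {U. openin X U}"
  shows "standard_prob_space M"
proof -
  define Y where "Y = pullback_topology (range f) (inv f) X"
  have open_Y: "openin Y V \<longleftrightarrow> (\<exists>U. openin X U \<and> V = f ` U)" for V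
  proof -
    have "inv f -` U \<inter> range f = f ` U" for U using inj_f by auto
    then show ?thesis by (auto simp: Y_def openin_pullback_topology)
  qed
  have top_Y: "topspace Y = range f" by (simp add: Y_def topspace_pullback_topology X)
  have "homeomorphic_map X Y f"
    unfolding homeomorphic_map_def quotient_map_def top_Y X(1)
    using inj_f by (auto simp: open_Y inj_vimage_image_eq vimage_def[symmetric] inj_image_eq_iff
        intro!: exI[of _ "f -` _"])
  then have "X homeomorphic_space Y" by (rule homeomorphic_map_imp_homeomorphic_space)
  then have "completely_metrizable_space Y" "second_countable Y"
    using X homeomorphic_completely_metrizable_space homeomorphic_space_second_countability by blast+
  moreover have "sets M = sigma_sets (topspace Y) {U. openin Y U}"
  proof -
    have inv_image: "inv f -` U \<inter> range f = f ` U" for U using inj_f by auto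
    have "{U. openin Y U} = (\<lambda>A. f ` A) ` {U. openin X U}" using open_Y by auto
    moreover have "sigma_sets (range f) ((\<lambda>A. f ` A) ` {U. openin X U}) = (\<lambda>A. f ` A) ` sigma_sets UNIV {U. openin X U}"
      using sigma_sets_vimage_commute[of "inv f" "range f" UNIV "{U. openin X U}"]
      by (simp add: inv_image image_Collect Setcompr_eq_image)
    ultimately show ?thesis using sets_M X(4) top_Y by simp
  qed
  ultimately show ?thesis unfolding standard_prob_space_def using prob_space_M top_Y space_M
    by (intro conjI exI[of _ Y]) simp_all
qed

text \<open>The integrals of the averages are the Cesaro means of the measures of the sets of points that
  \<open>T\<close> at time \<open>p n\<close> and \<open>S\<close> at time \<open>q n\<close> both send to \<open>A\<close>.\<close>

lemma push_not_L2_convergent: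
  assumes T: "bij T" "T \<in> measurable N N" "inv T \<in> measurable N N"
    and S: "bij S" "S \<in> measurable N N" "inv S \<in> measurable N N"
    and A: "A \<in> sets N"
    and div: "\<not> convergent (\<lambda>L. (1 / real L) * (\<Sum>n<L. measure N (int_power T (p n) -` A \<inter> int_power S (q n) -` A)))"
  shows "\<not> L2_convergent M (\<lambda>L x. (1 / real L) *
      (\<Sum>n<L. indicator (f ` A) (int_iterate M (push T) (p n) x) * indicator (f ` A) (int_iterate M (push S) (q n) x)))"
    (is "\<not> L2_convergent M ?F")
proof
  assume L2: "L2_convergent M ?F"
  interpret M: prob_space M by (rule prob_space_M)
  have V: "int_power R k -` A \<in> sets N" if "R \<in> measurable N N" "inv R \<in> measurable N N" for R k
    using measurable_sets[OF funpow_measurable[OF that(1)] A] measurable_sets[OF funpow_measurable[OF that(2)] A]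
    by (auto simp: int_power_def)
  define W where "W n = int_power T (p n) -` A \<inter> int_power S (q n) -` A" for n
  have W: "W n \<in> sets N" for n unfolding W_def using V T S by auto
  have fW: "f ` W n \<in> sets M" for n using W sets_M by auto
  have eq: "?F L x = (1 / real L) * (\<Sum>n<L. indicator (f ` W n) x)" if x: "x \<in> space M" for L x
  proof -
    obtain y where y: "x = f y" using x unfolding space_M by blast
    have "indicator (f ` A) (int_iterate M (push T) (p n) x) * indicator (f ` A) (int_iterate M (push S) (q n) x)
        = (indicator (f ` W n) x :: real)" for n
      unfolding y int_iterate_push[OF T(1)] int_iterate_push[OF S(1)]
      by (simp add: indicator_def inj_image_mem_iff[OF inj_f] W_def)
    then show ?thesis by simp
  qed
  have meas: "?F L \<in> borel_measurable M" for L
    by (subst measurable_cong[OF eq]) (use fW in auto)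
  have bound: "\<bar>?F L x\<bar> \<le> 1" for L x
  proof -
    have "(\<Sum>n<L. indicator (f ` A) (int_iterate M (push T) (p n) x) * indicator (f ` A) (int_iterate M (push S) (q n) x) :: real) \<le> (\<Sum>n<L. 1)"
      by (intro sum_mono) (auto simp: indicator_def)
    moreover have "0 \<le> (\<Sum>n<L. indicator (f ` A) (int_iterate M (push T) (p n) x) * indicator (f ` A) (int_iterate M (push S) (q n) x) :: real)"
      by (intro sum_nonneg) auto
    ultimately show ?thesis by (cases "L = 0") (auto simp: field_simps)
  qed
  have int: "integral\<^sup>L M (?F L) = (1 / real L) * (\<Sum>n<L. measure N (W n))" for L
  proof -
    have "integral\<^sup>L M (?F L) = (\<integral>x. (1 / real L) * (\<Sum>n<L. indicator (f ` W n) x) \<partial>M)"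
      by (rule Bochner_Integration.integral_cong[OF refl eq])
    also have "\<dots> = (1 / real L) * (\<Sum>n<L. measure M (f ` W n))"
      using fW by (simp add: M.emeasure_eq_measure)
    finally show ?thesis using W by (simp add: measure_M)
  qed
  have "convergent (\<lambda>L. integral\<^sup>L M (?F L))"
    by (rule M.L2_convergent_imp_integral_convergent[OF meas bound L2])
  then show False using div unfolding int W_def by (rule notE[rotated])
qed

end

section \<open>Coins shuffled over a base\<close>

text \<open>A countable product of discrete spaces.\<close>

lemma completely_metrizable_euclidean_nat_bool:
  "completely_metrizable_space (euclidean :: ((nat \<Rightarrow> nat) \<times> (int \<Rightarrow> bool)) topology)"
proof -
  have n: "(euclidean :: nat topology) = discrete_topology UNIV"
    by (simp add: topology_eq Topological_Spaces.open_discrete)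
  have b: "(euclidean :: bool topology) = discrete_topology UNIV"
    by (simp add: topology_eq Topological_Spaces.open_discrete)
  have "completely_metrizable_space (product_topology (\<lambda>i. (euclidean :: nat topology)) (UNIV :: nat set))"
    unfolding n by (simp add: completely_metrizable_space_product_topology completely_metrizable_space_discrete_topology)
  moreover have "completely_metrizable_space (product_topology (\<lambda>i. (euclidean :: bool topology)) (UNIV :: int set))"
    unfolding b by (simp add: completely_metrizable_space_product_topology completely_metrizable_space_discrete_topology)
  ultimately show ?thesis
    unfolding euclidean_product_topology prod_topology_euclidean[symmetric]
    by (simp add: completely_metrizable_space_prod_topology del: prod_topology_euclidean)
qed

lemma second_countable_euclidean:
  "second_countable (euclidean :: 'a::second_countable_topology topology)"
proof -
  obtain B :: "'a set set" where "countable B" "topological_basis B"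
    using ex_countable_basis by blast
  have "\<forall>V\<in>B. open V" using \<open>topological_basis B\<close> by (simp add: topological_basis_open)
  moreover have "\<forall>U x. open U \<and> x \<in> U \<longrightarrow> (\<exists>V\<in>B. x \<in> V \<and> V \<subseteq> U)"
    using \<open>topological_basis B\<close> by (meson topological_basisE)
  ultimately show ?thesis
    using \<open>countable B\<close> unfolding second_countable_def open_openin[symmetric] by blast
qed

text \<open>The cylinder sets, which form a generating \<open>\<pi>\<close>-system of the product.\<close>

definition boxes :: "('i \<Rightarrow> 'b) set set" where
  "boxes = {{x. \<forall>i\<in>J. x i \<in> E i} |J E. finite J}"

lemma boxesI: "finite J \<Longrightarrow> {x. \<forall>i\<in>J. x i \<in> E i} \<in> boxes"
  unfolding boxes_def by blast

lemma UNIV_boxes: "UNIV \<in> boxes"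
  using boxesI[of "{}"] by simp

lemma Int_stable_boxes: "Int_stable boxes"
proof (rule Int_stableI)
  fix A B :: "('i \<Rightarrow> 'b) set" assume "A \<in> boxes" "B \<in> boxes"
  then obtain J E J' E' where A: "finite J" "A = {x. \<forall>i\<in>J. x i \<in> E i}"
    and B: "finite J'" "B = {x. \<forall>i\<in>J'. x i \<in> E' i}" unfolding boxes_def by blast
  define E'' where "E'' i = (if i \<in> J then E i else UNIV) \<inter> (if i \<in> J' then E' i else UNIV)" for i
  have "A \<inter> B = {x. \<forall>i\<in>J \<union> J'. x i \<in> E'' i}"
    unfolding A B E''_def by auto
  then show "A \<inter> B \<in> boxes" using A B boxesI[of "J \<union> J'" E''] by simp
qed

abbreviation PiP :: "('i \<Rightarrow> 'b pmf) \<Rightarrow> ('i \<Rightarrow> 'b) measure" where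
  "PiP P \<equiv> PiM UNIV (\<lambda>i. measure_pmf (P i))"

lemma space_PiP: "space (PiP P) = UNIV"
  by (simp add: space_PiM)

lemma prob_space_PiP: "prob_space (PiP P)"
  by (intro prob_space_PiM measure_pmf.prob_space_axioms)

lemma prod_emb_box: "prod_emb UNIV (\<lambda>i. measure_pmf (P i)) J (Pi\<^sub>E J E) = {x. \<forall>i\<in>J. x i \<in> E i}"
  by (auto simp: prod_emb_def PiE_def Pi_def)

lemma box_sets: assumes "finite J" shows "{x. \<forall>i\<in>J. x i \<in> E i} \<in> sets (PiP P)"
  using sets_PiM_I[of J UNIV E "\<lambda>i. measure_pmf (P i)"] assms by (simp add: prod_emb_box)

lemma measure_box:
  assumes "finite J"
  shows "measure (PiP P) {x. \<forall>i\<in>J. x i \<in> E i} = (\<Prod>i\<in>J. measure (measure_pmf (P i)) (E i))"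
proof -
  interpret product_prob_space "\<lambda>i. measure_pmf (P i)" UNIV
    by unfold_locales
  show ?thesis using measure_PiM_emb[of J E] assms by (simp add: prod_emb_box)
qed

lemma sets_PiP: "sets (PiP P) = sigma_sets UNIV boxes"
proof
  have "prod_algebra UNIV (\<lambda>i. measure_pmf (P i)) \<subseteq> boxes"
  proof
    fix A assume "A \<in> prod_algebra UNIV (\<lambda>i. measure_pmf (P i))"
    then obtain J E where "A = prod_emb UNIV (\<lambda>i. measure_pmf (P i)) J (Pi\<^sub>E J E)" "finite J"
      by (rule prod_algebraE) auto
    then show "A \<in> boxes" unfolding prod_emb_box by (simp add: boxesI)
  qed
  then show "sets (PiP P) \<subseteq> sigma_sets UNIV boxes"
    unfolding sets_PiM by (simp add: sigma_sets_mono')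
  have "boxes \<subseteq> sets (PiP P)" unfolding boxes_def using box_sets by blast
  then show "sigma_sets UNIV boxes \<subseteq> sets (PiP P)"
    using sets.sigma_sets_subset[of boxes "PiP P"] by (simp add: space_PiP)
qed

lemma measurable_into_PiP:
  assumes "\<And>i. (\<lambda>x. f x i) \<in> measurable M (count_space UNIV)"
  shows "f \<in> measurable M (PiP P)"
  by (rule measurable_PiM_single') (use assms in \<open>auto simp: space_PiM\<close>)

lemma measurable_PiP_component: "(\<lambda>x. x i) \<in> measurable (PiP P) (count_space UNIV)"
  using measurable_component_singleton[of i UNIV "\<lambda>i. measure_pmf (P i)"]
  by (simp cong: measurable_cong_sets)

lemma PiP_measure_preserving:
  assumes m: "f \<in> measurable (PiP P) (PiP P)"
    and b: "\<And>J E. finite J \<Longrightarrow> measure (PiP P) (f -` {x. \<forall>i\<in>J. x i \<in> E i}) = (\<Prod>i\<in>J. measure (measure_pmf (P i)) (E i))"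
  shows "distr (PiP P) (PiP P) f = PiP P"
proof (rule measure_eqI_PiM_infinite)
  interpret prob_space "PiP P" by (rule prob_space_PiP)
  show "finite_measure (distr (PiP P) (PiP P) f)" using finite_measure_distr[OF m] .
  fix A and J :: "'a set" assume J: "finite J" 
  have "emeasure (distr (PiP P) (PiP P) f) {x. \<forall>i\<in>J. x i \<in> A i} = emeasure (PiP P) (f -` {x. \<forall>i\<in>J. x i \<in> A i})"
    using emeasure_distr[OF m box_sets[OF J]] by (simp add: space_PiP)
  also have "\<dots> = emeasure (PiP P) {x. \<forall>i\<in>J. x i \<in> A i}"
    unfolding emeasure_eq_measure b[OF J] measure_box[OF J] ..
  finally show "emeasure (distr (PiP P) (PiP P) f) (prod_emb UNIV (\<lambda>i. measure_pmf (P i)) J (Pi\<^sub>E J A)) =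
     emeasure (PiP P) (prod_emb UNIV (\<lambda>i. measure_pmf (P i)) J (Pi\<^sub>E J A))"
    by (simp add: prod_emb_box)
qed simp_all

text \<open>Independent identically distributed coordinates are exchangeable.\<close>

lemma PiP_permute:
  fixes \<tau> :: "'i \<Rightarrow> 'i" and p :: "'b pmf"
  assumes "inj \<tau>"
  shows "distr (PiP (\<lambda>_. p)) (PiP (\<lambda>_. p)) (\<lambda>y i. y (\<tau> i)) = PiP (\<lambda>_. p)"
proof (rule PiP_measure_preserving)
  show "(\<lambda>y i. y (\<tau> i)) \<in> measurable (PiP (\<lambda>_. p)) (PiP (\<lambda>_. p))"
    by (intro measurable_into_PiP measurable_PiP_component)
  fix J :: "'i set" and E :: "'i \<Rightarrow> 'b set" assume J: "finite J"
  have "(\<lambda>y i. y (\<tau> i)) -` {x. \<forall>i\<in>J. x i \<in> E i} = {x. \<forall>i\<in>\<tau> ` J. x i \<in> E (inv \<tau> i)}"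
    using assms by auto
  then show "measure (PiP (\<lambda>_. p)) ((\<lambda>y i. y (\<tau> i)) -` {x. \<forall>i\<in>J. x i \<in> E i}) = (\<Prod>i\<in>J. measure (measure_pmf p) (E i))"
    using J assms measure_box[of "\<tau> ` J" "\<lambda>_. p" "\<lambda>i. E (inv \<tau> i)"]
    by (simp add: prod.reindex inj_on_subset)
qed

text \<open>The base point moves by \<open>R\<close>, and the coins are renamed by a permutation depending on the base
  point. Both the transformation \<open>T\<close> and the map conjugating it to \<open>S\<close> are of this form.\<close>

definition skew :: "('w \<Rightarrow> 'w) \<Rightarrow> ('w \<Rightarrow> int \<Rightarrow> int) \<Rightarrow> 'w \<times> (int \<Rightarrow> bool) \<Rightarrow> 'w \<times> (int \<Rightarrow> bool)" where
  "skew R \<tau> = (\<lambda>(w, y). (R w, \<lambda>i. y (\<tau> w i)))"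

abbreviation coins :: "(int \<Rightarrow> bool) measure" where
  "coins \<equiv> PiP (\<lambda>_. pmf_of_set UNIV)"

lemma prob_space_coins: "prob_space coins" by (rule prob_space_PiP)

lemma skew_measurable:
  assumes R: "R \<in> measurable B B" and t: "\<And>i. (\<lambda>w. \<tau> w i) \<in> measurable B (count_space UNIV)"
  shows "skew R \<tau> \<in> measurable (B \<Otimes>\<^sub>M coins) (B \<Otimes>\<^sub>M coins)"
proof -
  have "(\<lambda>x. \<lambda>i. snd x (\<tau> (fst x) i)) \<in> measurable (B \<Otimes>\<^sub>M coins) coins"
  proof (rule measurable_into_PiP)
    fix i
    have "(\<lambda>x. snd x j) \<in> measurable (B \<Otimes>\<^sub>M coins) (count_space UNIV)" for j
      by (rule measurable_compose[OF measurable_snd measurable_PiP_component])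
    moreover have "(\<lambda>x. \<tau> (fst x) i) \<in> measurable (B \<Otimes>\<^sub>M coins) (count_space UNIV)"
      by (rule measurable_compose[OF measurable_fst t])
    ultimately show "(\<lambda>x. snd x (\<tau> (fst x) i)) \<in> measurable (B \<Otimes>\<^sub>M coins) (count_space UNIV)"
      by (rule measurable_compose_countable)
  qed
  then show ?thesis unfolding skew_def case_prod_beta
    using measurable_compose[OF measurable_fst R] by (intro measurable_Pair)
qed

text \<open>By Fubini, since every renaming preserves the law of the coins.\<close>

lemma skew_measure_preserving:
  assumes B: "prob_space B" and R: "R \<in> measurable B B" "distr B B R = B"
    and t: "\<And>i. (\<lambda>w. \<tau> w i) \<in> measurable B (count_space UNIV)" and inj: "\<And>w. inj (\<tau> w)"
  shows "distr (B \<Otimes>\<^sub>M coins) (B \<Otimes>\<^sub>M coins) (skew R \<tau>) = B \<Otimes>\<^sub>M coins"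
proof (rule measure_eqI)
  interpret C: prob_space coins by (rule prob_space_coins)
  fix A assume "A \<in> sets (distr (B \<Otimes>\<^sub>M coins) (B \<Otimes>\<^sub>M coins) (skew R \<tau>))"
  then have A: "A \<in> sets (B \<Otimes>\<^sub>M coins)" by simp
  note S = skew_measurable[OF R(1) t]
  let ?V = "skew R \<tau> -` A \<inter> space (B \<Otimes>\<^sub>M coins)"
  have fib: "emeasure coins (Pair w -` ?V) = emeasure coins (Pair (R w) -` A)" if w: "w \<in> space B" for w
  proof -
    have "Pair w -` ?V = (\<lambda>y i. y (\<tau> w i)) -` (Pair (R w) -` A) \<inter> space coins"
      using w by (auto simp: skew_def space_pair_measure space_PiP)
    moreover have "emeasure coins \<dots> = emeasure (distr coins coins (\<lambda>y i. y (\<tau> w i))) (Pair (R w) -` A)"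
      using A by (intro emeasure_distr[symmetric] measurable_into_PiP measurable_PiP_component sets_Pair1)
    ultimately show ?thesis using PiP_permute[OF inj[of w], of "pmf_of_set (UNIV :: bool set)"] by simp
  qed
  have "emeasure (distr (B \<Otimes>\<^sub>M coins) (B \<Otimes>\<^sub>M coins) (skew R \<tau>)) A = emeasure (B \<Otimes>\<^sub>M coins) ?V"
    using S A by (rule emeasure_distr)
  also have "\<dots> = (\<integral>\<^sup>+ w. emeasure coins (Pair w -` ?V) \<partial>B)"
    using measurable_sets[OF S A] by (rule C.emeasure_pair_measure_alt)
  also have "\<dots> = (\<integral>\<^sup>+ w. emeasure coins (Pair (R w) -` A) \<partial>B)"
    by (intro nn_integral_cong fib)
  also have "\<dots> = (\<integral>\<^sup>+ w. emeasure coins (Pair w -` A) \<partial>distr B B R)"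
    using R A by (intro nn_integral_distr[symmetric]) (auto intro: C.measurable_emeasure_Pair)
  also have "\<dots> = emeasure (B \<Otimes>\<^sub>M coins) A"
    using A by (simp add: R C.emeasure_pair_measure_alt)
  finally show "emeasure (distr (B \<Otimes>\<^sub>M coins) (B \<Otimes>\<^sub>M coins) (skew R \<tau>)) A = emeasure (B \<Otimes>\<^sub>M coins) A" .
qed simp

lemma skew_bij:
  assumes "bij R" "\<And>w. bij (\<tau> w)"
  shows "bij (skew R \<tau>)" "inv (skew R \<tau>) = skew (inv R) (\<lambda>w. inv (\<tau> (inv R w)))"
proof -
  let ?I = "skew (inv R) (\<lambda>w. inv (\<tau> (inv R w)))"
  have 1: "?I (skew R \<tau> x) = x" for x
    using assms by (cases x) (simp add: skew_def bij_is_inj bij_is_surj surj_f_inv_f)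
  have 2: "skew R \<tau> (?I x) = x" for x
    using assms by (cases x) (simp add: skew_def bij_is_inj bij_is_surj surj_f_inv_f)
  show "bij (skew R \<tau>)" by (rule o_bij[of ?I]) (use 1 2 in auto)
  show "inv (skew R \<tau>) = ?I" by (rule inv_unique_comp) (use 1 2 in auto)
qed

lemma skew_inv_measurable:
  assumes "bij R" "inv R \<in> measurable B B" "\<And>w. bij (\<tau> w)"
    and t: "\<And>i. (\<lambda>w. \<tau> w i) \<in> measurable B (count_space UNIV)"
  shows "inv (skew R \<tau>) \<in> measurable (B \<Otimes>\<^sub>M coins) (B \<Otimes>\<^sub>M coins)"
  unfolding skew_bij(2)[OF assms(1,3)]
proof (rule skew_measurable[OF assms(2)])
  fix i
  have "(\<lambda>w. inv (\<tau> w) i) \<in> measurable B (count_space UNIV)"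
  proof (rule measurable_count_space_eq_countable[THEN iffD2])
    have "(\<lambda>w. inv (\<tau> w) i) -` {j} \<inter> space B = (\<lambda>w. \<tau> w j) -` {i} \<inter> space B" for j
      using assms(3) by (auto simp: bij_is_inj bij_is_surj surj_f_inv_f bij_inv_eq_iff)
    then show "(\<lambda>w. inv (\<tau> w) i) \<in> space B \<rightarrow> UNIV \<and> (\<forall>a\<in>UNIV. (\<lambda>w. inv (\<tau> w) i) -` {a} \<inter> space B \<in> sets B)"
      using measurable_sets[OF t] by auto
  qed simp
  then show "(\<lambda>w. inv (\<tau> (inv R w)) i) \<in> measurable B (count_space UNIV)"
    by (rule measurable_compose[OF assms(2)])
qed

text \<open>Fubini with an exceptional set: the measure of \<open>C\<close> can be computed from the fibres over \<open>G\<close> alone,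
  at the cost of the measure of the complement of \<open>G\<close>.\<close>

lemma measure_close_by_fibres:
  assumes B: "prob_space B" and C: "C \<in> sets (B \<Otimes>\<^sub>M coins)" and G: "G \<in> sets B"
    and h: "h \<in> borel_measurable B" "\<And>w. 0 \<le> h w" "\<And>w. h w \<le> 1"
    and eq: "\<And>w. w \<in> G \<Longrightarrow> measure coins (Pair w -` C) = h w"
  shows "\<bar>measure (B \<Otimes>\<^sub>M coins) C - (\<integral>w. h w \<partial>B)\<bar> \<le> 1 - measure B G"
proof -
  interpret B: prob_space B by fact
  interpret C: prob_space coins by (rule prob_space_coins)
  interpret P: pair_prob_space B coins ..
  let ?m = "\<lambda>w. measure coins (Pair w -` C)"
  have m: "?m \<in> borel_measurable B"
    unfolding measure_def
    by (intro borel_measurable_enn2real C.measurable_emeasure_Pair C)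
  have int: "integrable B ?m" "integrable B h"
    using m h by (auto intro!: B.integrable_const_bound[where B=1])
  have intG: "integrable B (indicator (space B - G) :: _ \<Rightarrow> real)"
    using G by (intro B.integrable_const_bound[where B=1]) auto
  have "ennreal (measure (B \<Otimes>\<^sub>M coins) C) = (\<integral>\<^sup>+ w. emeasure coins (Pair w -` C) \<partial>B)"
    using C by (simp add: C.emeasure_pair_measure_alt flip: P.emeasure_eq_measure)
  also have "\<dots> = ennreal (\<integral>w. ?m w \<partial>B)"
    using int by (simp add: C.emeasure_eq_measure nn_integral_eq_integral)
  finally have "measure (B \<Otimes>\<^sub>M coins) C = (\<integral>w. ?m w \<partial>B)"
    by (simp add: integral_nonneg)
  then have "\<bar>measure (B \<Otimes>\<^sub>M coins) C - (\<integral>w. h w \<partial>B)\<bar> = \<bar>\<integral>w. (?m w - h w) \<partial>B\<bar>"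
    using int by simp
  also have "\<dots> \<le> (\<integral>w. \<bar>?m w - h w\<bar> \<partial>B)"
    by (rule integral_abs_bound)
  also have "\<dots> \<le> (\<integral>w. indicator (space B - G) w \<partial>B)"
  proof (rule integral_mono)
    fix w assume "w \<in> space B"
    show "\<bar>?m w - h w\<bar> \<le> indicator (space B - G) w"
    proof (cases "w \<in> G")
      case False
      have "0 \<le> ?m w" "?m w \<le> 1" by auto
      then have "\<bar>?m w - h w\<bar> \<le> 1" using h(2)[of w] h(3)[of w] by linarith
      then show ?thesis using False \<open>w \<in> space B\<close> by simp
    qed (simp add: eq)
  qed (use int intG in auto)
  also have "\<dots> = 1 - measure B G" using G by (simp add: B.prob_compl)
  finally show ?thesis .
qed

section \<open>A product of cyclic rotations and its cocycle\<close>

text \<open>Addition of \<open>1\<close> modulo \<open>q\<close>, extended by the identity to a bijection of all natural numbers.\<close>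

definition rot :: "nat \<Rightarrow> nat \<Rightarrow> nat" where
  "rot q w = (if w < q then Suc w mod q else w)"

lemma rot_funpow: "w < q \<Longrightarrow> (rot q ^^ t) w = (w + t) mod q"
  by (induction t) (auto simp: rot_def mod_Suc_eq)

lemma bij_betw_rot: "bij_betw (rot q) {..<q} {..<q}"
proof -
  have "rot q ` {..<q} \<subseteq> {..<q}" by (auto simp: rot_def)
  moreover have "inj_on (rot q) {..<q}"
  proof (rule inj_onI)
    fix v w assume "v \<in> {..<q}" "w \<in> {..<q}" "rot q v = rot q w"
    then have "Suc v mod q = Suc w mod q" "v < q" "w < q" by (auto simp: rot_def)
    then show "v = w" by (cases "Suc v = q"; cases "Suc w = q") auto
  qed
  ultimately show ?thesis by (simp add: bij_betw_def endo_inj_surj)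
qed

lemma bij_rot: "bij (rot q)"
proof -
  have "bij_betw (rot q) (- {..<q}) (- {..<q})"
    by (rule bij_betw_cong[THEN iffD1, OF _ bij_betw_id]) (simp add: rot_def)
  from bij_betw_combine[OF bij_betw_rot this] show ?thesis
    by (simp add: Compl_partition del: Compl_lessThan)
qed

lemma map_pmf_rot: "0 < q \<Longrightarrow> map_pmf (rot q) (pmf_of_set {..<q}) = pmf_of_set {..<q}"
  using bij_betw_rot[of q] by (intro map_pmf_of_set_bij_betw) auto

lemma card_near_multiple_le:
  assumes "0 < d"
  shows "card {w::nat. w < q \<and> w mod d + m \<ge> d} \<le> (q div d + 1) * m"
proof -
  \<comment> \<open>These \<open>w\<close> lie at a distance \<open>i + 1\<close>, with \<open>i < m\<close>, below the multiple \<open>(a + 1) d\<close>, where \<open>a = w div d\<close>.\<close>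
  have "{w. w < q \<and> w mod d + m \<ge> d} \<subseteq> (\<lambda>(a, i). a * d + (d - 1 - i)) ` ({..q div d} \<times> {..<m})"
  proof
    fix w assume "w \<in> {w. w < q \<and> w mod d + m \<ge> d}"
    then have w: "w < q" "w mod d + m \<ge> d" by auto
    have "w mod d < d" using assms by simp
    then have "w = (w div d) * d + (d - 1 - (d - 1 - w mod d))" "d - 1 - w mod d < m"
      using w div_mult_mod_eq[of w d] by linarith+
    moreover have "w div d \<le> q div d" using w by (simp add: div_le_mono)
    ultimately show "w \<in> (\<lambda>(a, i). a * d + (d - 1 - i)) ` ({..q div d} \<times> {..<m})"
      by (intro image_eqI[of _ _ "(w div d, d - 1 - w mod d)"]) auto
  qed
  then have "card {w. w < q \<and> w mod d + m \<ge> d} \<le> card ((\<lambda>(a, i). a * d + (d - 1 - i)) ` ({..q div d} \<times> {..<m}))"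
    by (intro card_mono) auto
  also have "\<dots> \<le> card ({..q div d} \<times> {..<m})" by (rule card_image_le) auto
  finally show ?thesis by simp
qed

text \<open>\<open>Q k\<close> is the period of coordinate \<open>k\<close> and \<open>W k\<close> the product of the earlier periods. Coordinate \<open>k\<close>
  changes its contribution to the cocycle every \<open>D k\<close> steps, and \<open>H k\<close> is the largest time to be
  considered at scale \<open>k\<close>. Since \<open>H k\<close> is at most \<open>W (Suc k)\<close>, the factor \<open>2 ^ j\<close> in \<open>D j\<close> makes it unlikely that
  a coordinate \<open>j > k\<close> contributes before time \<open>H k\<close>. The last condition leaves room for a window of length
  \<open>W k\<close> at the times where the cocycle is at least \<open>k\<close>; it is used for ergodicity.\<close>

locale tower =
  fixes Q W D H :: "nat \<Rightarrow> nat"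
  assumes W_0: "W 0 = 1" and W_Suc: "\<And>k. W (Suc k) = W k * Q k"
    and D_eq: "\<And>k. D k = 2 ^ k * W k"
    and coprime_Q_W: "\<And>k. coprime (Q k) (W k)"
    and D_le_Q: "\<And>k. D k \<le> Q k"
    and H_le_Q: "\<And>k. 2 ^ k * H k \<le> Q k"
    and le_H: "\<And>k. D k * (W k + k) + W k \<le> H k"
begin

lemma W_pos: "0 < W k" and Q_pos: "0 < Q k" and D_pos: "0 < D k"
proof -
  have *: "0 < W k \<and> 0 < Q k \<and> 0 < D k" for k
  proof (induction k)
    case 0
    then show ?case using D_le_Q[of 0] D_eq[of 0] W_0 by simp
  next
    case (Suc k)
    then have "0 < W (Suc k)" by (simp add: W_Suc)
    moreover from this have "0 < D (Suc k)" by (simp add: D_eq)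
    ultimately show ?case using D_le_Q[of "Suc k"] by linarith
  qed
  show "0 < W k" "0 < Q k" "0 < D k" using * by auto
qed

lemma W_dvd: "j < k \<Longrightarrow> Q j dvd W k"
  by (induction k) (auto simp: W_Suc less_Suc_eq)

lemma W_mono:
  assumes "j \<le> k" shows "W j \<le> W k"
proof (rule lift_Suc_mono_le[OF _ assms])
  show "W n \<le> W (Suc n)" for n
    using mult_left_mono[of 1 "Q n" "W n"] Q_pos[of n] by (simp add: W_Suc)
qed

lemma H_le_W: "H k \<le> W (Suc k)"
proof -
  have "1 * H k \<le> 2 ^ k * H k" by (intro mult_right_mono) auto
  also have "\<dots> \<le> 1 * Q k" using H_le_Q by simp
  also have "\<dots> \<le> W k * Q k" using W_pos[of k] by (intro mult_right_mono) auto
  finally show ?thesis by (simp add: W_Suc)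
qed

definition odo :: "(nat \<Rightarrow> nat) \<Rightarrow> nat \<Rightarrow> nat" where
  "odo w = (\<lambda>k. rot (Q k) (w k))"

definition height :: "nat \<Rightarrow> nat \<Rightarrow> int" where
  "height k v = int (v div D k)"

definition jump :: "nat \<Rightarrow> nat \<Rightarrow> int" where
  "jump k v = height k (rot (Q k) v) - height k v"

text \<open>On the sets \<open>quiet K m\<close> defined below, with \<open>m > 0\<close>, only finitely many jumps are nonzero. Where infinitely many are, the
  sum is \<open>0\<close> by convention.\<close>

definition phi :: "(nat \<Rightarrow> nat) \<Rightarrow> int" where
  "phi w = (\<Sum>k | jump k (w k) \<noteq> 0. jump k (w k))"

definition cocycle :: "nat \<Rightarrow> (nat \<Rightarrow> nat) \<Rightarrow> int" where
  "cocycle t w = (\<Sum>i<t. phi ((odo ^^ i) w))"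

definition T :: "(nat \<Rightarrow> nat) \<times> (int \<Rightarrow> bool) \<Rightarrow> (nat \<Rightarrow> nat) \<times> (int \<Rightarrow> bool)" where
  "T = skew odo (\<lambda>w i. i + phi w)"

abbreviation base :: "(nat \<Rightarrow> nat) measure" where
  "base \<equiv> PiP (\<lambda>k. pmf_of_set {..<Q k})"

lemma odo_funpow: "(odo ^^ t) w = (\<lambda>j. (rot (Q j) ^^ t) (w j))"
  by (induction t) (auto simp: odo_def)

lemma T_funpow: "T ^^ t = skew (odo ^^ t) (\<lambda>w i. i + cocycle t w)"
proof (rule ext)
  fix x :: "(nat \<Rightarrow> nat) \<times> (int \<Rightarrow> bool)"
  obtain w y where x: "x = (w, y)" by (cases x)
  show "(T ^^ t) x = skew (odo ^^ t) (\<lambda>w i. i + cocycle t w) x"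
    unfolding x by (induction t) (simp_all add: skew_def T_def cocycle_def add_ac)
qed

text \<open>Within \<open>m\<close> steps no coordinate from \<open>K\<close> on wraps around or crosses a multiple of \<open>D j\<close>.\<close>

definition quiet :: "nat \<Rightarrow> nat \<Rightarrow> (nat \<Rightarrow> nat) set" where
  "quiet K m = {w. (\<forall>j. w j < Q j) \<and> (\<forall>j\<ge>K. w j + m < Q j \<and> w j mod D j + m < D j)}"

text \<open>The coordinates from \<open>K\<close> on do not jump, and each remaining coordinate gives a telescoping sum.\<close>

lemma cocycle_quiet:
  assumes w: "w \<in> quiet K m" and "t \<le> m"
  shows "cocycle t w = (\<Sum>j<K. height j ((w j + t) mod Q j) - height j (w j))"
  using assms(2)
proof (induction t)
  case 0
  have "w j mod Q j = w j" for j using w by (simp add: quiet_def)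
  then show ?case by (simp add: cocycle_def)
next
  case (Suc t)
  have lt: "w j < Q j" for j using w by (simp add: quiet_def)
  have pos: "(odo ^^ t) w j = (w j + t) mod Q j" for j
    by (simp add: odo_funpow rot_funpow lt)
  have jump: "jump j ((odo ^^ t) w j) = height j ((w j + Suc t) mod Q j) - height j ((w j + t) mod Q j)" for j
    using Q_pos[of j] unfolding pos jump_def by (simp add: rot_def mod_Suc_eq)
  have high: "height j (w j + s) = height j (w j)" if "K \<le> j" "s \<le> m" for j s
  proof -
    have "w j mod D j + s < D j" using w that by (force simp: quiet_def)
    then have "(w j + s) div D j = w j div D j"
      using D_pos[of j] div_mult_mod_eq[of "w j" "D j"]
      by (metis add.assoc add.right_neutral div_less div_mult_self3 less_nat_zero_code)
    then show ?thesis by (simp add: height_def)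
  qed
  have zero: "jump j ((odo ^^ t) w j) = 0" if "K \<le> j" for j
  proof -
    have "w j + m < Q j" using w that by (simp add: quiet_def)
    then show ?thesis using Suc.prems that high[of j t] high[of j "Suc t"] unfolding jump by simp
  qed
  have "{k. jump k ((odo ^^ t) w k) \<noteq> 0} \<subseteq> {..<K}"
  proof
    fix k assume "k \<in> {k. jump k ((odo ^^ t) w k) \<noteq> 0}"
    then show "k \<in> {..<K}" using zero[of k] by (cases "K \<le> k") auto
  qed
  then have "phi ((odo ^^ t) w) = (\<Sum>j<K. jump j ((odo ^^ t) w j))"
    unfolding phi_def by (intro sum.mono_neutral_left) auto
  then show ?case using Suc by (simp add: cocycle_def jump sum_subtractf)
qed

lemma height_bounds: "v < Q j \<Longrightarrow> 0 \<le> height j v \<and> height j v \<le> int (Q j) - 1"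
  unfolding height_def using div_le_dividend[of v "D j"] by linarith

lemma sum_Q_le_W: "(\<Sum>j<k. int (Q j) - 1) \<le> int (W k) - 1"
proof (induction k)
  case (Suc k)
  have "0 \<le> (int (W k) - 1) * (int (Q k) - 1)"
    using W_pos[of k] Q_pos[of k] by (intro mult_nonneg_nonneg) auto
  then show ?case using Suc by (simp add: W_Suc algebra_simps)
qed (simp add: W_0)

text \<open>The points whose cocycle is under control at scale \<open>k\<close>: up to time \<open>H k\<close> the coordinates above \<open>k\<close>
  are quiet and coordinate \<open>k\<close> does not wrap around.\<close>

definition good :: "nat \<Rightarrow> (nat \<Rightarrow> nat) set" where
  "good k = quiet (Suc k) (H k) \<inter> {w. w k + H k < Q k}"

text \<open>Coordinate \<open>k\<close> contributes \<open>t div D k\<close> or one more. The heights of a coordinate \<open>j < k\<close> lie between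
  \<open>0\<close> and \<open>Q j - 1\<close>, and these numbers add up to less than \<open>W k\<close>.\<close>

lemma cocycle_good:
  assumes w: "w \<in> good k" and t: "t \<le> H k"
  shows "int (t div D k) - int (W k) \<le> cocycle t w" "cocycle t w \<le> int (t div D k) + 1 + int (W k)"
proof -
  have lt: "w j < Q j" for j using w by (simp add: good_def quiet_def)
  have "cocycle t w = (\<Sum>j<k. height j ((w j + t) mod Q j) - height j (w j)) + (height k (w k + t) - height k (w k))"
    using cocycle_quiet[of w "Suc k" "H k" t] w t by (simp add: good_def)
  moreover have "\<bar>\<Sum>j<k. height j ((w j + t) mod Q j) - height j (w j)\<bar> \<le> (\<Sum>j<k. int (Q j) - 1)"
  proof (rule order_trans[OF sum_abs sum_mono])
    fix j
    have "(w j + t) mod Q j < Q j" using Q_pos by simp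
    then show "\<bar>height j ((w j + t) mod Q j) - height j (w j)\<bar> \<le> int (Q j) - 1"
      using height_bounds[of "(w j + t) mod Q j" j] height_bounds[OF lt[of j]] by linarith
  qed
  moreover have "int (t div D k) \<le> height k (w k + t) - height k (w k)"
    "height k (w k + t) - height k (w k) \<le> int (t div D k) + 1"
  proof -
    have "(w k + t) div D k = w k div D k + t div D k + (w k mod D k + t mod D k) div D k"
      by (rule div_add1_eq)
    moreover have "(w k mod D k + t mod D k) div D k \<le> 1"
    proof -
      have "w k mod D k + t mod D k < 2 * D k"
        using mod_less_divisor[OF D_pos[of k], of "w k"] mod_less_divisor[OF D_pos[of k], of t] by linarith
      then have "(w k mod D k + t mod D k) div D k < 2" by (simp add: less_mult_imp_div_less)
      then show ?thesis by simp
    qed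
    ultimately show "int (t div D k) \<le> height k (w k + t) - height k (w k)"
      "height k (w k + t) - height k (w k) \<le> int (t div D k) + 1"
      by (simp_all add: height_def)
  qed
  ultimately show "int (t div D k) - int (W k) \<le> cocycle t w" "cocycle t w \<le> int (t div D k) + 1 + int (W k)"
    using sum_Q_le_W[of k] by linarith+
qed

text \<open>The gap \<open>D k * (2 * W k + 3)\<close> raises the lower bound of \<open>cocycle_good\<close> at the later time above the
  upper bound at the earlier time.\<close>

lemma cocycle_good_less:
  assumes w: "w \<in> good k" and t: "t + D k * (2 * W k + 3) \<le> t'" "t' \<le> H k"
  shows "cocycle t w < cocycle t' w"
proof -
  have "t div D k + (2 * W k + 3) = (t + D k * (2 * W k + 3)) div D k"
    using D_pos[of k] by simp
  also have "\<dots> \<le> t' div D k" using t by (intro div_le_mono)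
  finally show ?thesis
    using cocycle_good(2)[OF w, of t] cocycle_good(1)[OF w, of t'] t by linarith
qed

lemma space_base: "space base = UNIV" by (rule space_PiP)

lemma prob_space_base: "prob_space base" by (rule prob_space_PiP)

lemma coord_sets: "{w. w j \<in> E} \<in> sets base"
  using box_sets[of "{j}" "\<lambda>_. E"] by simp

lemma measure_coord: "measure base {w. w j \<in> E} = card {v. v < Q j \<and> v \<in> E} / real (Q j)"
proof -
  have "{v. v < Q j \<and> v \<in> E} = {..<Q j} \<inter> E" by auto
  then show ?thesis
    using measure_box[of "{j}" "\<lambda>k. pmf_of_set {..<Q k}" "\<lambda>_. E"] Q_pos[of j]
    by (simp add: measure_pmf_of_set lessThan_empty_iff)
qed

text \<open>Coordinate \<open>j\<close> is disturbed within \<open>m\<close> steps with probability at most \<open>3 m / D j\<close>, which is at most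
  \<open>3 / 2 ^ j\<close> for \<open>j \<ge> K\<close>. Sum over \<open>j\<close>.\<close>

lemma quiet_prob:
  assumes m: "m \<le> W K"
  shows "quiet K m \<in> sets base" "measure base (quiet K m) \<ge> 1 - 6 * (1/2) ^ K"
proof -
  interpret prob_space base by (rule prob_space_base)
  define E where "E j = {v. v \<ge> Q j} \<union> (if K \<le> j then {v. v + m \<ge> Q j \<or> v mod D j + m \<ge> D j} else {})" for j
  define A where "A j = {w :: nat \<Rightarrow> nat. w j \<in> E j}" for j
  define e where "e j = (if K \<le> j then 3 * (1/2) ^ j else (0 :: real))" for j
  have A: "A j \<in> sets base" for j unfolding A_def by (rule coord_sets)
  have compl: "quiet K m = - (\<Union>j. A j)"
  proof -
    have "v \<notin> E j \<longleftrightarrow> v < Q j \<and> (K \<le> j \<longrightarrow> v + m < Q j \<and> v mod D j + m < D j)" for v j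
      by (auto simp: E_def)
    then show ?thesis by (simp add: set_eq_iff quiet_def A_def) blast
  qed
  have UA: "(\<Union>j. A j) \<in> sets base" using A by auto
  then show "quiet K m \<in> sets base"
    unfolding compl using sets.compl_sets[OF UA] by (simp add: space_base Compl_eq_Diff_UNIV)
  have le: "measure base (A j) \<le> e j" for j
  proof (cases "K \<le> j")
    case False
    then have z: "{v. v < Q j \<and> v \<in> E j} = {}" by (auto simp: E_def)
    show ?thesis using False unfolding A_def measure_coord z by (simp add: e_def)
  next
    case True
    have "{v. v < Q j \<and> v \<in> E j} \<subseteq> {Q j - m..<Q j} \<union> {v. v < Q j \<and> v mod D j + m \<ge> D j}"
      using True by (auto simp: E_def)
    then have "card {v. v < Q j \<and> v \<in> E j} \<le> card ({Q j - m..<Q j} \<union> {v. v < Q j \<and> v mod D j + m \<ge> D j})"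
      by (intro card_mono) auto
    also have "\<dots> \<le> card {Q j - m..<Q j} + card {v. v < Q j \<and> v mod D j + m \<ge> D j}"
      by (rule card_Un_le)
    also have "\<dots> \<le> m + (Q j div D j + 1) * m"
      using card_near_multiple_le[OF D_pos[of j], of "Q j" m] by (intro add_mono) auto
    finally have c: "real (card {v. v < Q j \<and> v \<in> E j}) \<le> real (m + (Q j div D j + 1) * m)"
      by (rule of_nat_mono)
    have "Q j div D j * D j \<le> Q j" by simp
    then have "real (Q j div D j) * real (D j) \<le> real (Q j)" by (metis of_nat_le_iff of_nat_mult)
    then have "real (Q j div D j) \<le> real (Q j) / real (D j)" using D_pos[of j] by (simp add: field_simps)
    moreover have "2 \<le> 2 * (real (Q j) / real (D j))" using D_le_Q[of j] D_pos[of j] by (simp add: pos_le_divide_eq)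
    ultimately have "2 + real (Q j div D j) \<le> 3 * (real (Q j) / real (D j))" by linarith
    then have "real m * (2 + real (Q j div D j)) \<le> real m * (3 * (real (Q j) / real (D j)))"
      by (rule mult_left_mono) simp
    moreover have "real (m + (Q j div D j + 1) * m) = real m * (2 + real (Q j div D j))"
      by (simp add: algebra_simps)
    ultimately have "real (m + (Q j div D j + 1) * m) \<le> real m * (3 * (real (Q j) / real (D j)))" by simp
    with c have "real (card {v. v < Q j \<and> v \<in> E j}) / real (Q j) \<le> 3 * (real m / real (D j))"
      using Q_pos[of j] by (simp add: field_simps)
    also have "real m / real (D j) \<le> (1/2) ^ j"
    proof -
      have "m \<le> W j" using m W_mono[OF True] by simp
      then show ?thesis using W_pos[of j] unfolding D_eq by (simp add: field_simps)
    qed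
    finally show ?thesis using True unfolding A_def measure_coord by (simp add: e_def)
  qed
  have "(\<lambda>j. 3 * (1/2) ^ K * (1/2) ^ j) sums (3 * (1/2) ^ K * (1 / (1 - 1/2 :: real)))"
    by (intro sums_mult geometric_sums) simp
  then have "(\<lambda>j. e (j + K)) sums (6 * (1/2) ^ K)"
    by (simp add: e_def power_add mult_ac)
  moreover have "(\<Sum>j<K. e j) = 0" by (simp add: e_def)
  ultimately have e: "e sums (6 * (1/2) ^ K)" by (simp add: sums_iff_shift)
  have summ: "summable (\<lambda>j. measure base (A j))"
    by (rule summable_comparison_test[OF _ sums_summable[OF e]]) (use le in auto)
  have "measure base (\<Union>j. A j) \<le> (\<Sum>j. measure base (A j))"
    using A summ by (intro finite_measure_subadditive_countably) auto
  also have "\<dots> \<le> (\<Sum>j. e j)" by (intro suminf_le le summ sums_summable[OF e])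
  also have "\<dots> = 6 * (1/2) ^ K" using sums_unique[OF e] by simp
  finally show "measure base (quiet K m) \<ge> 1 - 6 * (1/2) ^ K"
    unfolding compl using prob_compl[OF UA] by (simp add: space_base Compl_eq_Diff_UNIV)
qed

lemma good_prob: "good k \<in> sets base" "measure base (good k) \<ge> 1 - 4 * (1/2) ^ k"
proof -
  interpret prob_space base by (rule prob_space_base)
  note q = quiet_prob[OF H_le_W[of k]]
  let ?B = "{w :: nat \<Rightarrow> nat. w k \<in> {v. v + H k \<ge> Q k}}"
  have B: "?B \<in> sets base" by (rule coord_sets)
  have eq: "good k = quiet (Suc k) (H k) - ?B" by (auto simp: good_def)
  then show "good k \<in> sets base" using q(1) B by auto
  have "card {v. v < Q k \<and> v \<in> {v. v + H k \<ge> Q k}} \<le> card {Q k - H k..<Q k}"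
    by (intro card_mono) auto
  also have "\<dots> \<le> H k" by simp
  finally have "measure base ?B \<le> real (H k) / real (Q k)"
    unfolding measure_coord by (intro divide_right_mono) auto
  also have "\<dots> \<le> (1/2) ^ k"
  proof -
    have "2 ^ k * real (H k) \<le> real (Q k)" using H_le_Q[of k] by (metis of_nat_le_iff of_nat_mult of_nat_numeral of_nat_power)
    then show ?thesis using Q_pos[of k] by (simp add: field_simps)
  qed
  finally have "measure base ?B \<le> (1/2) ^ k" .
  moreover have "measure base (quiet (Suc k) (H k)) \<le> measure base (good k \<union> ?B)"
    using q(1) B by (intro finite_measure_mono) (auto simp: eq)
  moreover have "measure base (good k \<union> ?B) \<le> measure base (good k) + measure base ?B"
    using q(1) B by (intro measure_Un_le) (auto simp: eq)
  ultimately show "measure base (good k) \<ge> 1 - 4 * (1/2) ^ k" using q(2) by simp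
qed

end

section \<open>The skew product is rigid and ergodic\<close>

lemma bij_int_translation: "bij (\<lambda>i. i + c :: int)"
  by (rule o_bij[of "\<lambda>i. i - c"]) auto

lemma tendsto_0_if_geometric_bound:
  fixes x :: "nat \<Rightarrow> real"
  assumes "\<And>k. K \<le> k \<Longrightarrow> \<bar>x k\<bar> \<le> c * (1/2) ^ k"
  shows "x \<longlonglongrightarrow> 0"
proof (rule Lim_null_comparison)
  show "eventually (\<lambda>k. norm (x k) \<le> c * (1/2) ^ k) sequentially"
    using assms by (intro eventually_sequentiallyI[of K]) simp
  show "(\<lambda>k. c * (1/2) ^ k) \<longlonglongrightarrow> 0"
    by (rule tendsto_mult_right_zero[OF LIMSEQ_realpow_zero]) auto
qed

lemma measurable_binary_count_space:
  fixes f :: "'a \<Rightarrow> 'b::countable" and g :: "'a \<Rightarrow> 'c::countable"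
  assumes f: "f \<in> measurable M (count_space UNIV)" and g: "g \<in> measurable M (count_space UNIV)"
  shows "(\<lambda>x. h (f x) (g x)) \<in> measurable M (count_space UNIV)"
proof (rule measurable_compose_countable[OF _ f])
  fix i show "(\<lambda>x. h i (g x)) \<in> measurable M (count_space UNIV)"
    by (rule measurable_compose[OF g]) simp
qed

lemma measurable_sum_count_space:
  fixes f :: "nat \<Rightarrow> 'a \<Rightarrow> int"
  assumes "\<And>k. f k \<in> measurable M (count_space UNIV)"
  shows "(\<lambda>x. \<Sum>k<n. f k x) \<in> measurable M (count_space UNIV)"
proof (induction n)
  case (Suc n)
  then show ?case using measurable_binary_count_space[OF Suc assms[of n], of "(+)"] by simp
qed simp

lemma measurable_count_spaceI:
  fixes f :: "'a \<Rightarrow> 'b::countable"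
  assumes "\<And>c. {x \<in> space M. f x = c} \<in> sets M"
  shows "f \<in> measurable M (count_space UNIV)"
proof (subst measurable_count_space_eq_countable)
  show "f \<in> space M \<rightarrow> UNIV \<and> (\<forall>a\<in>UNIV. f -` {a} \<inter> space M \<in> sets M)"
    using assms by (simp add: vimage_def Int_def conj_commute)
qed simp

lemma measure_box_shift:
  assumes I: "finite I" "finite I'" and disj: "I \<inter> (\<lambda>i. i + c) ` I' = {}"
  shows "measure coins {y. (\<forall>i\<in>I. y i \<in> E i) \<and> (\<forall>i\<in>I'. y (i + c) \<in> E' i)} =
    measure coins {y. \<forall>i\<in>I. y i \<in> E i} * measure coins {y. \<forall>i\<in>I'. y i \<in> E' i}"
proof -
  let ?s = "\<lambda>i. i + c :: int"
  define F where "F i = (if i \<in> I then E i else E' (i - c))" for i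
  have F: "F (i + c) = E' i" if "i \<in> I'" for i
    using that disj by (auto simp: F_def)
  have FI: "F i = E i" if "i \<in> I" for i using that by (simp add: F_def)
  have "{y. (\<forall>i\<in>I. y i \<in> E i) \<and> (\<forall>i\<in>I'. y (i + c) \<in> E' i)} = {y. \<forall>i\<in>I \<union> ?s ` I'. y i \<in> F i}"
    by (simp add: ball_Un F FI)
  then have "measure coins {y. (\<forall>i\<in>I. y i \<in> E i) \<and> (\<forall>i\<in>I'. y (i + c) \<in> E' i)} =
      (\<Prod>i\<in>I \<union> ?s ` I'. measure (measure_pmf (pmf_of_set (UNIV :: bool set))) (F i))"
    using I measure_box[of "I \<union> ?s ` I'" "\<lambda>_. pmf_of_set (UNIV :: bool set)" F] by simp
  also have "\<dots> = (\<Prod>i\<in>I. measure (measure_pmf (pmf_of_set (UNIV :: bool set))) (F i)) *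
      (\<Prod>i\<in>?s ` I'. measure (measure_pmf (pmf_of_set (UNIV :: bool set))) (F i))"
    using I disj by (intro prod.union_disjoint) auto
  also have "(\<Prod>i\<in>?s ` I'. measure (measure_pmf (pmf_of_set (UNIV :: bool set))) (F i)) =
      (\<Prod>i\<in>I'. measure (measure_pmf (pmf_of_set (UNIV :: bool set))) (E' i))"
    by (subst prod.reindex) (auto simp: inj_on_def F)
  also have "(\<Prod>i\<in>I. measure (measure_pmf (pmf_of_set (UNIV :: bool set))) (F i)) =
      (\<Prod>i\<in>I. measure (measure_pmf (pmf_of_set (UNIV :: bool set))) (E i))"
    by (simp add: F_def)
  finally show ?thesis using I by (simp add: measure_box)
qed

context tower begin

abbreviation "N \<equiv> base \<Otimes>\<^sub>M coins"

lemma prob_space_N: "prob_space N"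
proof -
  interpret b: prob_space base by (rule prob_space_base)
  interpret c: prob_space coins by (rule prob_space_coins)
  interpret pair_prob_space base coins ..
  show ?thesis by (rule P.prob_space_axioms)
qed

lemma space_N: "space N = UNIV"
  by (simp add: space_pair_measure space_PiP)

lemma full_prob_space_N: "full_prob_space N"
  using prob_space_N space_N by (simp add: full_prob_space_def full_prob_space_axioms_def)

definition rectangles :: "((nat \<Rightarrow> nat) \<times> (int \<Rightarrow> bool)) set set" where
  "rectangles = {A \<times> B |A B. A \<in> boxes \<and> B \<in> boxes}"

lemma rectanglesI: "A \<in> boxes \<Longrightarrow> B \<in> boxes \<Longrightarrow> A \<times> B \<in> rectangles"
  unfolding rectangles_def by blast

lemma rectanglesE:
  assumes "R \<in> rectangles"
  obtains A B where "R = A \<times> B" "A \<in> boxes" "B \<in> boxes"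
  using assms unfolding rectangles_def by blast

lemma rectangles: "Int_stable rectangles" "space N \<in> rectangles" "sets N = sigma_sets (space N) rectangles"
proof -
  show "Int_stable rectangles"
  proof (rule Int_stableI)
    fix A B assume "A \<in> rectangles" "B \<in> rectangles"
    then obtain A1 A2 B1 B2 where *: "A = A1 \<times> A2" "B = B1 \<times> B2" "A1 \<in> boxes" "A2 \<in> boxes" "B1 \<in> boxes" "B2 \<in> boxes"
      by (elim rectanglesE)
    show "A \<inter> B \<in> rectangles"
      unfolding *(1,2) Times_Int_Times
      by (intro rectanglesI Int_stableD[OF Int_stable_boxes] *(3-6))
  qed
  show "space N \<in> rectangles"
    using rectanglesI[OF UNIV_boxes UNIV_boxes] by (simp only: space_N UNIV_Times_UNIV)
  have "sets N = sets (sigma (space base \<times> space coins) {A \<times> B |A B. A \<in> boxes \<and> B \<in> boxes})"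
  proof (rule sets_pair_eq[of _ _ "{UNIV}" _ _ "{UNIV}"])
    show "sets base = sigma_sets (space base) boxes" "sets coins = sigma_sets (space coins) boxes"
      by (simp_all only: space_PiP sets_PiP)
  qed (simp_all add: space_PiP UNIV_boxes)
  then show "sets N = sigma_sets (space N) rectangles"
    unfolding rectangles_def by (simp only: space_PiP space_N Pow_UNIV UNIV_Times_UNIV subset_UNIV)
      (rule sets_measure_of, simp)
qed

lemma odo_measurable: "odo \<in> measurable base base"
  unfolding odo_def[abs_def]
  by (rule measurable_into_PiP, rule measurable_compose[OF measurable_PiP_component]) simp

lemma odo_bij: "bij odo" and inv_odo: "inv odo = (\<lambda>w k. inv (rot (Q k)) (w k))"
proof -
  let ?I = "\<lambda>w k. inv (rot (Q k)) (w k)"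
  have 1: "?I (odo w) = w" "odo (?I w) = w" for w
    by (auto simp: odo_def bij_is_inj[OF bij_rot] surj_f_inv_f[OF bij_is_surj[OF bij_rot]])
  show "bij odo" by (rule o_bij[of ?I]) (use 1 in auto)
  show "inv odo = ?I" by (rule inv_unique_comp) (use 1 in auto)
qed

lemma inv_odo_measurable: "inv odo \<in> measurable base base"
  unfolding inv_odo
  by (rule measurable_into_PiP, rule measurable_compose[OF measurable_PiP_component]) simp

lemma odo_distr: "distr base base odo = base"
proof (rule PiP_measure_preserving[OF odo_measurable])
  fix J :: "nat set" and E :: "nat \<Rightarrow> nat set" assume J: "finite J"
  have "odo -` {x. \<forall>i\<in>J. x i \<in> E i} = {x. \<forall>i\<in>J. x i \<in> rot (Q i) -` E i}"
    by (auto simp: odo_def)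
  then have "measure base (odo -` {x. \<forall>i\<in>J. x i \<in> E i}) =
      (\<Prod>i\<in>J. measure (measure_pmf (pmf_of_set {..<Q i})) (rot (Q i) -` E i))"
    using measure_box[OF J, of "\<lambda>k. pmf_of_set {..<Q k}" "\<lambda>i. rot (Q i) -` E i"] by simp
  also have "\<dots> = (\<Prod>i\<in>J. measure (measure_pmf (pmf_of_set {..<Q i})) (E i))"
  proof (rule prod.cong[OF refl])
    fix i
    show "measure (measure_pmf (pmf_of_set {..<Q i})) (rot (Q i) -` E i) = measure (measure_pmf (pmf_of_set {..<Q i})) (E i)"
      using measure_map_pmf[of "rot (Q i)" "pmf_of_set {..<Q i}" "E i"] by (simp add: map_pmf_rot Q_pos)
  qed
  finally show "measure base (odo -` {x. \<forall>i\<in>J. x i \<in> E i}) =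
      (\<Prod>i\<in>J. measure (measure_pmf (pmf_of_set {..<Q i})) (E i))" .
qed

text \<open>The points with finitely many nonzero jumps form the countable union of the sets \<open>Z K\<close>, on which \<open>phi\<close>
  is the sum of the first \<open>K\<close> jumps.\<close>

lemma phi_measurable: "phi \<in> measurable base (count_space UNIV)"
proof (rule measurable_count_spaceI)
  fix c
  have j: "(\<lambda>w. jump k (w k)) \<in> measurable base (count_space UNIV)" for k
    by (rule measurable_compose[OF measurable_PiP_component]) simp
  have s: "(\<lambda>w. \<Sum>k<K. jump k (w k)) \<in> measurable base (count_space UNIV)" for K
    by (rule measurable_sum_count_space[OF j])
  have J: "{w. jump k (w k) = 0} \<in> sets base" for k
    using measurable_sets[OF j[of k], of "{0}"] by (simp add: space_base vimage_def)
  have S: "{w. (\<Sum>k<K. jump k (w k)) = c} \<in> sets base" for K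
    using measurable_sets[OF s[of K], of "{c}"] by (simp add: space_base vimage_def)
  define Z where "Z K = (\<Inter>k\<in>{K..}. {w. jump k (w k) = 0})" for K
  have Z: "Z K \<in> sets base" for K
    unfolding Z_def using J by (intro sets.countable_INT') auto
  have fin: "finite {k. jump k (w k) \<noteq> 0} \<longleftrightarrow> (\<exists>K. w \<in> Z K)" for w
  proof
    assume "finite {k. jump k (w k) \<noteq> 0}"
    then obtain K where "\<forall>k\<in>{k. jump k (w k) \<noteq> 0}. k < K"
      using finite_nat_set_iff_bounded by auto
    then have "w \<in> Z K" unfolding Z_def by (auto simp: not_less[symmetric])
    then show "\<exists>K. w \<in> Z K" ..
  next
    assume "\<exists>K. w \<in> Z K"
    then obtain K where "w \<in> Z K" ..
    then have "{k. jump k (w k) \<noteq> 0} \<subseteq> {..<K}" unfolding Z_def by (auto simp: not_less[symmetric])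
    then show "finite {k. jump k (w k) \<noteq> 0}" by (rule finite_subset) simp
  qed
  have phi: "phi w = (\<Sum>k<K. jump k (w k))" if "w \<in> Z K" for w K
  proof -
    have "{k. jump k (w k) \<noteq> 0} \<subseteq> {..<K}" using that unfolding Z_def by (auto simp: not_less[symmetric])
    then show ?thesis unfolding phi_def by (intro sum.mono_neutral_left) auto
  qed
  have phi0: "phi w = 0" if "\<forall>K. w \<notin> Z K" for w
    using that fin[of w] unfolding phi_def by (intro sum.infinite) auto
  have "{w \<in> space base. phi w = c} = (\<Union>K. Z K \<inter> {w. (\<Sum>k<K. jump k (w k)) = c}) \<union> (if c = 0 then - (\<Union>K. Z K) else {})"
    (is "?L = ?R")
  proof (rule set_eqI)
    fix w show "w \<in> ?L \<longleftrightarrow> w \<in> ?R"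
    proof (cases "\<exists>K. w \<in> Z K")
      case True
      then have "phi w = c \<longleftrightarrow> (\<exists>K. w \<in> Z K \<and> (\<Sum>k<K. jump k (w k)) = c)" using phi by metis
      moreover have "w \<in> ?R \<longleftrightarrow> (\<exists>K. w \<in> Z K \<and> (\<Sum>k<K. jump k (w k)) = c)" using True by auto
      ultimately show ?thesis by (simp add: space_base)
    next
      case False
      then show ?thesis using phi0[of w] by (auto simp: space_base)
    qed
  qed
  moreover have "- (\<Union>K. Z K) \<in> sets base"
    using sets.compl_sets[of "\<Union>K. Z K" base] Z by (simp add: space_base Compl_eq_Diff_UNIV)
  ultimately show "{w \<in> space base. phi w = c} \<in> sets base" using Z S by auto
qed

lemma cocycle_measurable: "cocycle t \<in> measurable base (count_space UNIV)"
  unfolding cocycle_def[abs_def]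
  by (rule measurable_sum_count_space, rule measurable_compose[OF funpow_measurable[OF odo_measurable] phi_measurable])

lemma translate_measurable: "(\<lambda>w. i + phi w) \<in> measurable base (count_space UNIV)"
  by (rule measurable_compose[OF phi_measurable]) simp

lemma T_invertible: "bij T" "T \<in> measurable N N" "inv T \<in> measurable N N" "distr N N T = N"
proof -
  let ?tau = "\<lambda>w i. i + phi w"
  have bij: "bij (?tau w)" for w by (rule bij_int_translation)
  have inj: "inj (?tau w)" for w using bij by (rule bij_is_inj)
  show "bij T" unfolding T_def by (rule skew_bij(1)[where \<tau>="?tau", OF odo_bij bij])
  show "T \<in> measurable N N" unfolding T_def
    by (rule skew_measurable[where \<tau>="?tau", OF odo_measurable translate_measurable])
  show "inv T \<in> measurable N N" unfolding T_def
    by (rule skew_inv_measurable[where \<tau>="?tau", OF odo_bij inv_odo_measurable bij translate_measurable])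
  show "distr N N T = N" unfolding T_def
    by (rule skew_measure_preserving[where \<tau>="?tau", OF prob_space_base odo_measurable odo_distr translate_measurable inj])
qed

lemma T_vimage_fibre:
  "Pair w -` ((A \<times> B) \<inter> (T ^^ t) -` (A' \<times> B')) =
    {y. w \<in> A \<and> (odo ^^ t) w \<in> A' \<and> y \<in> B \<and> (\<lambda>i. y (i + cocycle t w)) \<in> B'}"
proof (rule set_eqI)
  fix y
  have "(T ^^ t) (w, y) = ((odo ^^ t) w, \<lambda>i. y (i + cocycle t w))"
    unfolding T_funpow by (simp add: skew_def)
  then show "y \<in> Pair w -` ((A \<times> B) \<inter> (T ^^ t) -` (A' \<times> B')) \<longleftrightarrow>
      y \<in> {y. w \<in> A \<and> (odo ^^ t) w \<in> A' \<and> y \<in> B \<and> (\<lambda>i. y (i + cocycle t w)) \<in> B'}"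
    by (simp only: vimage_eq Int_iff mem_Sigma_iff mem_Collect_eq) blast
qed

lemma odo_funpow_box:
  assumes "\<And>j. w j < Q j"
  shows "(odo ^^ t) w \<in> {x. \<forall>j\<in>J. x j \<in> E j} \<longleftrightarrow> (\<forall>j\<in>J. (w j + t) mod Q j \<in> E j)"
  using assms by (simp add: odo_funpow rot_funpow)

lemma T_vimage_sets:
  assumes "A \<in> sets N" "B \<in> sets N" shows "A \<inter> (T ^^ t) -` B \<in> sets N"
proof -
  have "(T ^^ t) -` B \<in> sets N"
    using measurable_sets[OF funpow_measurable[OF T_invertible(2)] assms(2), of t]
    by (simp only: space_N Int_UNIV_right)
  with assms(1) show ?thesis by (rule sets.Int)
qed

lemma rectangle_sets: "A \<in> boxes \<Longrightarrow> B \<in> boxes \<Longrightarrow> A \<times> B \<in> sets N"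
  unfolding rectangles(3) by (intro sigma_sets.Basic rectanglesI)

text \<open>The rigidity times are \<open>W k\<close>. All \<open>Q j\<close> with \<open>j < k\<close> divide \<open>W k\<close>, so these coordinates return; on
  \<open>quiet k (W k)\<close> only they contribute to the cocycle, which therefore vanishes.\<close>

lemma T_rigid: "rigid N T"
proof -
  interpret prob_space N by (rule prob_space_N)
  show ?thesis
  proof (rule rigid_from_generator[OF T_invertible(2,4) rectangles])
    show "0 < W k" for k by (rule W_pos)
    fix R R' assume "R \<in> rectangles" "R' \<in> rectangles"
    then obtain A B A' B' where R: "R = A \<times> B" "R' = A' \<times> B'"
      and box: "A \<in> boxes" "B \<in> boxes" "A' \<in> boxes" "B' \<in> boxes"
      by (elim rectanglesE)
    obtain J E where J: "finite J" "A' = {x. \<forall>j\<in>J. x j \<in> E j}" using box(3) unfolding boxes_def by auto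
    define K where "K = Suc (Max (insert 0 J))"
    have K: "j < K" if "j \<in> J" for j using that J(1) by (simp add: K_def less_Suc_eq_le)
    have RR: "R \<in> sets N" "R' \<in> sets N" unfolding R using box rectangle_sets by auto
    have ev: "\<bar>measure N (R \<inter> (T ^^ W k) -` R') - measure N (R \<inter> R')\<bar> \<le> 12 * (1/2) ^ k" if k: "K \<le> k" for k
    proof -
      interpret c: prob_space coins by (rule prob_space_coins)
      let ?h = "\<lambda>w. measure coins (Pair w -` (R \<inter> R'))"
      note G = quiet_prob[OF order_refl, of k]
      have h: "?h \<in> borel_measurable base"
        unfolding measure_def using RR by (intro borel_measurable_enn2real c.measurable_emeasure_Pair) auto
      have eq: "measure coins (Pair w -` (R \<inter> (T ^^ W k) -` R')) = ?h w" if w: "w \<in> quiet k (W k)" for w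
      proof -
        have lt: "w j < Q j" for j using w by (simp add: quiet_def)
        have per: "(w j + W k) mod Q j = w j" if jk: "j < k" for j
        proof -
          obtain c where "W k = Q j * c" using W_dvd[OF jk] by (rule dvdE)
          then show ?thesis using lt[of j] by simp
        qed
        have co: "cocycle (W k) w = 0"
          unfolding cocycle_quiet[OF w order_refl] by (rule sum.neutral) (simp add: per)
        have "(w j + W k) mod Q j = w j" if "j \<in> J" for j
          using K[OF that] k by (intro per) simp
        then have "(odo ^^ W k) w \<in> A' \<longleftrightarrow> w \<in> A'"
          unfolding J odo_funpow_box[OF lt] by simp
        then have "Pair w -` (R \<inter> (T ^^ W k) -` R') = Pair w -` (R \<inter> R')"
          unfolding R T_vimage_fibre co by auto
        then show ?thesis by simp
      qed
      have "\<bar>measure N (R \<inter> (T ^^ W k) -` R') - (\<integral>w. ?h w \<partial>base)\<bar> \<le> 1 - measure base (quiet k (W k))"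
        by (rule measure_close_by_fibres[OF prob_space_base T_vimage_sets[OF RR] G(1) h _ _ eq]) auto
      moreover have "\<bar>measure N (R \<inter> R') - (\<integral>w. ?h w \<partial>base)\<bar> \<le> 1 - measure base (quiet k (W k))"
        using RR by (intro measure_close_by_fibres[OF prob_space_base _ G(1) h]) auto
      ultimately show ?thesis using G(2) by linarith
    qed
    show "(\<lambda>k. measure N (R \<inter> (T ^^ W k) -` R') - measure N (R \<inter> R')) \<longlonglongrightarrow> 0"
      using ev by (rule tendsto_0_if_geometric_bound)
  qed
qed

lemma prod_Q: "(\<Prod>j<k. Q j) = W k"
  by (induction k) (simp_all add: W_0 W_Suc mult.commute)

lemma W_dvd_all:
  assumes "\<And>j. j < k \<Longrightarrow> Q j dvd d" shows "W k dvd d"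
  using assms
proof (induction k)
  case (Suc k)
  have "coprime (W k) (Q k)" by (rule coprime_commute[THEN iffD1, OF coprime_Q_W])
  moreover have "W k dvd d" using Suc by simp
  moreover have "Q k dvd d" using Suc.prems[of k] by simp
  ultimately show ?case unfolding W_Suc by (intro divides_mult)
qed (simp add: W_0)

text \<open>Chinese remainder theorem: as \<open>t\<close> runs through \<open>W k\<close> consecutive integers, the first \<open>k\<close>
  coordinates of the orbit run through all tuples of residues exactly once.\<close>

lemma odo_equidistributed:
  assumes w: "\<And>j. w j < Q j" and J: "J \<subseteq> {..<k}"
  shows "real (card {t\<in>{n..<n + W k}. (odo ^^ t) w \<in> {x. \<forall>j\<in>J. x j \<in> E j}}) =
    real (W k) * measure base {x. \<forall>j\<in>J. x j \<in> E j}"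
proof -
  define r where "r t = (\<lambda>j\<in>{..<k}. (w j + t) mod Q j)" for t
  have finJ: "finite J" using J finite_subset by blast
  have inj: "inj_on r {n..<n + W k}"
  proof -
    have *: "s = t" if st: "s \<in> {n..<n + W k}" "t \<in> {n..<n + W k}" "r s = r t" "s \<le> t" for s t
    proof -
      have "Q j dvd t - s" if "j < k" for j
      proof -
        have "(w j + s) mod Q j = (w j + t) mod Q j"
          using fun_cong[OF st(3), of j] that by (simp add: r_def)
        then have "Q j dvd (w j + t) - (w j + s)"
          using mod_eq_dvd_iff_nat[of "w j + s" "w j + t" "Q j"] st(4) by (metis add_le_cancel_left)
        then show ?thesis by simp
      qed
      then have "W k dvd t - s" by (rule W_dvd_all)
      moreover have "t - s < W k" using st by auto
      ultimately show ?thesis using st(4) dvd_imp_le by fastforce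
    qed
    show ?thesis
    proof (rule inj_onI)
      fix s t assume "s \<in> {n..<n + W k}" "t \<in> {n..<n + W k}" "r s = r t"
      then show "s = t" using *[of s t] *[of t s] by (cases "s \<le> t") auto
    qed
  qed
  have into: "r ` {n..<n + W k} \<subseteq> (\<Pi>\<^sub>E j\<in>{..<k}. {..<Q j})"
    using Q_pos by (intro image_subsetI) (simp add: r_def restrict_PiE_iff)
  have "card (r ` {n..<n + W k}) = card (\<Pi>\<^sub>E j\<in>{..<k}. {..<Q j})"
    using card_image[OF inj] by (simp add: card_PiE prod_Q)
  then have onto: "r ` {n..<n + W k} = (\<Pi>\<^sub>E j\<in>{..<k}. {..<Q j})"
    by (intro card_subset_eq into finite_PiE) auto
  define c where "c j = {v. v < Q j \<and> v \<in> E j}" for j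
  define F where "F j = (if j \<in> J then c j else {..<Q j})" for j
  let ?S = "{t\<in>{n..<n + W k}. (odo ^^ t) w \<in> {x. \<forall>j\<in>J. x j \<in> E j}}"
  have "r ` ?S = (\<Pi>\<^sub>E j\<in>{..<k}. F j)"
  proof (intro equalityI subsetI)
    fix f assume "f \<in> r ` ?S"
    then obtain t where t: "t \<in> ?S" "f = r t" by auto
    then have "\<forall>j\<in>J. (w j + t) mod Q j \<in> E j" using odo_funpow_box[OF w] by blast
    then show "f \<in> (\<Pi>\<^sub>E j\<in>{..<k}. F j)" using Q_pos by (simp add: t(2) r_def restrict_PiE_iff F_def c_def)
  next
    fix f assume f: "f \<in> (\<Pi>\<^sub>E j\<in>{..<k}. F j)"
    then have "f \<in> (\<Pi>\<^sub>E j\<in>{..<k}. {..<Q j})" by (auto simp: F_def c_def PiE_iff split: if_splits)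
    then obtain t where t: "t \<in> {n..<n + W k}" "f = r t" using onto by blast
    have "(w j + t) mod Q j \<in> E j" if "j \<in> J" for j
    proof -
      have "j < k" using that J by auto
      then have "f j \<in> F j" "f j = (w j + t) mod Q j" using f t by (auto simp: r_def)
      then show ?thesis using that by (simp add: F_def c_def)
    qed
    then have "t \<in> ?S" using t odo_funpow_box[OF w, of t J E] by simp
    then show "f \<in> r ` ?S" using t by blast
  qed
  then have "card ?S = card (\<Pi>\<^sub>E j\<in>{..<k}. F j)"
    using card_image[OF inj_on_subset[OF inj, of ?S]] Collect_restrict by metis
  then have "real (card ?S) = (\<Prod>j<k. real (card (F j)))" by (simp add: card_PiE)
  also have "\<dots> = (\<Prod>j<k. real (Q j) * (if j \<in> J then real (card (c j)) / real (Q j) else 1))"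
    using Q_pos by (intro prod.cong) (auto simp: F_def)
  also have "\<dots> = real (W k) * (\<Prod>j<k. if j \<in> J then real (card (c j)) / real (Q j) else 1)"
    by (simp add: prod.distrib flip: prod_Q)
  also have "(\<Prod>j<k. if j \<in> J then real (card (c j)) / real (Q j) else 1) = (\<Prod>j\<in>J. real (card (c j)) / real (Q j))"
    using J by (simp add: prod.If_cases Int_absorb1 flip: prod.inter_restrict)
  also have "\<dots> = measure base {x. \<forall>j\<in>J. x j \<in> E j}"
  proof -
    have "real (card (c j)) / real (Q j) = measure (measure_pmf (pmf_of_set {..<Q j})) (E j)" for j
    proof -
      have "c j = {..<Q j} \<inter> E j" by (auto simp: c_def)
      then show ?thesis using Q_pos[of j] by (simp add: measure_pmf_of_set lessThan_empty_iff)
    qed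
    then show ?thesis by (simp add: measure_box[OF finJ])
  qed
  finally show ?thesis .
qed

lemma AE_in_range: "AE w in base. \<forall>j. w j < Q j"
proof -
  interpret prob_space base by (rule prob_space_base)
  have "AE w in base. w j < Q j" for j
  proof (rule AE_I')
    have "card {v. v < Q j \<and> v \<in> {Q j..}} = 0" by auto
    then have "measure base {w. w j \<in> {Q j..}} = 0" unfolding measure_coord by simp
    then show "{w. w j \<in> {Q j..}} \<in> null_sets base"
      using coord_sets[of j "{Q j..}"] by (intro null_setsI) (simp_all add: emeasure_eq_measure)
  qed auto
  then show ?thesis by (simp add: AE_all_countable)
qed

lemma odo_vimage_sets:
  assumes "A \<in> sets base" "B \<in> sets base" shows "A \<inter> (odo ^^ t) -` B \<in> sets base"
proof -
  have "(odo ^^ t) -` B \<in> sets base"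
    using measurable_sets[OF funpow_measurable[OF odo_measurable] assms(2), of t]
    by (simp only: space_base Int_UNIV_right)
  with assms(1) show ?thesis by (rule sets.Int)
qed

lemma odo_average:
  assumes A: "A \<in> sets base" and J: "J \<subseteq> {..<k}"
  shows "(\<Sum>t\<in>{n..<n + W k}. measure base (A \<inter> (odo ^^ t) -` {x. \<forall>j\<in>J. x j \<in> E j})) =
    real (W k) * (measure base A * measure base {x. \<forall>j\<in>J. x j \<in> E j})"
proof -
  interpret prob_space base by (rule prob_space_base)
  let ?B = "{x. \<forall>j\<in>J. x j \<in> E j}" and ?F = "{n..<n + W k}"
  have "finite J" using J finite_subset by blast
  then have B: "?B \<in> sets base" by (rule box_sets)
  note S = odo_vimage_sets[OF A B]
  have "(\<Sum>t\<in>?F. measure base (A \<inter> (odo ^^ t) -` ?B)) = (\<Sum>t\<in>?F. \<integral>w. indicator (A \<inter> (odo ^^ t) -` ?B) w \<partial>base)"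
    using S by simp
  also have "\<dots> = (\<integral>w. (\<Sum>t\<in>?F. indicator (A \<inter> (odo ^^ t) -` ?B) w) \<partial>base)"
    using S by (intro Bochner_Integration.integral_sum[symmetric] integrable_real_indicator) (simp_all add: emeasure_eq_measure)
  also have "\<dots> = (\<integral>w. real (W k) * measure base ?B * indicator A w \<partial>base)"
  proof (rule integral_cong_AE)
    show "(\<lambda>w. \<Sum>t\<in>?F. indicator (A \<inter> (odo ^^ t) -` ?B) w :: real) \<in> borel_measurable base"
      using S by (intro borel_measurable_sum borel_measurable_indicator)
    show "(\<lambda>w. real (W k) * measure base ?B * indicator A w) \<in> borel_measurable base"
      using A by simp
    show "AE w in base. (\<Sum>t\<in>?F. indicator (A \<inter> (odo ^^ t) -` ?B) w) = real (W k) * measure base ?B * indicator A w"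
      using AE_in_range
    proof eventually_elim
      case (elim w)
      have "(\<Sum>t\<in>?F. indicator (A \<inter> (odo ^^ t) -` ?B) w :: real) = (\<Sum>t\<in>?F. if (odo ^^ t) w \<in> ?B then indicator A w else 0)"
        by (intro sum.cong refl) (simp add: indicator_def)
      also have "\<dots> = (\<Sum>t\<in>{t\<in>?F. (odo ^^ t) w \<in> ?B}. indicator A w)"
        by (rule sum.inter_filter[symmetric]) simp
      also have "\<dots> = real (card {t\<in>?F. (odo ^^ t) w \<in> ?B}) * indicator A w"
        by (rule sum_constant)
      also have "\<dots> = real (W k) * measure base ?B * indicator A w"
        using odo_equidistributed[of w J k n E] elim J by simp
      finally show ?case .
    qed
  qed
  also have "\<dots> = real (W k) * (measure base A * measure base ?B)"
    using A by simp
  finally show ?thesis .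
qed

text \<open>Correlations of rectangles are averaged over the \<open>W k\<close> times starting at \<open>D k * (W k + k)\<close>. On good
  points the cocycle is then at least \<open>k\<close>, so that two given finite sets of coins no longer interact,
  and the average over the base is exact.\<close>

lemma T_ergodic: "ergodic N T"
proof -
  interpret prob_space N by (rule prob_space_N)
  interpret b: prob_space base by (rule prob_space_base)
  interpret c: prob_space coins by (rule prob_space_coins)
  define n where "n k = D k * (W k + k)" for k
  show ?thesis
  proof (rule ergodic_from_generator[OF T_invertible(2,4) rectangles])
    show "finite {n k..<n k + W k}" "{n k..<n k + W k} \<noteq> {}" for k using W_pos[of k] by auto
    fix R R' assume RR: "R \<in> rectangles" "R' \<in> rectangles"
    obtain A B where R: "R = A \<times> B" and AB: "A \<in> boxes" "B \<in> boxes" using RR(1) by (rule rectanglesE)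
    obtain A' B' where R': "R' = A' \<times> B'" and AB': "A' \<in> boxes" "B' \<in> boxes" using RR(2) by (rule rectanglesE)
    obtain J E where J: "finite J" "A' = {x. \<forall>j\<in>J. x j \<in> E j}" using AB' unfolding boxes_def by auto
    obtain I F where I: "finite I" "B = {x. \<forall>i\<in>I. x i \<in> F i}" using AB unfolding boxes_def by auto
    obtain I' F' where I': "finite I'" "B' = {x. \<forall>i\<in>I'. x i \<in> F' i}" using AB' unfolding boxes_def by auto
    have As: "A \<in> sets base" "A' \<in> sets base" and Bs: "B \<in> sets coins" "B' \<in> sets coins"
      using AB AB' unfolding boxes_def by (auto intro: box_sets)
    have Rs: "R \<in> sets N" "R' \<in> sets N" unfolding R R' using AB AB' by (auto intro: rectangle_sets)
    have mR: "measure N R = measure base A * measure coins B" "measure N R' = measure base A' * measure coins B'"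
      unfolding R R' using As Bs by (simp_all add: measure_def c.emeasure_pair_measure_Times enn2real_mult)
    define a where "a = Max (abs ` (insert 0 (I \<union> I')))"
    have a: "\<bar>i\<bar> \<le> a" if "i \<in> I \<union> I'" for i
      unfolding a_def using that I I' by (intro Max_ge) auto
    define K where "K = Suc (Max (insert 0 J) + nat (2 * a))"
    have KJ: "j < K" if "j \<in> J" for j
    proof -
      have "j \<le> Max (insert 0 J)" using that J(1) by simp
      then show ?thesis by (simp add: K_def)
    qed
    define c where "c = measure coins B * measure coins B'"
    have c01: "0 \<le> c" "c \<le> 1" unfolding c_def by (auto intro: mult_le_one)
    have close: "\<bar>measure N (R \<inter> (T ^^ t) -` R') - c * measure base (A \<inter> (odo ^^ t) -` A')\<bar> \<le> 4 * (1/2) ^ k"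
      if k: "K \<le> k" and t: "t \<in> {n k..<n k + W k}" for k t
    proof -
      have S: "A \<inter> (odo ^^ t) -` A' \<in> sets base" using As by (rule odo_vimage_sets)
      let ?h = "\<lambda>w. c * indicator (A \<inter> (odo ^^ t) -` A') w"
      have eq: "measure coins (Pair w -` (R \<inter> (T ^^ t) -` R')) = ?h w" if w: "w \<in> good k" for w
      proof -
        have "t \<le> H k" using t le_H[of k] by (simp add: n_def)
        then have "int (t div D k) - int (W k) \<le> cocycle t w" by (rule cocycle_good(1)[OF w])
        moreover have "W k + k \<le> t div D k"
        proof -
          have "(W k + k) * D k div D k \<le> t div D k" using t by (intro div_le_mono) (simp add: n_def mult.commute)
          then show ?thesis using D_pos[of k] by simp
        qed
        moreover have "2 * a < int k" using k unfolding K_def by linarith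
        ultimately have big: "2 * a < cocycle t w" by linarith
        have "i \<noteq> i' + cocycle t w" if "i \<in> I" "i' \<in> I'" for i i'
          using a[of i] a[of i'] that big by auto
        then have "I \<inter> (\<lambda>i. i + cocycle t w) ` I' = {}" by blast
        note shift = measure_box_shift[OF I(1) I'(1) this, of F F']
        show ?thesis
        proof (cases "w \<in> A \<and> (odo ^^ t) w \<in> A'")
          case True
          then have "Pair w -` (R \<inter> (T ^^ t) -` R') = {y. (\<forall>i\<in>I. y i \<in> F i) \<and> (\<forall>i\<in>I'. y (i + cocycle t w) \<in> F' i)}"
            unfolding R R' T_vimage_fibre by (simp add: I I')
          then show ?thesis using shift True by (simp add: c_def I I')
        next
          case False
          then have "Pair w -` (R \<inter> (T ^^ t) -` R') = {}"
            unfolding R R' T_vimage_fibre by auto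
          then show ?thesis using False by auto
        qed
      qed
      have h: "?h \<in> borel_measurable base" using S by simp
      have h01: "0 \<le> ?h w" "?h w \<le> 1" for w using c01 by (auto simp: indicator_def)
      have "\<bar>measure N (R \<inter> (T ^^ t) -` R') - (\<integral>w. ?h w \<partial>base)\<bar> \<le> 1 - measure base (good k)"
        by (rule measure_close_by_fibres[OF prob_space_base T_vimage_sets[OF Rs] good_prob(1) h h01 eq])
      moreover have "(\<integral>w. ?h w \<partial>base) = c * measure base (A \<inter> (odo ^^ t) -` A')" using S by simp
      ultimately show ?thesis using good_prob(2)[of k] by linarith
    qed
    have "\<bar>(\<Sum>t\<in>{n k..<n k + W k}. measure N (R \<inter> (T ^^ t) -` R')) / real (card {n k..<n k + W k}) - measure N R * measure N R'\<bar>
        \<le> 4 * (1/2) ^ k" if k: "K \<le> k" for k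
    proof -
      let ?F = "{n k..<n k + W k}"
      have "J \<subseteq> {..<k}" using KJ k by force
      then have avg: "(\<Sum>t\<in>?F. measure base (A \<inter> (odo ^^ t) -` A')) = real (W k) * (measure base A * measure base A')"
        unfolding J(2) by (rule odo_average[OF As(1)])
      have "(\<Sum>t\<in>?F. c * measure base (A \<inter> (odo ^^ t) -` A')) = real (W k) * (measure N R * measure N R')"
        unfolding sum_distrib_left[symmetric] avg mR c_def by simp
      then have "\<bar>(\<Sum>t\<in>?F. measure N (R \<inter> (T ^^ t) -` R')) - real (W k) * (measure N R * measure N R')\<bar> =
          \<bar>\<Sum>t\<in>?F. measure N (R \<inter> (T ^^ t) -` R') - c * measure base (A \<inter> (odo ^^ t) -` A')\<bar>"
        by (simp add: sum_subtractf)
      also have "\<dots> \<le> (\<Sum>t\<in>?F. 4 * (1/2) ^ k)"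
        by (rule order_trans[OF sum_abs sum_mono]) (rule close[OF k])
      finally have "\<bar>(\<Sum>t\<in>?F. measure N (R \<inter> (T ^^ t) -` R')) - real (W k) * (measure N R * measure N R')\<bar>
          \<le> real (W k) * (4 * (1/2) ^ k)" by simp
      then have "\<bar>(\<Sum>t\<in>?F. measure N (R \<inter> (T ^^ t) -` R')) - real (W k) * (measure N R * measure N R')\<bar> / real (W k)
          \<le> 4 * (1/2) ^ k" using W_pos[of k] by (simp add: field_simps)
      moreover have "(\<Sum>t\<in>?F. measure N (R \<inter> (T ^^ t) -` R')) / real (card ?F) - measure N R * measure N R' =
          ((\<Sum>t\<in>?F. measure N (R \<inter> (T ^^ t) -` R')) - real (W k) * (measure N R * measure N R')) / real (W k)"
        using W_pos[of k] by (simp add: diff_divide_distrib)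
      ultimately show ?thesis by (simp add: abs_divide)
    qed
    then show "(\<lambda>k. (\<Sum>t\<in>{n k..<n k + W k}. measure N (R \<inter> (T ^^ t) -` R')) / real (card {n k..<n k + W k})
        - measure N R * measure N R') \<longlonglongrightarrow> 0"
      by (rule tendsto_0_if_geometric_bound)
  qed
qed

theorem T_rigid_ergodic: "rigid_ergodic_mpt N T"
  unfolding rigid_ergodic_mpt_def using T_invertible T_ergodic T_rigid by simp

end

section \<open>A conjugate with prescribed correlations\<close>

text \<open>Under the assumptions of the locale below, the involution that exchanges \<open>- a n\<close> and \<open>b n\<close> for
  all \<open>n\<close> in \<open>U\<close> and fixes everything else.\<close>

definition swap :: "nat set \<Rightarrow> (nat \<Rightarrow> int) \<Rightarrow> (nat \<Rightarrow> int) \<Rightarrow> int \<Rightarrow> int" where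
  "swap U a b i =
    (if \<exists>n\<in>U. i = - a n then b (THE n. n \<in> U \<and> i = - a n)
     else if \<exists>n\<in>U. i = b n then - a (THE n. n \<in> U \<and> i = b n) else i)"

locale swap_times =
  fixes U :: "nat set" and a b :: "nat \<Rightarrow> int"
  assumes pos: "\<And>n. n \<in> U \<Longrightarrow> 0 < a n" "\<And>n. n \<in> U \<Longrightarrow> 0 < b n"
    and inj: "inj_on a U" "inj_on b U"
begin

lemma swap_minus_a: assumes "n \<in> U" shows "swap U a b (- a n) = b n"
proof -
  have "(THE m. m \<in> U \<and> - a n = - a m) = n"
    using assms inj(1) by (intro the_equality) (auto dest: inj_onD)
  then show ?thesis using assms unfolding swap_def by auto
qed

lemma swap_b: assumes "n \<in> U" shows "swap U a b (b n) = - a n"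
proof -
  have "(THE m. m \<in> U \<and> b n = b m) = n"
    using assms inj(2) by (intro the_equality) (auto dest: inj_onD)
  moreover have "b n \<noteq> - a m" if "m \<in> U" for m using pos(1)[OF that] pos(2)[OF assms] by linarith
  ultimately show ?thesis using assms unfolding swap_def by auto
qed

lemma swap_other: "(\<And>n. n \<in> U \<Longrightarrow> i \<noteq> - a n \<and> i \<noteq> b n) \<Longrightarrow> swap U a b i = i"
  unfolding swap_def by auto

lemma swap_cases:
  obtains n where "n \<in> U" "i = - a n" | n where "n \<in> U" "i = b n" | "\<And>n. n \<in> U \<Longrightarrow> i \<noteq> - a n \<and> i \<noteq> b n"
  by blast

lemma swap_swap: "swap U a b (swap U a b i) = i"
  by (cases rule: swap_cases[of i]) (auto simp: swap_minus_a swap_b swap_other)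

lemma swap_0: "swap U a b 0 = 0"
  by (rule swap_other) (use pos in force)

text \<open>A form without choice operators, from which measurability can be read off.\<close>

lemma swap_eq_iff: "swap U a b i = j \<longleftrightarrow>
  (\<exists>n. n \<in> U \<and> i = - a n \<and> j = b n) \<or> (\<exists>n. n \<in> U \<and> i = b n \<and> j = - a n) \<or>
  (\<forall>n. n \<in> U \<longrightarrow> i \<noteq> - a n \<and> i \<noteq> b n) \<and> j = i"
proof -
  have disj: "- a n \<noteq> b m" if "n \<in> U" "m \<in> U" for n m
    using pos(1)[OF that(1)] pos(2)[OF that(2)] by linarith
  show ?thesis
  proof (cases rule: swap_cases[of i])
    case (1 n)
    then show ?thesis using disj inj(1) by (auto simp: swap_minus_a dest: inj_onD)
  next
    case (2 n)
    then have "i \<noteq> - a m" if "m \<in> U" for m using disj[OF that, of n] by simp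
    then show ?thesis using 2 inj(2) by (auto simp: swap_b dest: inj_onD)
  next
    case 3
    then show ?thesis by (auto simp: swap_other)
  qed
qed

lemma bij_swap_uminus: "bij (\<lambda>i. swap U a b (- i))"
proof (rule o_bij)
  show "(\<lambda>i. - swap U a b i) \<circ> (\<lambda>i. swap U a b (- i)) = id" by (auto simp: swap_swap)
  show "(\<lambda>i. swap U a b (- i)) \<circ> (\<lambda>i. - swap U a b i) = id" by (auto simp: swap_swap)
qed

end

text \<open>Block \<open>k\<close> ends at \<open>(k + 1) * s k\<close>, hence it fills all but the fraction \<open>1 / (k + 1)\<close> of the times up to
  its end, and the averages up to there are close to \<open>1/2\<close> or \<open>1/4\<close> according to the parity of \<open>k\<close>.\<close>

lemma block_average_not_convergent:
  fixes u :: "nat \<Rightarrow> real" and s :: "nat \<Rightarrow> nat"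
  assumes u: "\<And>n. 0 \<le> u n" "\<And>n. u n \<le> 1" and s: "\<And>k. 0 < s k"
    and block: "\<And>k n. s k \<le> n \<Longrightarrow> n < (k + 1) * s k \<Longrightarrow> \<bar>u n - (if odd k then 1/2 else 1/4)\<bar> \<le> 4 * (1/2) ^ k"
  shows "\<not> convergent (\<lambda>L. (1 / real L) * (\<Sum>n<L. u n))"
proof
  assume "convergent (\<lambda>L. (1 / real L) * (\<Sum>n<L. u n))"
  then obtain l where l: "(\<lambda>L. (1 / real L) * (\<Sum>n<L. u n)) \<longlonglongrightarrow> l" by (auto simp: convergent_def)
  define L where "L k = (k + 1) * s k" for k
  define c where "c k = (if odd k then 1/2 else 1/4 :: real)" for k :: nat
  have Lk: "k + 1 \<le> L k" for k unfolding L_def using mult_le_mono2[of 1 "s k" "k + 1"] s[of k] by simp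
  have "k \<le> L k" for k using Lk[of k] by simp
  then have "filterlim L at_top sequentially"
    by (intro filterlim_at_top_mono[OF filterlim_ident] always_eventually) simp
  then have lim: "(\<lambda>k. (1 / real (L k)) * (\<Sum>n<L k. u n)) \<longlonglongrightarrow> l" by (rule filterlim_compose[OF l])
  have close: "\<bar>(1 / real (L k)) * (\<Sum>n<L k. u n) - c k\<bar> \<le> 1 / real (k + 1) + 4 * (1/2) ^ k" for k
  proof -
    have c01: "0 \<le> c k" "c k \<le> 1" by (auto simp: c_def)
    have L0: "0 < real (L k)" using Lk[of k] by simp
    have sL: "s k \<le> L k" by (simp add: L_def)
    have split: "{..<L k} = {..<s k} \<union> {s k..<L k}" using sL by auto
    have "(\<Sum>n<L k. \<bar>u n - c k\<bar>) = (\<Sum>n<s k. \<bar>u n - c k\<bar>) + (\<Sum>n\<in>{s k..<L k}. \<bar>u n - c k\<bar>)"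
      unfolding split by (rule sum.union_disjoint) auto
    also have "(\<Sum>n<s k. \<bar>u n - c k\<bar>) \<le> (\<Sum>n<s k. 1)"
    proof (rule sum_mono)
      fix n show "\<bar>u n - c k\<bar> \<le> 1" using u[of n] c01 by linarith
    qed
    also have "(\<Sum>n\<in>{s k..<L k}. \<bar>u n - c k\<bar>) \<le> (\<Sum>n\<in>{s k..<L k}. 4 * (1/2) ^ k)"
      using block by (intro sum_mono) (auto simp: L_def c_def)
    also have "(\<Sum>n\<in>{s k..<L k}. 4 * (1/2) ^ k :: real) \<le> real (L k) * (4 * (1/2) ^ k)"
      unfolding sum_constant by (intro mult_right_mono) auto
    finally have tot: "(\<Sum>n<L k. \<bar>u n - c k\<bar>) \<le> real (s k) + real (L k) * (4 * (1/2) ^ k)" by simp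
    have "(1 / real (L k)) * (\<Sum>n<L k. u n) - c k = (\<Sum>n<L k. u n - c k) / real (L k)"
      using L0 by (simp add: sum_subtractf field_simps)
    then have "\<bar>(1 / real (L k)) * (\<Sum>n<L k. u n) - c k\<bar> = \<bar>\<Sum>n<L k. u n - c k\<bar> / real (L k)"
      by (simp add: abs_divide)
    also have "\<dots> \<le> (real (s k) + real (L k) * (4 * (1/2) ^ k)) / real (L k)"
      using order_trans[OF sum_abs tot] by (intro divide_right_mono) auto
    also have "\<dots> = real (s k) / real (L k) + 4 * (1/2) ^ k" using L0 by (simp add: add_divide_distrib)
    also have "real (s k) / real (L k) = 1 / real (k + 1)"
      using s[of k] unfolding L_def of_nat_mult by simp
    finally show ?thesis .
  qed
  have "(\<lambda>k. 1 / real (k + 1) + 4 * (1/2) ^ k) \<longlonglongrightarrow> 0 + 0"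
    using LIMSEQ_Suc[OF lim_1_over_n[where 'a=real]] tendsto_mult_right_zero[OF LIMSEQ_realpow_zero[of "1/2"], of 4]
    by (intro tendsto_add) auto
  then have z: "(\<lambda>k. 1 / real (k + 1) + 4 * (1/2) ^ k) \<longlonglongrightarrow> 0" by simp
  have "(\<lambda>k. (1 / real (L k)) * (\<Sum>n<L k. u n) - c k) \<longlonglongrightarrow> 0"
    by (rule Lim_null_comparison[OF _ z]) (use close in \<open>simp add: always_eventually\<close>)
  then have "(\<lambda>k. (1 / real (L k)) * (\<Sum>n<L k. u n) - ((1 / real (L k)) * (\<Sum>n<L k. u n) - c k)) \<longlonglongrightarrow> l - 0"
    by (rule tendsto_diff[OF lim])
  then have cl: "c \<longlonglongrightarrow> l" by simp
  have "(\<lambda>k. c (2 * k)) \<longlonglongrightarrow> l"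
    using LIMSEQ_subseq_LIMSEQ[OF cl, of "\<lambda>k. 2 * k"] by (simp add: strict_mono_def o_def)
  then have "1/4 = l" by (simp add: c_def LIMSEQ_const_iff)
  moreover have "(\<lambda>k. c (2 * k + 1)) \<longlonglongrightarrow> l"
    using LIMSEQ_subseq_LIMSEQ[OF cl, of "\<lambda>k. 2 * k + 1"] by (simp add: strict_mono_def o_def)
  then have "1/2 = l" by (simp add: c_def LIMSEQ_const_iff)
  ultimately show False by simp
qed

text \<open>Block \<open>k\<close> consists of the \<open>n\<close> from \<open>s k\<close> up to \<open>(k + 1) * s k\<close>; its times \<open>P1 n\<close> and \<open>P2 n\<close> must be within
  reach of scale \<open>k\<close>. The gap is required from all earlier times, also those before the block, so that
  the coins read in the block are new.\<close>

locale matched_tower = tower Q W D H for Q W D H :: "nat \<Rightarrow> nat" +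
  fixes P1 P2 s :: "nat \<Rightarrow> nat"
  assumes s_pos: "\<And>k. 0 < s k"
    and P_le_H: "\<And>k n. n < (k + 1) * s k \<Longrightarrow> P1 n \<le> H k" "\<And>k n. n < (k + 1) * s k \<Longrightarrow> P2 n \<le> H k"
    and P_gap: "\<And>k j n. s k \<le> n \<Longrightarrow> j < n \<Longrightarrow> P1 j + D k * (2 * W k + 3) \<le> P1 n"
      "\<And>k j n. s k \<le> n \<Longrightarrow> j < n \<Longrightarrow> P2 j + D k * (2 * W k + 3) \<le> P2 n"
    and blocks_disjoint: "\<And>k. (k + 1) * s k \<le> s (Suc k)"
begin

text \<open>The coin read by \<open>T\<close> at time \<open>P1 n\<close> is \<open>b w n\<close>, and the one read by \<open>T\<close> at time \<open>P2 n\<close> is \<open>a w n\<close>.\<close>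

definition b where "b w n = cocycle (P1 n) w"
definition a where "a w n = cocycle (P2 n) w"

definition block :: "nat \<Rightarrow> nat set" where "block k = {s k..<(k + 1) * s k}"

definition odd_times :: "nat set" where "odd_times = (\<Union>k\<in>{k. odd k}. block k)"

text \<open>Times in odd blocks whose coins occur at no earlier time. This makes the coins of different used
  times distinct for every \<open>w\<close>; over the points of \<open>good k\<close>, with \<open>k\<close> odd, no time of block \<open>k\<close> is lost.\<close>

definition used :: "(nat \<Rightarrow> nat) \<Rightarrow> nat set" where
  "used w = {n\<in>odd_times. 0 < a w n \<and> 0 < b w n \<and> (\<forall>j<n. a w j \<noteq> a w n \<and> b w j \<noteq> b w n)}"

lemma swap_times: "swap_times (used w) (a w) (b w)"
proof
  show "inj_on (a w) (used w)" "inj_on (b w) (used w)"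
    unfolding inj_on_def used_def by (metis (mono_tags, lifting) linorder_neqE_nat mem_Collect_eq)+
qed (auto simp: used_def)

text \<open>The minus sign sends the positive coins \<open>a w n\<close> to negative ones, away from the positive coins
  \<open>b w n\<close> read by \<open>T\<close>. At the used times the swap then brings the two together.\<close>

definition perm :: "(nat \<Rightarrow> nat) \<Rightarrow> int \<Rightarrow> int" where
  "perm w i = swap (used w) (a w) (b w) (- i)"

lemma bij_perm: "bij (perm w)"
  unfolding perm_def[abs_def] by (rule swap_times.bij_swap_uminus[OF swap_times])

lemma perm_0: "perm w 0 = 0"
  unfolding perm_def using swap_times.swap_0[OF swap_times] by simp

lemma perm_measurable: "(\<lambda>w. perm w i) \<in> measurable base (count_space UNIV)"
proof (rule measurable_count_spaceI)
  fix j
  have co: "{w. R (cocycle t w)} \<in> sets base" for t R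
    using measurable_sets[OF cocycle_measurable[of t], of "{c. R c}"] by (simp add: space_base vimage_def)
  have co2: "{w. R (cocycle t w) (cocycle t' w)} \<in> sets base" for t t' and R :: "int \<Rightarrow> int \<Rightarrow> bool"
    using measurable_sets[OF measurable_binary_count_space[OF cocycle_measurable[of t] cocycle_measurable[of t'], of R], of "{True}"]
    by (simp add: space_base vimage_def)
  have B: "{w\<in>space base. a w n > 0} \<in> sets base" "{w\<in>space base. b w n > 0} \<in> sets base"
    "{w\<in>space base. a w j \<noteq> a w n} \<in> sets base" "{w\<in>space base. b w j \<noteq> b w n} \<in> sets base"
    "{w\<in>space base. i = - a w n} \<in> sets base" "{w\<in>space base. i = b w n} \<in> sets base"
    "{w\<in>space base. i \<noteq> - a w n} \<in> sets base" "{w\<in>space base. i \<noteq> b w n} \<in> sets base" for n j i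
    unfolding a_def b_def space_base
    using co[of "\<lambda>c. c > 0"] co2[of "\<lambda>c d. c \<noteq> d"] co[of "\<lambda>c. i = - c"] co[of "\<lambda>c. i = c"]
      co[of "\<lambda>c. i \<noteq> - c"] co[of "\<lambda>c. i \<noteq> c"] by simp_all
  have used: "{w\<in>space base. n \<in> used w} \<in> sets base" for n
    unfolding used_def mem_Collect_eq
    by (intro sets.sets_Collect_conj sets.sets_Collect_const sets.sets_Collect_countable_All sets.sets_Collect_imp B)
  have not_used: "{w\<in>space base. \<not> n \<in> used w} \<in> sets base" for n
    by (intro sets.sets_Collect_neg used)
  show "{w\<in>space base. perm w i = j} \<in> sets base"
    unfolding perm_def swap_times.swap_eq_iff[OF swap_times]
    by (intro sets.sets_Collect_disj sets.sets_Collect_conj sets.sets_Collect_const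
        sets.sets_Collect_countable_Ex sets.sets_Collect_countable_All sets.sets_Collect_imp used not_used B)
qed

definition shuffle :: "(nat \<Rightarrow> nat) \<times> (int \<Rightarrow> bool) \<Rightarrow> (nat \<Rightarrow> nat) \<times> (int \<Rightarrow> bool)" where
  "shuffle = skew id perm"

definition S where "S = inv shuffle \<circ> T \<circ> shuffle"

lemma shuffle: "bij shuffle" "shuffle \<in> measurable N N" "inv shuffle \<in> measurable N N" "distr N N shuffle = N"
proof -
  have id: "id \<in> measurable base base" "inv id \<in> measurable base base" "distr base base id = base"
    by (simp_all add: id_def distr_id inv_id[unfolded id_def])
  have inj: "inj (perm w)" for w using bij_perm by (rule bij_is_inj)
  show "bij shuffle" unfolding shuffle_def by (rule skew_bij(1)[OF bij_id bij_perm])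
  show "shuffle \<in> measurable N N" unfolding shuffle_def by (rule skew_measurable[OF id(1) perm_measurable])
  show "inv shuffle \<in> measurable N N" unfolding shuffle_def
    by (rule skew_inv_measurable[OF bij_id id(2) bij_perm perm_measurable])
  show "distr N N shuffle = N" unfolding shuffle_def
    by (rule skew_measure_preserving[OF prob_space_base id(1,3) perm_measurable inj])
qed

lemma S_rigid_ergodic: "rigid_ergodic_mpt N S"
  unfolding S_def
  by (rule full_prob_space.rigid_ergodic_mpt_conj[OF full_prob_space_N T_rigid_ergodic shuffle])

definition heads :: "((nat \<Rightarrow> nat) \<times> (int \<Rightarrow> bool)) set" where "heads = {x. snd x 0}"

lemma coins_heads: "measure coins {y. y i} = 1/2"
  using measure_box[of "{i}" "\<lambda>_. pmf_of_set (UNIV :: bool set)" "\<lambda>_. {True}"]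
  by (simp add: measure_pmf_of_set)

lemma coins_heads2: "i \<noteq> j \<Longrightarrow> measure coins {y. y i \<and> y j} = 1/4"
  using measure_box[of "{i, j}" "\<lambda>_. pmf_of_set (UNIV :: bool set)" "\<lambda>_. {True}"]
  by (simp add: measure_pmf_of_set)

lemma coins_heads_sets: "{y. y i} \<in> sets coins"
  using box_sets[of "{i}" "\<lambda>_. {True}" "\<lambda>_. pmf_of_set (UNIV :: bool set)"] by simp

lemma heads: "heads \<in> sets N" "measure N heads = 1/2"
proof -
  interpret c: prob_space coins by (rule prob_space_coins)
  interpret b: prob_space base by (rule prob_space_base)
  have eq: "heads = UNIV \<times> {y. y 0}" by (auto simp: heads_def)
  have U: "UNIV \<in> sets base" using sets.top[of base] by (simp add: space_base)
  show "heads \<in> sets N" unfolding eq using U coins_heads_sets by (rule pair_measureI)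
  show "measure N heads = 1/2"
    unfolding eq using U coins_heads_sets[of 0] b.prob_space coins_heads[of 0]
    by (simp add: measure_def c.emeasure_pair_measure_Times enn2real_mult space_base)
qed

lemma T_heads: "(T ^^ t) (w, y) \<in> heads \<longleftrightarrow> y (cocycle t w)"
  by (simp add: T_funpow skew_def heads_def)

text \<open>The renaming at the end point of the orbit does not matter because it fixes coin \<open>0\<close>.\<close>

lemma S_heads: "(S ^^ t) (w, y) \<in> heads \<longleftrightarrow> y (perm w (cocycle t w))"
proof -
  have i: "inv shuffle = skew id (\<lambda>w. inv (perm w))"
    unfolding shuffle_def by (subst skew_bij(2)[OF bij_id bij_perm]) simp
  have p: "inv (perm v) 0 = 0" for v
    using perm_0[of v] bij_is_inj[OF bij_perm[of v]] by (metis inv_f_f)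
  have "S ^^ t = inv shuffle \<circ> T ^^ t \<circ> shuffle"
    unfolding S_def by (rule full_prob_space.funpow_conj[OF full_prob_space_N shuffle(1)])
  moreover have "shuffle (w, y) = (w, \<lambda>i. y (perm w i))" by (simp add: shuffle_def skew_def)
  moreover have "inv shuffle (v, z) = (v, \<lambda>i. z (inv (perm v) i))" for v z by (simp add: i skew_def)
  ultimately show ?thesis by (simp add: T_funpow skew_def heads_def p)
qed

lemma block_unique:
  assumes "n \<in> block k" "n \<in> block l" shows "k = l"
proof -
  have mono: "s k \<le> s l" if "k \<le> l" for k l
  proof (rule lift_Suc_mono_le[OF _ that])
    show "s n \<le> s (Suc n)" for n using blocks_disjoint[of n] by simp
  qed
  have "False" if "k < l" "n \<in> block k" "n \<in> block l" for k l
    using that blocks_disjoint[of k] mono[of "Suc k" l] by (simp add: block_def)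
  then show ?thesis using assms by (metis linorder_neqE_nat)
qed

lemma good_times:
  assumes n: "n \<in> block k" and w: "w \<in> good k"
  shows "0 < a w n" "0 < b w n" "j < n \<Longrightarrow> a w j < a w n" "j < n \<Longrightarrow> b w j < b w n"
proof -
  have sn: "s k \<le> n" "n < (k + 1) * s k" using n by (auto simp: block_def)
  have n0: "0 < n" using s_pos[of k] sn by simp
  have c0: "cocycle 0 w = 0" by (simp add: cocycle_def)
  have "0 + D k * (2 * W k + 3) \<le> P1 n" "0 + D k * (2 * W k + 3) \<le> P2 n"
    using P_gap[OF sn(1) n0] by linarith+
  from this[THEN cocycle_good_less[OF w]] show "0 < a w n" "0 < b w n"
    using P_le_H[OF sn(2)] by (simp_all add: a_def b_def c0)
  show "a w j < a w n" if "j < n"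
    unfolding a_def by (rule cocycle_good_less[OF w P_gap(2)[OF sn(1) that] P_le_H(2)[OF sn(2)]])
  show "b w j < b w n" if "j < n"
    unfolding b_def by (rule cocycle_good_less[OF w P_gap(1)[OF sn(1) that] P_le_H(1)[OF sn(2)]])
qed

lemma perm_odd:
  assumes "n \<in> block k" "w \<in> good k" "odd k"
  shows "perm w (a w n) = b w n"
proof -
  have "n \<in> odd_times" using assms by (auto simp: odd_times_def)
  then have "n \<in> used w" using good_times[OF assms(1,2)] by (force simp: used_def)
  then show ?thesis unfolding perm_def by (rule swap_times.swap_minus_a[OF swap_times])
qed

text \<open>The coin \<open>- a w n\<close> takes part in no swap: an earlier time has a smaller \<open>a\<close>, and a later time with the
  same \<open>a\<close> is not used. So \<open>S\<close> reads a negative coin and \<open>T\<close> a positive one.\<close>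

lemma perm_even:
  assumes n: "n \<in> block k" and w: "w \<in> good k" and k: "even k"
  shows "perm w (a w n) \<noteq> b w n"
proof -
  note g = good_times[OF n w]
  have "- a w n \<noteq> - a w j \<and> - a w n \<noteq> b w j" if j: "j \<in> used w" for j
  proof -
    have "j \<noteq> n" using j block_unique[OF n] k by (auto simp: used_def odd_times_def)
    moreover have "a w n \<noteq> a w j" if "n < j" using j that by (auto simp: used_def)
    moreover have "a w j < a w n" if "j < n" using g(3)[OF that] .
    moreover have "0 < b w j" using j by (simp add: used_def)
    ultimately show ?thesis using g(1) by (metis linorder_neqE_nat less_irrefl neg_equal_iff_equal neg_less_0_iff_less not_less_iff_gr_or_eq)
  qed
  then have "perm w (a w n) = - a w n" unfolding perm_def by (intro swap_times.swap_other[OF swap_times])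
  then show ?thesis using g by simp
qed

text \<open>Over good points both events are decided by one and the same coin if \<open>k\<close> is odd, and by two
  different coins if \<open>k\<close> is even.\<close>

lemma block_correlation:
  assumes n: "n \<in> block k"
  shows "\<bar>measure N ((T ^^ P1 n) -` heads \<inter> (S ^^ P2 n) -` heads) - (if odd k then 1/2 else 1/4)\<bar> \<le> 4 * (1/2) ^ k"
proof -
  interpret base: prob_space base by (rule prob_space_base)
  let ?C = "(T ^^ P1 n) -` heads \<inter> (S ^^ P2 n) -` heads" and ?c = "if odd k then 1/2 else 1/4 :: real"
  have meas: "T \<in> measurable N N" "S \<in> measurable N N"
    using T_rigid_ergodic S_rigid_ergodic by (auto simp: rigid_ergodic_mpt_def)
  have "(R ^^ t) -` heads \<in> sets N" if "R \<in> measurable N N" for R t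
    using measurable_sets[OF funpow_measurable[OF that] heads(1), of t] by (simp only: space_N Int_UNIV_right)
  then have C: "?C \<in> sets N" using meas by (intro sets.Int)
  have fib: "Pair w -` ?C = {y. y (b w n) \<and> y (perm w (a w n))}" for w
    by (simp add: set_eq_iff T_heads S_heads a_def b_def)
  have eq: "measure coins (Pair w -` ?C) = ?c" if w: "w \<in> good k" for w
  proof (cases "odd k")
    case True
    then show ?thesis unfolding fib perm_odd[OF n w True] by (simp add: coins_heads)
  next
    case False
    then have "b w n \<noteq> perm w (a w n)" using perm_even[OF n w] by auto
    then show ?thesis unfolding fib using False by (simp add: coins_heads2)
  qed
  have "\<bar>measure N ?C - (\<integral>w. ?c \<partial>base)\<bar> \<le> 1 - measure base (good k)"
    by (rule measure_close_by_fibres[OF prob_space_base C good_prob(1) _ _ _ eq]) auto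
  moreover have "(\<integral>w. ?c \<partial>base) = ?c" by (simp add: base.prob_space)
  ultimately show ?thesis using good_prob(2)[of k] by linarith
qed

end

section \<open>Polynomial times, choice of the parameters, and the conclusion\<close>

instance bool :: second_countable_topology
proof
  show "\<exists>B::bool set set. countable B \<and> open = generate_topology B"
    by (intro exI[of _ UNIV]) (auto simp: Topological_Spaces.open_discrete generate_topology.Basis fun_eq_iff)
qed

lemma poly_eventually_ge:
  fixes p :: "real poly"
  assumes "degree p \<ge> 1" "lead_coeff p > 0"
  shows "\<exists>X. \<forall>x\<ge>X. B \<le> poly p x"
proof -
  obtain a r where p: "p = pCons a r" by (cases p)
  then have r: "r \<noteq> 0" using assms(1) by auto
  then have lc: "lead_coeff r > 0" using assms(2) p by simp
  obtain n where n: "\<And>x. n \<le> x \<Longrightarrow> lead_coeff r \<le> poly r x" using poly_pinfty_gt_lc[OF lc] by blast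
  define X where "X = max n (max 0 ((B - a) / lead_coeff r))"
  have "B \<le> poly p x" if "X \<le> x" for x
  proof -
    have x: "n \<le> x" "0 \<le> x" "(B - a) / lead_coeff r \<le> x" using that by (auto simp: X_def)
    have "B - a \<le> x * lead_coeff r" using x(3) lc by (simp add: pos_divide_le_eq)
    also have "\<dots> \<le> x * poly r x" using n[OF x(1)] x(2) by (rule mult_left_mono)
    finally show ?thesis by (simp add: p)
  qed
  then show ?thesis by blast
qed

text \<open>By the mean value theorem, since the derivative has degree at least \<open>1\<close>. This is where the
  degree of the polynomials matters.\<close>

lemma poly_increment_eventually_ge:
  fixes p :: "real poly"
  assumes "degree p \<ge> 2" "lead_coeff p > 0"
  shows "\<exists>X. \<forall>x\<ge>X. B \<le> poly p (x + 1) - poly p x"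
proof -
  have d: "degree (pderiv p) \<ge> 1" "lead_coeff (pderiv p) > 0"
    using assms by (auto simp: degree_pderiv coeff_pderiv)
  obtain X where X: "\<And>x. X \<le> x \<Longrightarrow> B \<le> poly (pderiv p) x" using poly_eventually_ge[OF d] by blast
  have "B \<le> poly p (x + 1) - poly p x" if "X \<le> x" for x
  proof -
    obtain y where "x < y" "poly p (x + 1) - poly p x = (x + 1 - x) * poly (pderiv p) y"
      using poly_MVT[of x "x + 1" p] by auto
    then show ?thesis using X[of y] that by simp
  qed
  then show ?thesis by blast
qed

definition gaps_to_infinity :: "(nat \<Rightarrow> nat) \<Rightarrow> bool" where
  "gaps_to_infinity P \<longleftrightarrow> (\<forall>g. \<exists>s. \<forall>n\<ge>s. \<forall>j<n. P j + g \<le> P n)"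

lemma gaps_to_infinityI:
  fixes F :: "nat \<Rightarrow> int"
  assumes inc: "\<And>g. \<exists>s. \<forall>n\<ge>s. g \<le> F (Suc n) - F n" and lim: "\<And>g. \<exists>s. \<forall>n\<ge>s. g \<le> F n"
  shows "gaps_to_infinity (\<lambda>n. nat \<bar>F n\<bar>)"
  unfolding gaps_to_infinity_def
proof
  fix g
  obtain s0 where s0: "\<And>n. n \<ge> s0 \<Longrightarrow> int g \<le> F (Suc n) - F n" using inc by blast
  obtain s1 where s1: "\<And>n. n \<ge> s1 \<Longrightarrow> 0 \<le> F n" using lim by blast
  define r where "r = max s0 s1"
  define B where "B = (\<Sum>j<r. nat \<bar>F j\<bar>) + g"
  obtain s2 where s2: "\<And>n. n \<ge> s2 \<Longrightarrow> int B \<le> F n" using lim by blast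
  have mono: "F i \<le> F j" if "r \<le> i" "i \<le> j" for i j
    using that(2)
  proof (induction rule: dec_induct)
    case (step k)
    have "F k \<le> F (Suc k)" using s0[of k] step.hyps that(1) by (simp add: r_def)
    with step.IH show ?case by (rule order_trans)
  qed simp
  have "nat \<bar>F j\<bar> + g \<le> nat \<bar>F n\<bar>" if n: "max r s2 \<le> n" and j: "j < n" for n j
  proof (cases "j < r")
    case True
    then have "nat \<bar>F j\<bar> \<le> (\<Sum>j<r. nat \<bar>F j\<bar>)" by (intro member_le_sum) auto
    then have "nat \<bar>F j\<bar> + g \<le> B" unfolding B_def by simp
    moreover have "int B \<le> F n" using s2[of n] n by simp
    ultimately show ?thesis by linarith
  next
    case False
    then have jr: "r \<le> j" by simp
    have "F j + int g \<le> F (Suc j)" using s0[of j] jr by (simp add: r_def)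
    also have "\<dots> \<le> F n" using jr j by (intro mono) auto
    finally show ?thesis using s1[of j] jr by (simp add: r_def)
  qed
  then show "\<exists>s. \<forall>n\<ge>s. \<forall>j<n. nat \<bar>F j\<bar> + g \<le> nat \<bar>F n\<bar>" by blast
qed

text \<open>After multiplication by the sign \<open>e\<close> of the leading coefficient, values and increments tend to
  \<open>\<infinity>\<close>.\<close>

lemma int_valued_poly_gaps:
  assumes p: "int_valued_poly p q" and deg: "degree q \<ge> 2"
  obtains e :: int and m where "e = 1 \<or> e = - 1"
    "\<And>n. n \<ge> m \<Longrightarrow> p (int n) = e * \<bar>p (int n)\<bar>" "gaps_to_infinity (\<lambda>n. nat \<bar>p (int n)\<bar>)"
proof -
  define e :: int where "e = (if lead_coeff q > 0 then 1 else - 1)"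
  define r where "r = smult (real_of_int e) q"
  define F where "F n = e * p (int n)" for n
  have e: "e = 1 \<or> e = - 1" by (simp add: e_def)
  have q0: "lead_coeff q \<noteq> 0" using deg by (metis degree_0 leading_coeff_0_iff not_numeral_le_zero)
  have r: "degree r \<ge> 2" "lead_coeff r > 0" using deg q0 unfolding r_def e_def by (auto simp: not_less order.order_iff_strict)
  have F: "real_of_int (F n) = poly r (real n)" for n
    using p by (simp add: F_def r_def int_valued_poly_def)
  have inc: "\<exists>s. \<forall>n\<ge>s. g \<le> F (Suc n) - F n" for g
  proof -
    obtain X where X: "\<And>x. X \<le> x \<Longrightarrow> real_of_int g \<le> poly r (x + 1) - poly r x"
      using poly_increment_eventually_ge[OF r] by blast
    have "g \<le> F (Suc n) - F n" if "n \<ge> nat \<lceil>X\<rceil>" for n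
    proof -
      have "X \<le> real n" using that by linarith
      from X[OF this] have "real_of_int g \<le> real_of_int (F (Suc n) - F n)" by (simp add: F add.commute)
      then show ?thesis by (simp only: of_int_le_iff)
    qed
    then show ?thesis by blast
  qed
  have lim: "\<exists>s. \<forall>n\<ge>s. g \<le> F n" for g
  proof -
    have "degree r \<ge> 1" using r by simp
    from poly_eventually_ge[OF this r(2)] obtain X where X: "\<And>x. X \<le> x \<Longrightarrow> real_of_int g \<le> poly r x" by blast
    have "g \<le> F n" if "n \<ge> nat \<lceil>X\<rceil>" for n
    proof -
      have "X \<le> real n" using that by linarith
      from X[OF this] show ?thesis by (simp flip: F)
    qed
    then show ?thesis by blast
  qed
  obtain m where m: "\<And>n. n \<ge> m \<Longrightarrow> 0 \<le> F n" using lim by blast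
  have ee: "e * e = 1" using e by auto
  have absF: "\<bar>F n\<bar> = \<bar>p (int n)\<bar>" for n using e by (auto simp: F_def)
  show ?thesis
  proof (rule that[OF e])
    fix n assume "n \<ge> m"
    then have "\<bar>p (int n)\<bar> = F n" using m absF[of n] by simp
    then show "p (int n) = e * \<bar>p (int n)\<bar>" using e by (auto simp: F_def)
  next
    show "gaps_to_infinity (\<lambda>n. nat \<bar>p (int n)\<bar>)"
      using gaps_to_infinityI[OF inc lim] by (simp add: absF)
  qed
qed

text \<open>The parameters of scale \<open>k\<close> are chosen from \<open>w = W k\<close> in the order \<open>D\<close>, \<open>s\<close>, \<open>H\<close>, \<open>Q\<close>. As \<open>w\<close> divides \<open>D k\<close>,
  a number of the form \<open>D k * c + 1\<close> is coprime to \<open>w\<close>.\<close>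

lemma matched_tower_exists:
  assumes P1: "gaps_to_infinity P1" and P2: "gaps_to_infinity P2"
  obtains Q W D H s where "matched_tower Q W D H P1 P2 s" "\<And>k. m \<le> s k"
proof -
  have "\<exists>s. s \<ge> max (max w m) 1 \<and> (\<forall>n\<ge>s. \<forall>j<n. P1 j + g \<le> P1 n \<and> P2 j + g \<le> P2 n)" for w g
  proof -
    obtain s1 s2 where "\<forall>n\<ge>s1. \<forall>j<n. P1 j + g \<le> P1 n" "\<forall>n\<ge>s2. \<forall>j<n. P2 j + g \<le> P2 n"
      using P1 P2 unfolding gaps_to_infinity_def by blast
    then show ?thesis by (intro exI[of _ "max (max (max w m) 1) (max s1 s2)"]) auto
  qed
  note ex_s = this
  define \<sigma> where "\<sigma> w g = (SOME s. s \<ge> max (max w m) 1 \<and>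
    (\<forall>n\<ge>s. \<forall>j<n. P1 j + g \<le> P1 n \<and> P2 j + g \<le> P2 n))" for w g
  have \<sigma>: "\<sigma> w g \<ge> max (max w m) 1"
    "\<And>n j. n \<ge> \<sigma> w g \<Longrightarrow> j < n \<Longrightarrow> P1 j + g \<le> P1 n \<and> P2 j + g \<le> P2 n" for w g
    using someI_ex[OF ex_s[of w g]] unfolding \<sigma>_def by blast+
  define d where "d k w = 2 ^ k * w" for k w :: nat
  define s' where "s' k w = \<sigma> w (d k w * (2 * w + 3))" for k w
  \<comment> \<open>\<open>h\<close> is a sum of all the quantities that it must dominate.\<close>
  define h where "h k w = (\<Sum>n<(k + 1) * s' k w. P1 n + P2 n) + (d k w * (w + k) + w) + (k + 1) * s' k w" for k w
  define q where "q k w = d k w * (2 ^ k * h k w + 1) + 1" for k w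
  define W where "W = rec_nat 1 (\<lambda>k w. w * q k w)"
  have W: "W 0 = 1" "W (Suc k) = W k * q k (W k)" for k by (simp_all add: W_def)
  have W1: "1 \<le> W k" for k by (induction k) (simp_all add: W q_def)
  have d1: "1 \<le> d k (W k)" for k using W1[of k] by (simp add: d_def)
  have hq: "2 ^ k * h k (W k) \<le> q k (W k)" for k
  proof -
    have "x \<le> y * (x + 1) + 1" if "1 \<le> y" for x y :: nat
      using that by (cases y) auto
    from this[OF d1] show ?thesis unfolding q_def .
  qed
  have s'1: "max (max (W k) m) 1 \<le> s' k (W k)" for k unfolding s'_def by (rule \<sigma>(1))
  have tower: "matched_tower (\<lambda>k. q k (W k)) W (\<lambda>k. d k (W k)) (\<lambda>k. h k (W k)) P1 P2 (\<lambda>k. s' k (W k))"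
  proof
    fix k
    show "W 0 = 1" "W (Suc k) = W k * q k (W k)" by (rule W)+
    show "d k (W k) = 2 ^ k * W k" by (simp add: d_def)
    show "coprime (q k (W k)) (W k)"
    proof (rule coprimeI)
      fix c assume c: "c dvd q k (W k)" "c dvd W k"
      then have "c dvd d k (W k) * (2 ^ k * h k (W k) + 1)" by (simp add: d_def)
      then show "is_unit c" using c(1) unfolding q_def by (simp only: dvd_add_right_iff)
    qed
    show "d k (W k) \<le> q k (W k)" by (simp add: q_def)
    show "2 ^ k * h k (W k) \<le> q k (W k)" by (rule hq)
    show "d k (W k) * (W k + k) + W k \<le> h k (W k)" by (simp add: h_def)
    show "0 < s' k (W k)" using s'1[of k] by simp
    show "P1 n \<le> h k (W k)" "P2 n \<le> h k (W k)" if "n < (k + 1) * s' k (W k)" for n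
    proof -
      have "P1 n + P2 n \<le> (\<Sum>n<(k + 1) * s' k (W k). P1 n + P2 n)"
        using that by (intro member_le_sum) auto
      then show "P1 n \<le> h k (W k)" "P2 n \<le> h k (W k)" by (simp_all add: h_def)
    qed
    show "P1 j + d k (W k) * (2 * W k + 3) \<le> P1 n" "P2 j + d k (W k) * (2 * W k + 3) \<le> P2 n"
      if "s' k (W k) \<le> n" "j < n" for j n
      using \<sigma>(2)[OF that(1)[unfolded s'_def] that(2)] by auto
    show "(k + 1) * s' k (W k) \<le> s' (Suc k) (W (Suc k))"
    proof -
      have "(k + 1) * s' k (W k) \<le> h k (W k)" by (simp add: h_def)
      also have "1 * h k (W k) \<le> 2 ^ k * h k (W k)" by (rule mult_right_mono) auto
      then have "h k (W k) \<le> q k (W k)" using hq[of k] by linarith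
      also have "1 * q k (W k) \<le> W k * q k (W k)" using W1 by (rule mult_right_mono) simp
      then have "q k (W k) \<le> W (Suc k)" by (simp add: W)
      also have "\<dots> \<le> s' (Suc k) (W (Suc k))" using s'1[of "Suc k"] by simp
      finally show ?thesis .
    qed
  qed
  show ?thesis by (rule that[OF tower]) (use s'1 in auto)
qed

lemma ex_injection_into_reals: "\<exists>f :: (nat \<Rightarrow> nat) \<times> (int \<Rightarrow> bool) \<Rightarrow> real. inj f"
proof -
  obtain h :: "nat set \<Rightarrow> real" where h: "bij_betw h UNIV UNIV"
    using nat_sets_eqpoll_reals unfolding eqpoll_def by blast
  define G where "G x = range (\<lambda>k. Inl (k, fst x k)) \<union> Inr ` {i. snd x i}"
    for x :: "(nat \<Rightarrow> nat) \<times> (int \<Rightarrow> bool)"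
  have "inj G"
  proof (rule injI)
    fix x y assume eq: "G x = G y"
    have 1: "Inl (k, v) \<in> G z \<longleftrightarrow> v = fst z k" for k v z by (auto simp: G_def)
    have 2: "Inr i \<in> G z \<longleftrightarrow> snd z i" for i z by (auto simp: G_def)
    have "fst x = fst y" using 1[of _ _ x] 1[of _ _ y] eq by (intro ext) metis
    moreover have "snd x = snd y" using 2[of _ x] 2[of _ y] eq by (intro ext) metis
    ultimately show "x = y" by (rule prod_eqI)
  qed
  moreover have "inj (\<lambda>A :: (nat \<times> nat + int) set. to_nat ` A)"
    by (rule injI) (simp add: inj_image_eq_iff)
  moreover have "inj h" using h by (simp add: bij_betw_def)
  ultimately have "inj (h \<circ> ((\<lambda>A. to_nat ` A) \<circ> G))" by (intro inj_compose)
  then show ?thesis by blast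
qed

lemma (in tower) sets_N_eq_borel: "sets N = sigma_sets UNIV {U. openin euclidean U}"
proof -
  have "sets base = sets (PiM UNIV (\<lambda>_. borel :: nat measure))"
    by (intro sets_PiM_cong refl) (simp add: sets_borel_eq_count_space)
  moreover have "sets coins = sets (PiM UNIV (\<lambda>_. borel :: bool measure))"
    by (intro sets_PiM_cong refl) (simp add: sets_borel_eq_count_space)
  ultimately have "sets N = sets (borel \<Otimes>\<^sub>M borel :: ((nat \<Rightarrow> nat) \<times> (int \<Rightarrow> bool)) measure)"
    by (intro sets_pair_measure_cong) (simp_all add: sets_PiM_equal_borel)
  then have "sets N = sets (borel :: ((nat \<Rightarrow> nat) \<times> (int \<Rightarrow> bool)) measure)"
    unfolding borel_prod .
  then show ?thesis unfolding borel_def by (simp add: sets_measure_of)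
qed

theorem theorem1p2:
  fixes p1 p2 :: "int \<Rightarrow> int" and q1 q2 :: "real poly"
  assumes "int_valued_poly p1 q1" and "degree q1 \<ge> 2"
    and "int_valued_poly p2 q2" and "degree q2 \<ge> 2"
  shows "\<exists>(M :: real measure) T S A.
    standard_prob_space M \<and>
    invertible_mpt M T \<and> ergodic M T \<and> KS_entropy M T = 0 \<and>
    invertible_mpt M S \<and> ergodic M S \<and> KS_entropy M S = 0 \<and>
    A \<in> sets M \<and> measure M A > 0 \<and>
    \<not> L2_convergent M (\<lambda>N x. (1 / real N) *
        (\<Sum>n<N. indicator A (int_iterate M T (p1 (int n)) x) *
                indicator A (int_iterate M S (p2 (int n)) x)))"
proof -
  obtain e1 m1 where e1: "e1 = 1 \<or> e1 = - 1"
    and m1: "\<And>n. n \<ge> m1 \<Longrightarrow> p1 (int n) = e1 * \<bar>p1 (int n)\<bar>"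
    and g1: "gaps_to_infinity (\<lambda>n. nat \<bar>p1 (int n)\<bar>)"
    using int_valued_poly_gaps[OF assms(1,2)] by metis
  obtain e2 m2 where e2: "e2 = 1 \<or> e2 = - 1"
    and m2: "\<And>n. n \<ge> m2 \<Longrightarrow> p2 (int n) = e2 * \<bar>p2 (int n)\<bar>"
    and g2: "gaps_to_infinity (\<lambda>n. nat \<bar>p2 (int n)\<bar>)"
    using int_valued_poly_gaps[OF assms(3,4)] by metis
  obtain Q W D H s where tower: "matched_tower Q W D H (\<lambda>n. nat \<bar>p1 (int n)\<bar>) (\<lambda>n. nat \<bar>p2 (int n)\<bar>) s"
    and s: "\<And>k. max m1 m2 \<le> s k"
    using matched_tower_exists[OF g1 g2, of "max m1 m2"] by metis
  interpret matched_tower Q W D H "\<lambda>n. nat \<bar>p1 (int n)\<bar>" "\<lambda>n. nat \<bar>p2 (int n)\<bar>" s by (rule tower)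
  obtain f :: "(nat \<Rightarrow> nat) \<times> (int \<Rightarrow> bool) \<Rightarrow> real" where f: "inj f"
    using ex_injection_into_reals by blast
  interpret full: full_prob_space N by (rule full_prob_space_N)
  interpret tr: transport N f by unfold_locales (rule f)
  \<comment> \<open>If \<open>p1\<close> tends to \<open>-\<infinity>\<close>, the inverse of \<open>T\<close> at time \<open>p1 n\<close> is \<open>T\<close> at time \<open>\<bar>p1 n\<bar>\<close>; similarly for \<open>p2\<close>.\<close>
  define T' where "T' = (if e1 = 1 then T else inv T)"
  define S' where "S' = (if e2 = 1 then S else inv S)"
  have T': "rigid_ergodic_mpt N T'" and S': "rigid_ergodic_mpt N S'"
    using T_rigid_ergodic S_rigid_ergodic full.rigid_ergodic_mpt_inv by (auto simp: T'_def S'_def)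
  have bijTS: "bij T" "bij S" using T_rigid_ergodic S_rigid_ergodic by (auto simp: rigid_ergodic_mpt_def)
  have pow: "int_power (if e = 1 then R else inv R) k = R ^^ nat \<bar>k\<bar>"
    if "bij R" "e = 1 \<or> e = - 1" "k = e * \<bar>k\<bar>" for R :: "(nat \<Rightarrow> nat) \<times> (int \<Rightarrow> bool) \<Rightarrow> _" and e k :: int
    using that by (auto simp: int_power_inv) (auto simp: int_power_def abs_if)
  define u where "u n = measure N (int_power T' (p1 (int n)) -` heads \<inter> int_power S' (p2 (int n)) -` heads)" for n
  have "\<not> convergent (\<lambda>L. (1 / real L) * (\<Sum>n<L. u n))"
  proof (rule block_average_not_convergent[OF _ _ s_pos])
    fix k n assume n: "s k \<le> n" "n < (k + 1) * s k"
    then have "m1 \<le> n" "m2 \<le> n" using s[of k] by auto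
    then have "u n = measure N ((T ^^ nat \<bar>p1 (int n)\<bar>) -` heads \<inter> (S ^^ nat \<bar>p2 (int n)\<bar>) -` heads)"
      unfolding u_def T'_def S'_def using pow[OF bijTS(1) e1 m1] pow[OF bijTS(2) e2 m2] by simp
    then show "\<bar>u n - (if odd k then 1/2 else 1/4)\<bar> \<le> 4 * (1/2) ^ k"
      using block_correlation[of n k] n by (simp add: block_def)
  qed (auto simp: u_def)
  then have "\<not> L2_convergent tr.M (\<lambda>L x. (1 / real L) *
      (\<Sum>n<L. indicator (f ` heads) (int_iterate tr.M (tr.push T') (p1 (int n)) x) *
              indicator (f ` heads) (int_iterate tr.M (tr.push S') (p2 (int n)) x)))"
    unfolding u_def using T' S' heads(1)
    by (intro tr.push_not_L2_convergent) (auto simp: rigid_ergodic_mpt_def)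
  moreover have "standard_prob_space tr.M"
    by (rule tr.standard_M[of euclidean])
      (simp_all add: completely_metrizable_euclidean_nat_bool second_countable_euclidean sets_N_eq_borel)
  moreover have "f ` heads \<in> sets tr.M" "measure tr.M (f ` heads) > 0"
    using heads tr.sets_M tr.measure_M by auto
  moreover have "ergodic N T'" "ergodic N S'" using T' S' by (auto simp: rigid_ergodic_mpt_def)
  ultimately show ?thesis
    using tr.push_invertible_mpt[OF T'] tr.push_invertible_mpt[OF S'] tr.push_ergodic tr.push_KS_entropy[OF T'] tr.push_KS_entropy[OF S']
    by blast
qed

end
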